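(* Let $G$ be a countable discrete group acting transitively on a set $X$. Then the following are equivalent: (1) the action is Liouville with a symmetric measure, i.e., there exists a non-degenerate symmetric probability measure $\mu$ on $G$ such that the action of $G$ on $X$ is $\mu$-Liouville; (2) there exists a finitely additive probability measure $m$ on $G$ (defined on all subsets of $G$) such that $m\cdot x=m\cdot y$ for all $x,y\in X$; (3) for every $\varepsilon>0$ and every finite $F\subseteq X$ there exists a finite nonempty set $E\subset G$ such that $|Ex\,\Delta\, Ey|\le \varepsilon |E|$ for all $x,y\in F$, where $Ex$ and $Ey$ are counted with multiplicities.
   Context: A probability measure $\mu$ on $G$ is non-degenerate if its support generates $G$ as a semigroup, and symmetric if $\mu(g)=\mu(g^{-1})$ for all $g\in G$. For $x,y\in X$ put $p_\mu(x,y)=\sum_{g\in G,\ gx=y}\mu(g)$. A function $f:X\to\mathbb{R}$ is $\mu$-harmonic if $f(x)=\sum_{y\in X}f(y)p_\mu(x,y)$ for all $x\in X$. The action of $G$ on $X$ is $\mu$-Liouville if all bounded $\mu$-harmonic functions on $X$ are constant. For a finitely additive measure $m$ on $G$ and $x\in X$, $m\cdot x$ is the finitely additive measure on $X$ given by $(m\cdot x)(A)=m(\{g\in G: gx\in A\})$ for $A\subseteq X$. For a finite set $E\subset G$ and $x\in X$, $Ex$ denotes the multiset $\{gx: g\in E\}$, in which $z\in X$ has multiplicity $|\{g\in E: gx=z\}|$. Thus $|Ex\,\Delta\, Ey|=\sum_{z\in X}\bigl|\,|\{g\in E: gx=z\}|-|\{g\in E: gy=z\}|\,\bigr|$. *)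

theory Defs
  imports
    "HOL-Algebra.Group_Action"
    "HOL-Library.Multiset"
    "HOL-Probability.Probability_Mass_Function"
begin

text \<open>
  Actions are \<open>transitive_action G X \<phi>\<close>, where \<open>\<phi> g x\<close> is the point \<open>g x\<close>. A probability
  measure on the countable discrete group \<open>G\<close> is a \<open>'g pmf\<close> concentrated on \<open>carrier G\<close>.
\<close>

inductive_set semigroup_generated :: "('g, 'm) monoid_scheme \<Rightarrow> 'g set \<Rightarrow> 'g set"
  for G and S where
  base: "s \<in> S \<Longrightarrow> s \<in> semigroup_generated G S"
| mult: "s \<in> semigroup_generated G S \<Longrightarrow> t \<in> semigroup_generated G S \<Longrightarrow>
    s \<otimes>\<^bsub>G\<^esub> t \<in> semigroup_generated G S"

definition prob_on :: "('g, 'm) monoid_scheme \<Rightarrow> 'g pmf \<Rightarrow> bool" where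
  "prob_on G \<mu> \<longleftrightarrow> set_pmf \<mu> \<subseteq> carrier G"

definition nondegenerate :: "('g, 'm) monoid_scheme \<Rightarrow> 'g pmf \<Rightarrow> bool" where
  "nondegenerate G \<mu> \<longleftrightarrow> semigroup_generated G (set_pmf \<mu>) = carrier G"

definition symmetric_prob :: "('g, 'm) monoid_scheme \<Rightarrow> 'g pmf \<Rightarrow> bool" where
  "symmetric_prob G \<mu> \<longleftrightarrow> (\<forall>g\<in>carrier G. pmf \<mu> g = pmf \<mu> (inv\<^bsub>G\<^esub> g))"

definition trans_prob ::
    "('g, 'm) monoid_scheme \<Rightarrow> ('g \<Rightarrow> 'x \<Rightarrow> 'x) \<Rightarrow> 'g pmf \<Rightarrow> 'x \<Rightarrow> 'x \<Rightarrow> real" where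
  "trans_prob G \<phi> \<mu> x y = (\<Sum>\<^sub>\<infinity>g\<in>{g \<in> carrier G. \<phi> g x = y}. pmf \<mu> g)"

text \<open>
  A function on \<open>X\<close> is a total HOL function of which only the values on \<open>X\<close> matter.
  Convergence of the sum is part of harmonicity (it is automatic if \<open>f\<close> is bounded on \<open>X\<close>).
\<close>

definition harmonic_on ::
    "('g, 'm) monoid_scheme \<Rightarrow> 'x set \<Rightarrow> ('g \<Rightarrow> 'x \<Rightarrow> 'x) \<Rightarrow> 'g pmf \<Rightarrow> ('x \<Rightarrow> real) \<Rightarrow> bool" where
  "harmonic_on G X \<phi> \<mu> f \<longleftrightarrow>
     (\<forall>x\<in>X. ((\<lambda>y. f y * trans_prob G \<phi> \<mu> x y) has_sum f x) X)"

definition liouville ::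
    "('g, 'm) monoid_scheme \<Rightarrow> 'x set \<Rightarrow> ('g \<Rightarrow> 'x \<Rightarrow> 'x) \<Rightarrow> 'g pmf \<Rightarrow> bool" where
  "liouville G X \<phi> \<mu> \<longleftrightarrow>
     (\<forall>f. bounded (f ` X) \<and> harmonic_on G X \<phi> \<mu> f \<longrightarrow> (\<exists>c. \<forall>x\<in>X. f x = c))"

definition fin_add_prob :: "'g set \<Rightarrow> ('g set \<Rightarrow> real) \<Rightarrow> bool" where
  "fin_add_prob S m \<longleftrightarrow>
     (\<forall>A\<subseteq>S. 0 \<le> m A) \<and> Measure_Space.additive (Pow S) m \<and> m S = 1"

definition push_measure ::
    "('g, 'm) monoid_scheme \<Rightarrow> ('g \<Rightarrow> 'x \<Rightarrow> 'x) \<Rightarrow> ('g set \<Rightarrow> real) \<Rightarrow> 'x \<Rightarrow> 'x set \<Rightarrow> real" where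
  "push_measure G \<phi> m x A = m {g \<in> carrier G. \<phi> g x \<in> A}"

definition orbit_mset :: "('g \<Rightarrow> 'x \<Rightarrow> 'x) \<Rightarrow> 'g set \<Rightarrow> 'x \<Rightarrow> 'x multiset" where
  "orbit_mset \<phi> E x = image_mset (\<lambda>g. \<phi> g x) (mset_set E)"

definition sym_diff_mset :: "'x multiset \<Rightarrow> 'x multiset \<Rightarrow> 'x multiset" where
  "sym_diff_mset M N = (M - N) + (N - M)"

lemma count_orbit_mset:
  assumes "finite E"
  shows "count (orbit_mset \<phi> E x) z = card {g \<in> E. \<phi> g x = z}"
  using assms
proof (induction E rule: finite_induct)
  case empty
  then show ?case by (simp add: orbit_mset_def)
next
  case (insert h E)
  have "{g \<in> insert h E. \<phi> g x = z} =
      (if \<phi> h x = z then insert h {g \<in> E. \<phi> g x = z} else {g \<in> E. \<phi> g x = z})"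
    by auto
  then show ?case
    using insert by (simp add: orbit_mset_def)
qed

lemma size_sym_diff_mset:
  assumes "finite Z" "set_mset M \<subseteq> Z" "set_mset N \<subseteq> Z"
  shows "real (size (sym_diff_mset M N)) = (\<Sum>z\<in>Z. \<bar>real (count M z) - real (count N z)\<bar>)"
proof -
  have sub: "set_mset (sym_diff_mset M N) \<subseteq> Z"
    using assms(2,3) by (auto simp: sym_diff_mset_def dest: in_diffD)
  have "size (sym_diff_mset M N) = (\<Sum>z\<in>Z. count (sym_diff_mset M N) z)"
    unfolding size_multiset_overloaded_eq using sub assms(1)
    by (intro sum.mono_neutral_left) (auto simp: not_in_iff)
  then show ?thesis
    by (auto simp: sym_diff_mset_def intro!: sum.cong)
qed

lemma size_sym_diff_orbit_mset:
  assumes "group_action G X \<phi>" "finite E" "E \<subseteq> carrier G" "x \<in> X" "y \<in> X"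
  shows "real (size (sym_diff_mset (orbit_mset \<phi> E x) (orbit_mset \<phi> E y))) =
    (\<Sum>\<^sub>\<infinity>z\<in>X. \<bar>real (card {g \<in> E. \<phi> g x = z}) - real (card {g \<in> E. \<phi> g y = z})\<bar>)"
proof -
  define Z where "Z = (\<lambda>g. \<phi> g x) ` E \<union> (\<lambda>g. \<phi> g y) ` E"
  have fin: "finite Z"
    using assms(2) by (simp add: Z_def)
  have ZX: "Z \<subseteq> X"
    using assms group_action.element_image[OF assms(1)] by (auto simp: Z_def)
  have sub: "set_mset (orbit_mset \<phi> E x) \<subseteq> Z" "set_mset (orbit_mset \<phi> E y) \<subseteq> Z"
    using assms(2) by (auto simp: orbit_mset_def Z_def)
  have "real (size (sym_diff_mset (orbit_mset \<phi> E x) (orbit_mset \<phi> E y))) =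
      (\<Sum>z\<in>Z. \<bar>real (card {g \<in> E. \<phi> g x = z}) - real (card {g \<in> E. \<phi> g y = z})\<bar>)"
    unfolding size_sym_diff_mset[OF fin sub] count_orbit_mset[OF assms(2)] ..
  also have "\<dots> = (\<Sum>\<^sub>\<infinity>z\<in>Z. \<bar>real (card {g \<in> E. \<phi> g x = z}) - real (card {g \<in> E. \<phi> g y = z})\<bar>)"
    using fin by simp
  also have "\<dots> = (\<Sum>\<^sub>\<infinity>z\<in>X. \<bar>real (card {g \<in> E. \<phi> g x = z}) - real (card {g \<in> E. \<phi> g y = z})\<bar>)"
  proof (rule infsum_cong_neutral)
    fix z assume "z \<in> X - Z"
    then have "{g \<in> E. \<phi> g x = z} = {}" "{g \<in> E. \<phi> g y = z} = {}"
      by (auto simp: Z_def)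
    then show "\<bar>real (card {g \<in> E. \<phi> g x = z}) - real (card {g \<in> E. \<phi> g y = z})\<bar> = 0"
      by (simp only: card.empty)
  qed (use ZX in auto)
  finally show ?thesis .
qed

end

theory Submission
  imports Defs "HOL-Probability.Product_PMF"
begin

text \<open>
  The equivalences are proved as a cycle through Reiter's condition, which asks for finitely supported
  probability measures \<open>\<nu>\<close> on the group such that for all \<open>x\<close>, \<open>y\<close> in a given finite set the laws of
  \<open>g x\<close> and \<open>g y\<close> under \<open>\<nu>\<close> are close in total variation.

  \<^item> Liouville implies an invariant mean (\<open>invariant_mean_of_liouville\<close>): a limit \<open>m\<close> of Cesaro averages
    of convolution powers makes \<open>x \<mapsto> m {g. g x \<in> A}\<close> a bounded harmonic function.
  \<^item> An invariant mean implies Reiter's condition (\<open>reiter_of_invariant_mean\<close>) by duality: a failure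
    produces bounded functions whose integrals contradict the invariance.
  \<^item> Reiter's condition implies Liouville for some symmetric measure of full support
    (\<open>liouville_measure_of_reiter\<close>): an infinite mixture of better and better balanced measures, in which
    a long walk very likely meets a measure that is balanced on everything reached so far. Only a
    fixed part of the mixture has to be balanced, and this leaves room for the inverses that symmetry
    demands.
  \<^item> The sets of the third condition give balanced uniform measures, hence Reiter's condition
    (\<open>reiter_of_foelner_sets\<close>).
  \<^item> The converse is the delicate part, since a measure has to be replaced by a set without
    multiplicities. If the group is amenable, its Foelner sets do (\<open>foelner_sets_of_right_foelner\<close>).
    Otherwise (\<open>foelner_sets_of_reiter_nonfoelner\<close>) a suitable sum of left translates of a balanced measure
    is rounded to a set. Rounding succeeds if the weights are almost everywhere at most \<open>1\<close> while their
    images in \<open>X\<close> have large weight at most points. The first is achieved by right averaging, which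
    shrinks \<open>\<ell>\<^sup>2\<close>-norms in a group that is not amenable (\<open>l2_contraction\<close>). The second is achieved by
    choosing the translates so that they pile up; Reiter's condition, applied once more, shows that
    this is possible (\<open>clumping\<close>).
\<close>

section \<open>Limits along filters and expectations\<close>

abbreviation "expect \<equiv> measure_pmf.expectation"

text \<open>
  Tychonoff's theorem in the form used to build means: a refinement of the given filter makes
  every member of a bounded family converge at once. The refinement plays the part of an
  ultrafilter, or of a Banach limit.
\<close>

lemma convergent_subfilter:
  fixes a :: "'n \<Rightarrow> 'i \<Rightarrow> real"
  assumes "F \<noteq> bot" and bd: "\<And>n i. \<bar>a n i\<bar> \<le> B i"
  obtains F' l where "F' \<le> F" "F' \<noteq> bot" "\<And>i. ((\<lambda>n. a n i) \<longlongrightarrow> l i) F'"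
proof -
  define K where "K = PiE UNIV (\<lambda>i. {- B i..B i})"
  have "compactin (product_topology (\<lambda>i. euclidean) UNIV) K"
    unfolding K_def by (subst compactin_PiE) auto
  then have "compact K"
    by (simp add: euclidean_product_topology flip: compactin_euclidean_iff)
  moreover have "eventually (\<lambda>x. x \<in> K) (filtermap a F)"
  proof -
    have "a n \<in> K" for n using bd[of n] by (auto simp: K_def abs_le_iff minus_le_iff)
    then show ?thesis by (simp add: eventually_filtermap)
  qed
  moreover have "filtermap a F \<noteq> bot" using assms(1) by (simp add: filtermap_bot_iff)
  ultimately obtain l where l: "inf (nhds l) (filtermap a F) \<noteq> bot"
    unfolding compact_filter by blast
  define F' where "F' = inf F (filtercomap a (nhds l))"
  have "F' \<noteq> bot"
  proof
    assume "F' = bot"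
    then have "eventually (\<lambda>_. False) F'" by simp
    then obtain P Q where PQ: "eventually P F" "eventually Q (filtercomap a (nhds l))"
       "\<And>x. P x \<Longrightarrow> Q x \<Longrightarrow> False"
      unfolding F'_def eventually_inf by blast
    then obtain R where R: "eventually R (nhds l)" "\<And>x. R (a x) \<Longrightarrow> Q x"
      unfolding eventually_filtercomap by blast
    have "eventually (\<lambda>y. \<not> R y) (filtermap a F)"
      unfolding eventually_filtermap using PQ(1) by eventually_elim (use PQ(3) R(2) in blast)
    then have "eventually (\<lambda>_. False) (inf (nhds l) (filtermap a F))"
      unfolding eventually_inf using R(1) by blast
    with l show False by (simp add: trivial_limit_def)
  qed
  moreover have "F' \<le> F" by (simp add: F'_def)
  moreover have "((\<lambda>n. a n i) \<longlongrightarrow> l i) F'" for i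
  proof -
    have "filterlim a (nhds l) F'"
      unfolding F'_def filterlim_iff_le_filtercomap by simp
    then show ?thesis
      using continuous_on_tendsto_compose[OF continuous_on_product_coordinates[of i], of a l F'] by simp
  qed
  ultimately show ?thesis using that by blast
qed

lemma pmf_expectation_has_sum:
  fixes f :: "'a \<Rightarrow> real"
  assumes "\<And>x. \<bar>f x\<bar> \<le> B"
  shows "((\<lambda>x. f x * pmf \<mu> x) has_sum expect \<mu> f) UNIV"
proof -
  have 1: "Infinite_Set_Sum.abs_summable_on (\<lambda>x. f x * pmf \<mu> x) UNIV"
  proof (rule Infinite_Set_Sum.abs_summable_on_comparison_test)
    show "Infinite_Set_Sum.abs_summable_on (\<lambda>x. B * pmf \<mu> x) UNIV"
      by (intro Infinite_Set_Sum.abs_summable_on_cmult_right pmf_abs_summable)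
    show "norm (f x * pmf \<mu> x) \<le> norm (B * pmf \<mu> x)" for x
      using assms[of x] by (auto simp: abs_mult intro!: mult_right_mono)
  qed
  have 2: "(\<lambda>x. f x * pmf \<mu> x) summable_on UNIV"
    using 1 abs_summable_equivalent abs_summable_summable by blast
  have "expect \<mu> f = infsetsum (\<lambda>x. f x * pmf \<mu> x) UNIV"
    by (simp add: pmf_expectation_eq_infsetsum mult.commute)
  also have "\<dots> = infsum (\<lambda>x. f x * pmf \<mu> x) UNIV"
    using 1 abs_summable_equivalent by (intro infsetsum_infsum) blast
  finally show ?thesis using has_sum_infsum[OF 2] by simp
qed

lemma integrable_pmf_bounded:
  fixes f :: "'a \<Rightarrow> real"
  assumes "\<And>x. \<bar>f x\<bar> \<le> B"
  shows "integrable (measure_pmf \<mu>) f"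
  by (rule measure_pmf.integrable_const_bound[where B=B]) (use assms in auto)

lemma pmf_expectation_bind_bounded:
  fixes f :: "'b \<Rightarrow> real"
  assumes "\<And>x. \<bar>f x\<bar> \<le> B"
  shows "expect (bind_pmf \<mu> N) f
    = expect \<mu> (\<lambda>x. expect (N x) f)"
  unfolding measure_pmf_bind
  by (rule integral_bind[where B=B and B'=1 and K="count_space UNIV"])
    (use assms in \<open>auto simp: measure_pmf.finite_measure_axioms measure_subprob
       measure_pmf.emeasure_space_1[simplified]\<close>)

lemma pmf_expectation_finite:
  fixes f :: "'a \<Rightarrow> real"
  assumes "finite S" "set_pmf \<mu> \<subseteq> S"
  shows "expect \<mu> f = (\<Sum>a\<in>S. f a * pmf \<mu> a)"
  by (rule integral_measure_pmf_real) (use assms in auto)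

lemma pmf_map_eq_expectation:
  "pmf (map_pmf f \<mu>) z = expect \<mu> (\<lambda>g. of_bool (f g = z))"
proof -
  have "pmf (map_pmf f \<mu>) z = expect \<mu> (indicator (f -` {z}))"
    by (simp add: pmf_map)
  also have "indicator (f -` {z}) = (\<lambda>g. of_bool (f g = z) :: real)"
    by (auto simp: fun_eq_iff indicator_def)
  finally show ?thesis .
qed

lemma pmf_expectation_cong:
  fixes f g :: "'a \<Rightarrow> real"
  assumes "\<And>x. x \<in> set_pmf p \<Longrightarrow> f x = g x"
  shows "expect p f = expect p g"
  using assms by (intro integral_cong_AE) (auto simp: AE_measure_pmf_iff)

lemma pmf_expectation_abs_le:
  fixes f :: "'a \<Rightarrow> real"
  assumes "\<And>x. x \<in> set_pmf \<mu> \<Longrightarrow> \<bar>f x\<bar> \<le> B"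
  shows "\<bar>expect \<mu> f\<bar> \<le> B"
proof -
  define g where "g x = (if x \<in> set_pmf \<mu> then f x else 0)" for x
  obtain x0 where x0: "x0 \<in> set_pmf \<mu>" using set_pmf_not_empty by fast
  then have "B \<ge> 0" using assms by (meson abs_ge_zero order_trans)
  then have g: "\<bar>g x\<bar> \<le> B" for x using assms by (auto simp: g_def)
  have "\<bar>expect \<mu> f\<bar> = \<bar>expect \<mu> g\<bar>"
    by (intro arg_cong[of _ _ abs] integral_cong_AE) (auto simp: g_def AE_measure_pmf_iff)
  also have "\<bar>expect \<mu> g\<bar> \<le> expect \<mu> (\<lambda>x. \<bar>g x\<bar>)"
    by (rule integral_abs_bound)
  also have "\<dots> \<le> expect \<mu> (\<lambda>x. B)"
    using g \<open>B \<ge> 0\<close> by (intro integral_mono integrable_pmf_bounded[where B=B]) auto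
  also have "\<dots> = B" by simp
  finally show ?thesis .
qed

text \<open>
  Dominated convergence is a statement on sequences and can fail along other filters. For a discrete
  measure it holds along all of them, because all but a small part of \<open>\<mu>\<close> sits on a finite set \<open>H\<close>, on which the
  convergence is uniform.
\<close>

lemma tendsto_pmf_expectation:
  fixes a :: "'n \<Rightarrow> 'g \<Rightarrow> real"
  assumes lim: "\<And>h. ((\<lambda>n. a n h) \<longlongrightarrow> l h) F" and bd: "\<And>n h. \<bar>a n h\<bar> \<le> B" and "F \<noteq> bot"
  shows "((\<lambda>n. expect \<mu> (a n)) \<longlongrightarrow> expect \<mu> l) F"
proof (rule tendstoI)
  fix e :: real assume e: "e > 0"
  have B: "B \<ge> 0" using bd[of undefined undefined] by linarith
  have lb: "\<bar>l h\<bar> \<le> B" for h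
    by (rule tendsto_upperbound[OF tendsto_rabs[OF lim[of h]] _ assms(3)]) (use bd in auto)
  \<comment> \<open>The mass allowed outside \<open>H\<close>; a term there is at most \<open>2 * B\<close>.\<close>
  define d where "d = e / (4 * (B + 1))"
  have d: "d > 0" using e B by (simp add: d_def)
  have "(pmf \<mu> has_sum 1) UNIV" using pmf_expectation_has_sum[of "\<lambda>_. 1" 1 \<mu>] by simp
  then have "eventually (\<lambda>A. dist (sum (pmf \<mu>) A) 1 < d) (finite_subsets_at_top UNIV)"
    using d unfolding has_sum_def by (rule tendstoD)
  then obtain H where H: "finite H" "sum (pmf \<mu>) H > 1 - d"
    unfolding eventually_finite_subsets_at_top by (force simp: dist_real_def)
  have int: "integrable \<mu> f" if "\<And>h. \<bar>f h\<bar> \<le> C" for f :: "'g \<Rightarrow> real" and C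
    by (rule measure_pmf.integrable_const_bound[where B=C]) (use that in auto)
  have "eventually (\<lambda>n. \<forall>h\<in>H. \<bar>a n h - l h\<bar> < e / 4) F"
  proof (intro eventually_ball_finite H ballI)
    fix h
    show "eventually (\<lambda>n. \<bar>a n h - l h\<bar> < e / 4) F"
      using tendstoD[OF lim[of h], of "e / 4"] e by (simp add: dist_real_def)
  qed
  then show "eventually (\<lambda>n. dist (expect \<mu> (a n)) (expect \<mu> l) < e) F"
  proof eventually_elim
    case (elim n)
    have "\<bar>expect \<mu> (a n) - expect \<mu> l\<bar>
        = \<bar>expect \<mu> (\<lambda>h. a n h - l h)\<bar>"
      by (subst Bochner_Integration.integral_diff) (auto intro: int bd lb)
    also have "\<dots> \<le> expect \<mu> (\<lambda>h. \<bar>a n h - l h\<bar>)"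
      by (rule integral_abs_bound)
    also have "\<dots> \<le> expect \<mu> (\<lambda>h. e / 4 + 2 * B * indicator (- H) h)"
    proof (rule integral_mono)
      show "integrable \<mu> (\<lambda>h. \<bar>a n h - l h\<bar>)"
      proof -
        have "\<bar>a n h - l h\<bar> \<le> 2 * B" for h using bd[of n h] lb[of h] by linarith
        then show ?thesis by (intro int[where C="2*B"]) simp
      qed
      show "integrable \<mu> (\<lambda>h. e / 4 + 2 * B * indicator (- H) h)"
        by (rule int[where C="e/4+2*B"]) (use e B in \<open>auto simp: indicator_def\<close>)
      fix h show "\<bar>a n h - l h\<bar> \<le> e / 4 + 2 * B * indicator (- H) h"
        using elim bd[of n h] lb[of h] e by (cases "h \<in> H") (force simp: indicator_def)+
    qed
    also have "\<dots> = e / 4 + 2 * B * measure_pmf.prob \<mu> (- H)"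
    proof -
      have "integrable \<mu> (\<lambda>h. 2 * B * indicator (- H) h :: real)"
        by (rule int[where C="2 * B"]) (use B in \<open>auto simp: indicator_def\<close>)
      then show ?thesis by (subst Bochner_Integration.integral_add) auto
    qed
    also have "measure_pmf.prob \<mu> (- H) = 1 - sum (pmf \<mu>) H"
      using measure_pmf.prob_compl[of H \<mu>] H by (simp add: measure_measure_pmf_finite Compl_eq_Diff_UNIV)
    also have "e / 4 + 2 * B * (1 - sum (pmf \<mu>) H) \<le> e / 4 + 2 * B * d"
      using H B by (intro add_left_mono mult_left_mono) auto
    also have "\<dots> < e"
    proof -
      have "2 * B * d \<le> e / 2" using e B by (simp add: d_def field_simps)
      then show ?thesis using e by linarith
    qed
    finally show ?case by (simp add: dist_real_def)
  qed
qed

section \<open>Reiter's condition\<close>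

text \<open>
  A bound on twice the total variation distance, in dual form: under images and mixtures of
  measures the test functions are simply pulled back.
\<close>

definition tv_close :: "real \<Rightarrow> 'a pmf \<Rightarrow> 'a pmf \<Rightarrow> bool" where
  "tv_close \<epsilon> p q \<longleftrightarrow> (\<forall>u. (\<forall>z. \<bar>u z\<bar> \<le> 1) \<longrightarrow>
     \<bar>expect p u - expect q u\<bar> \<le> \<epsilon>)"

lemma tv_closeD:
  assumes "tv_close \<epsilon> p q" "\<And>z. \<bar>u z\<bar> \<le> 1"
  shows "\<bar>expect p u - expect q u\<bar> \<le> \<epsilon>"
  using assms unfolding tv_close_def by blast

lemma tv_close_sum:
  assumes "tv_close \<epsilon> p q" "finite Z"
  shows "(\<Sum>z\<in>Z. \<bar>pmf p z - pmf q z\<bar>) \<le> \<epsilon>"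
proof -
  define u where "u z = (if z \<in> Z then sgn (pmf p z - pmf q z) else 0)" for z
  have u: "\<bar>u z\<bar> \<le> 1" for z by (simp add: u_def abs_sgn_eq)
  have E: "expect r u = (\<Sum>z\<in>Z. u z * pmf r z)" for r
    by (rule integral_measure_pmf_real[OF assms(2)]) (auto simp: u_def split: if_splits)
  have "(\<Sum>z\<in>Z. \<bar>pmf p z - pmf q z\<bar>) = (\<Sum>z\<in>Z. u z * pmf p z - u z * pmf q z)"
    by (intro sum.cong refl) (auto simp: u_def sgn_if)
  also have "\<dots> = expect p u - expect q u"
    by (simp add: E sum_subtractf)
  also have "\<dots> \<le> \<epsilon>" using assms(1) u unfolding tv_close_def by (metis abs_le_D1)
  finally show ?thesis .
qed

lemma tv_closeI_sum:
  assumes "finite Z" "set_pmf p \<subseteq> Z" "set_pmf q \<subseteq> Z" "(\<Sum>z\<in>Z. \<bar>pmf p z - pmf q z\<bar>) \<le> \<epsilon>"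
  shows "tv_close \<epsilon> p q"
  unfolding tv_close_def
proof (intro allI impI)
  fix u :: "'a \<Rightarrow> real" assume u: "\<forall>z. \<bar>u z\<bar> \<le> 1"
  have E: "expect r u = (\<Sum>z\<in>Z. u z * pmf r z)" if "set_pmf r \<subseteq> Z" for r
    by (rule integral_measure_pmf_real[OF assms(1)]) (use that in auto)
  have "\<bar>expect p u - expect q u\<bar> = \<bar>\<Sum>z\<in>Z. u z * (pmf p z - pmf q z)\<bar>"
    using assms by (simp add: E right_diff_distrib sum_subtractf)
  also have "\<dots> \<le> (\<Sum>z\<in>Z. \<bar>u z * (pmf p z - pmf q z)\<bar>)" by (rule sum_abs)
  also have "\<dots> \<le> (\<Sum>z\<in>Z. \<bar>pmf p z - pmf q z\<bar>)"
    using u by (intro sum_mono) (auto simp: abs_mult intro!: mult_left_le_one_le)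
  finally show "\<bar>expect p u - expect q u\<bar> \<le> \<epsilon>" using assms(4) by linarith
qed

lemma tv_close_sym: "tv_close \<epsilon> p q \<Longrightarrow> tv_close \<epsilon> q p"
  unfolding tv_close_def by (metis abs_minus_commute)

lemma tv_close_trans: "tv_close \<epsilon> p q \<Longrightarrow> tv_close \<epsilon>' q r \<Longrightarrow> tv_close (\<epsilon> + \<epsilon>') p r"
  unfolding tv_close_def
proof (intro allI impI)
  fix u :: "'a \<Rightarrow> real"
  assume a: "\<forall>u. (\<forall>z. \<bar>u z\<bar> \<le> 1) \<longrightarrow> \<bar>expect p u - expect q u\<bar> \<le> \<epsilon>"
     "\<forall>u. (\<forall>z. \<bar>u z\<bar> \<le> 1) \<longrightarrow> \<bar>expect q u - expect r u\<bar> \<le> \<epsilon>'"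
     "\<forall>z. \<bar>u z\<bar> \<le> 1"
  then have "\<bar>expect p u - expect q u\<bar> \<le> \<epsilon>"
     "\<bar>expect q u - expect r u\<bar> \<le> \<epsilon>'" by blast+
  then show "\<bar>expect p u - expect r u\<bar> \<le> \<epsilon> + \<epsilon>'" by linarith
qed

text \<open>
  Reiter's condition for the action. All three conditions of the theorem are compared with it.
\<close>

definition reiter :: "('g, 'm) monoid_scheme \<Rightarrow> 'x set \<Rightarrow> ('g \<Rightarrow> 'x \<Rightarrow> 'x) \<Rightarrow> bool" where
  "reiter G X \<phi> \<longleftrightarrow> (\<forall>\<epsilon>>0. \<forall>F. finite F \<and> F \<subseteq> X \<longrightarrow>
     (\<exists>\<nu>. finite (set_pmf \<nu>) \<and> set_pmf \<nu> \<subseteq> carrier G \<and>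
        (\<forall>x\<in>F. \<forall>y\<in>F. tv_close \<epsilon> (map_pmf (\<lambda>g. \<phi> g x) \<nu>) (map_pmf (\<lambda>g. \<phi> g y) \<nu>))))"

lemma reiterE:
  assumes "reiter G X \<phi>" "0 < \<epsilon>" "finite F" "F \<subseteq> X"
  obtains \<nu> where "finite (set_pmf \<nu>)" "set_pmf \<nu> \<subseteq> carrier G"
    "\<And>x y. x \<in> F \<Longrightarrow> y \<in> F \<Longrightarrow> tv_close \<epsilon> (map_pmf (\<lambda>g. \<phi> g x) \<nu>) (map_pmf (\<lambda>g. \<phi> g y) \<nu>)"
  using assms(1)[unfolded reiter_def, rule_format, OF assms(2) conjI[OF assms(3,4)]] by blast

section \<open>From invariant means to Reiter's condition\<close>

text \<open>
  The function \<open>\<lambda>u. sqrt (u\<^sup>2 + s\<^sup>2)\<close> is a smooth substitute for the absolute value. Its derivative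
  has absolute value at most \<open>1\<close>, and its second derivative is at most \<open>1 / s\<close>.
\<close>

lemma sqrt_perturb:
  fixes a u s :: real
  assumes "s > 0"
  shows "sqrt (u\<^sup>2 + s\<^sup>2) \<le> sqrt (a\<^sup>2 + s\<^sup>2) + a / sqrt (a\<^sup>2 + s\<^sup>2) * (u - a) + (u - a)\<^sup>2 / (2 * s)"
proof -
  define h where "h = sqrt (a\<^sup>2 + s\<^sup>2)"
  have h: "h \<ge> s" "h\<^sup>2 = a\<^sup>2 + s\<^sup>2" "h > 0"
    using assms real_sqrt_le_mono[of "s\<^sup>2" "a\<^sup>2 + s\<^sup>2"] by (auto simp: h_def add_nonneg_pos)
  define k where "k = sqrt (u\<^sup>2 + s\<^sup>2)"
  have k: "k\<^sup>2 = u\<^sup>2 + s\<^sup>2" by (simp add: k_def)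
  have "2 * h * k \<le> h\<^sup>2 + k\<^sup>2" using sum_squares_bound[of h k] by simp
  then have "2 * h * k \<le> 2 * h\<^sup>2 + 2 * a * (u - a) + (u - a)\<^sup>2"
    unfolding h(2) k by (simp add: power2_eq_square algebra_simps)
  then have "k \<le> (2 * h\<^sup>2 + 2 * a * (u - a) + (u - a)\<^sup>2) / (2 * h)"
    using h by (simp add: field_simps)
  also have "\<dots> = h + a / h * (u - a) + (u - a)\<^sup>2 / (2 * h)"
    using h(3) by (simp add: field_simps power2_eq_square)
  also have "(u - a)\<^sup>2 / (2 * h) \<le> (u - a)\<^sup>2 / (2 * s)"
    using h assms by (intro divide_left_mono) auto
  finally show ?thesis by (simp add: h_def k_def)
qed

text \<open>
  The finite-dimensional duality behind the Hahn-Banach step. If every convex combination of the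
  vectors \<open>b g\<close> has \<open>\<ell>\<^sup>1\<close>-norm at least \<open>c\<close>, then a single functional of sup-norm at most \<open>1\<close> is
  at least \<open>c / 2\<close> on all of them. The functional is the gradient of a smoothed norm at a nearly
  minimal combination \<open>w\<close>: moving \<open>w\<close> a little towards the vertex \<open>g\<close> cannot lower the smoothed norm
  noticeably, which bounds the gradient on \<open>b g\<close> from below.
\<close>

lemma l1_dual_certificate:
  fixes b :: "'g \<Rightarrow> 'j \<Rightarrow> real"
  assumes S: "finite S" "S \<noteq> {}" and J: "finite J" and b: "\<And>g j. \<bar>b g j\<bar> \<le> 1" and c: "c > 0"
    and lower: "\<And>w. (\<And>g. g \<in> S \<Longrightarrow> 0 \<le> w g) \<Longrightarrow> sum w S = 1 \<Longrightarrow> c \<le> (\<Sum>j\<in>J. \<bar>\<Sum>g\<in>S. w g * b g j\<bar>)"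
  obtains \<theta> where "\<And>j. \<bar>\<theta> j\<bar> \<le> 1" "\<And>g. g \<in> S \<Longrightarrow> c / 2 \<le> (\<Sum>j\<in>J. \<theta> j * b g j)"
proof -
  define W where "W = {w. (\<forall>g\<in>S. 0 \<le> w g) \<and> sum w S = (1::real)}"
  have vertex: "(\<lambda>h. if h = g then 1 else 0) \<in> W" if "g \<in> S" for g
    using that S by (simp add: W_def)
  obtain g1 where g1: "g1 \<in> S" using S by blast
  define D where "D w j = (\<Sum>g\<in>S. w g * b g j)" for w j
  define n where "n = real (card J)"
  have "J \<noteq> {}" using lower[of "\<lambda>h. if h = g1 then 1 else 0"] vertex[OF g1] c by (auto simp: W_def)
  then have n: "n > 0" using J by (simp add: n_def card_gt_0_iff)
  \<comment> \<open>Smoothing changes the norm by at most \<open>s * n = c / 4\<close>. The step length \<open>t\<close> and the slack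
    \<open>\<eta>\<close> of the minimisation each cost at most \<open>c / 8\<close>.\<close>
  define s where "s = c / (4 * n)"
  have s: "s > 0" using c n by (simp add: s_def)
  define Q where "Q w = (\<Sum>j\<in>J. sqrt ((D w j)\<^sup>2 + s\<^sup>2))" for w
  define t where "t = min 1 (c * s / (16 * n))"
  have t: "0 < t" "t \<le> 1" "2 * t * n / s \<le> c / 8"
  proof -
    show "0 < t" "t \<le> 1" using c s n by (auto simp: t_def)
    have "t \<le> c * s / (16 * n)" by (simp add: t_def)
    then show "2 * t * n / s \<le> c / 8" using s n by (simp add: field_simps)
  qed
  define \<eta> where "\<eta> = t * (c / 8)"
  have \<eta>: "\<eta> > 0" using t c by (simp add: \<eta>_def)
  obtain w where w: "w \<in> W" "\<And>w'. w' \<in> W \<Longrightarrow> Q w \<le> Q w' + \<eta>"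
  proof -
    have ne: "Q ` W \<noteq> {}" using vertex[OF g1] by blast
    have bdd: "bdd_below (Q ` W)" by (rule bdd_belowI[of _ 0]) (auto simp: Q_def intro!: sum_nonneg)
    obtain y where "y \<in> Q ` W" "y < Inf (Q ` W) + \<eta>"
      using cInf_lessD[OF ne, of "Inf (Q ` W) + \<eta>"] \<eta> by auto
    then obtain w where "w \<in> W" "Q w < Inf (Q ` W) + \<eta>" by auto
    then show ?thesis using that cInf_lower[OF _ bdd] by fastforce
  qed
  define \<theta> where "\<theta> j = D w j / sqrt ((D w j)\<^sup>2 + s\<^sup>2)" for j
  have D1: "\<bar>D v j\<bar> \<le> 1" if "v \<in> W" for v j
  proof -
    have "\<bar>D v j\<bar> \<le> (\<Sum>g\<in>S. \<bar>v g * b g j\<bar>)" unfolding D_def by (rule sum_abs)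
    also have "\<dots> \<le> (\<Sum>g\<in>S. v g)"
      using that b by (intro sum_mono) (auto simp: W_def abs_mult intro!: mult_left_le)
    finally show ?thesis using that by (simp add: W_def)
  qed
  have pos: "sqrt ((D w j)\<^sup>2 + s\<^sup>2) > 0" for j using s by (simp add: add_nonneg_pos)
  have "\<bar>\<theta> j\<bar> \<le> 1" for j
  proof -
    have "\<bar>D w j\<bar> \<le> sqrt ((D w j)\<^sup>2 + s\<^sup>2)" by (rule real_le_rsqrt) simp
    then show ?thesis using pos[of j] by (simp add: \<theta>_def)
  qed
  moreover have "c / 2 \<le> (\<Sum>j\<in>J. \<theta> j * b g j)" if g: "g \<in> S" for g
  proof -
    define w' where "w' h = (1 - t) * w h + t * (if h = g then 1 else 0)" for h
    have w'W: "w' \<in> W"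
      using w(1) t vertex[OF g] by (auto simp: W_def w'_def sum.distrib sum_distrib_left[symmetric])
    have D': "D w' j = D w j + t * (b g j - D w j)" for j
    proof -
      have "D w' j = (\<Sum>h\<in>S. (1 - t) * (w h * b h j) + (if h = g then t * b g j else 0))"
        unfolding D_def by (intro sum.cong refl) (auto simp: w'_def algebra_simps)
      also have "\<dots> = (1 - t) * D w j + t * b g j"
        using S g by (simp add: sum.distrib D_def sum_distrib_left)
      finally show ?thesis by (simp add: algebra_simps)
    qed
    have "Q w' \<le> (\<Sum>j\<in>J. sqrt ((D w j)\<^sup>2 + s\<^sup>2) + \<theta> j * (t * (b g j - D w j)) + t\<^sup>2 * 4 / (2 * s))"
      unfolding Q_def
    proof (rule sum_mono)
      fix j
      have "\<bar>b g j - D w j\<bar> \<le> 2" using b[of g j] D1[OF w(1), of j] by linarith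
      then have "(b g j - D w j)\<^sup>2 \<le> 2\<^sup>2" by (metis abs_ge_zero power2_abs power_mono)
      then have "(t * (b g j - D w j))\<^sup>2 / (2 * s) \<le> t\<^sup>2 * 4 / (2 * s)"
        using s by (intro divide_right_mono) (auto simp: power_mult_distrib mult_left_mono)
      moreover have "sqrt ((D w' j)\<^sup>2 + s\<^sup>2) \<le> sqrt ((D w j)\<^sup>2 + s\<^sup>2) + \<theta> j * (t * (b g j - D w j)) + (t * (b g j - D w j))\<^sup>2 / (2 * s)"
        using sqrt_perturb[OF s, of "D w' j" "D w j"] unfolding D' \<theta>_def by simp
      ultimately show "sqrt ((D w' j)\<^sup>2 + s\<^sup>2) \<le> sqrt ((D w j)\<^sup>2 + s\<^sup>2) + \<theta> j * (t * (b g j - D w j)) + t\<^sup>2 * 4 / (2 * s)"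
        by linarith
    qed
    also have "\<dots> = Q w + t * (\<Sum>j\<in>J. \<theta> j * (b g j - D w j)) + t * (2 * t * n / s)"
      by (simp add: Q_def sum.distrib sum_distrib_left n_def power2_eq_square mult_ac)
    finally have "Q w' \<le> Q w + t * (\<Sum>j\<in>J. \<theta> j * (b g j - D w j)) + t * (2 * t * n / s)" .
    moreover have "t * (2 * t * n / s) \<le> t * (c / 8)" using t by (intro mult_left_mono) auto
    ultimately have "0 \<le> t * (\<Sum>j\<in>J. \<theta> j * (b g j - D w j)) + t * (c / 8) + t * (c / 8)"
      using w(2)[OF w'W] unfolding \<eta>_def by linarith
    then have "0 \<le> t * ((\<Sum>j\<in>J. \<theta> j * (b g j - D w j)) + c / 8 + c / 8)"
      by (simp only: distrib_left)
    then have 1: "- (c / 4) \<le> (\<Sum>j\<in>J. \<theta> j * (b g j - D w j))"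
      using t(1) by (simp add: zero_le_mult_iff)
    have "c \<le> (\<Sum>j\<in>J. \<bar>D w j\<bar>)" using lower[of w] w(1) by (simp add: W_def D_def)
    also have "\<dots> \<le> (\<Sum>j\<in>J. \<theta> j * D w j + s)"
    proof (rule sum_mono)
      fix j
      define a where "a = \<bar>D w j\<bar>"
      define r where "r = sqrt ((D w j)\<^sup>2 + s\<^sup>2)"
      have r: "r > 0" "r\<^sup>2 = a\<^sup>2 + s\<^sup>2" "r \<le> a + s"
      proof -
        show "r > 0" "r\<^sup>2 = a\<^sup>2 + s\<^sup>2" using pos by (auto simp: r_def a_def)
        show "r \<le> a + s" unfolding r_def
          by (rule real_le_lsqrt) (use s in \<open>auto simp: a_def power2_sum\<close>)
      qed
      have "(a - s) * r \<le> a\<^sup>2"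
      proof (cases "a \<ge> s")
        case True
        then have "(a - s) * r \<le> (a - s) * (a + s)" using r by (intro mult_left_mono) auto
        also have "\<dots> \<le> a\<^sup>2" by (simp add: power2_eq_square algebra_simps)
        finally show ?thesis .
      next
        case False
        then have "(a - s) * r \<le> 0" using r by (intro mult_nonpos_nonneg) auto
        then show ?thesis using zero_le_power2[of a] by linarith
      qed
      then have "a - s \<le> a\<^sup>2 / r" using r by (simp add: pos_le_divide_eq)
      moreover have "\<theta> j * D w j = a\<^sup>2 / r" by (simp add: \<theta>_def a_def r_def power2_eq_square)
      ultimately show "\<bar>D w j\<bar> \<le> \<theta> j * D w j + s" by (simp add: a_def)
    qed
    also have "\<dots> = (\<Sum>j\<in>J. \<theta> j * D w j) + c / 4" using n by (simp add: sum.distrib s_def n_def)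
    finally have "3 * c / 4 \<le> (\<Sum>j\<in>J. \<theta> j * D w j)" by simp
    with 1 show ?thesis by (simp add: right_diff_distrib sum_subtractf)
  qed
  ultimately show ?thesis using that by blast
qed

lemma fin_add_prob_fibres:
  assumes m: "fin_add_prob S m" and fin: "finite (T ` S)"
  shows "m {g \<in> S. T g \<in> B} = (\<Sum>v\<in>T ` S \<inter> B. m {g \<in> S. T g = v})"
proof -
  have add: "m (A \<union> A') = m A + m A'" if "A \<subseteq> S" "A' \<subseteq> S" "A \<inter> A' = {}" for A A'
    using m that unfolding fin_add_prob_def Measure_Space.additive_def by (simp add: Pow_def)
  have empty: "m {} = 0" using add[of "{}" "{}"] by simp
  have "m {g \<in> S. T g \<in> V} = (\<Sum>v\<in>V. m {g \<in> S. T g = v})" if "finite V" for V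
    using that
  proof (induction V rule: finite_induct)
    case empty
    then show ?case using \<open>m {} = 0\<close> by simp
  next
    case (insert v V)
    have "{g \<in> S. T g \<in> insert v V} = {g \<in> S. T g = v} \<union> {g \<in> S. T g \<in> V}" by auto
    moreover have "{g \<in> S. T g = v} \<inter> {g \<in> S. T g \<in> V} = {}" using insert by auto
    ultimately show ?case using insert by (simp add: add)
  qed
  from this[of "T ` S \<inter> B"] fin have "m {g \<in> S. T g \<in> T ` S \<inter> B} = (\<Sum>v\<in>T ` S \<inter> B. m {g \<in> S. T g = v})"
    by simp
  moreover have "{g \<in> S. T g \<in> T ` S \<inter> B} = {g \<in> S. T g \<in> B}" by auto
  ultimately show ?thesis by simp
qed

text \<open>
  If Reiter's condition fails for \<open>F\<close>, duality on finite subsets of the group and compactness give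
  bounded functions \<open>\<theta> (x, \<cdot>)\<close>, \<open>x \<in> F\<close>, with \<open>(\<Sum>x\<in>F. \<theta> (x, g x) - \<theta> (x, g o'))\<close> bounded below by a
  positive constant for all \<open>g\<close>. An invariant mean would integrate this sum to \<open>0\<close>. Since \<open>m\<close> is only
  finitely additive, the functions are first rounded to finitely many values, so that the
  integrals become finite sums.
\<close>

lemma reiter_of_invariant_mean:
  fixes G :: "('g, 'm) monoid_scheme" and X :: "'x set"
  assumes one: "carrier G \<noteq> {}" and m: "fin_add_prob (carrier G) m"
    and act: "\<And>g x. g \<in> carrier G \<Longrightarrow> x \<in> X \<Longrightarrow> \<phi> g x \<in> X"
    and inv: "\<And>x y A. x \<in> X \<Longrightarrow> y \<in> X \<Longrightarrow> A \<subseteq> X \<Longrightarrow> push_measure G \<phi> m x A = push_measure G \<phi> m y A"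
  shows "reiter G X \<phi>"
  unfolding reiter_def
proof (intro allI impI)
  fix \<epsilon> :: real and F assume \<epsilon>: "\<epsilon> > 0" and F: "finite F \<and> F \<subseteq> X"
  define C where "C = carrier G"
  define P where "P x \<nu> = map_pmf (\<lambda>g. \<phi> g x) \<nu>" for x \<nu>
  define c where "c = \<epsilon> / 2"
  have c: "c > 0" using \<epsilon> by (simp add: c_def)
  show "\<exists>\<nu>. finite (set_pmf \<nu>) \<and> set_pmf \<nu> \<subseteq> carrier G \<and>
        (\<forall>x\<in>F. \<forall>y\<in>F. tv_close \<epsilon> (map_pmf (\<lambda>g. \<phi> g x) \<nu>) (map_pmf (\<lambda>g. \<phi> g y) \<nu>))"
  proof (cases "F = {}")
    case True
    obtain e where "e \<in> carrier G" using one by blast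
    then show ?thesis using True by (intro exI[of _ "return_pmf e"]) auto
  next
    case False
    then obtain o' where o': "o' \<in> F" by blast
    define Z where "Z S = (\<lambda>(g, x). \<phi> g x) ` (S \<times> F)" for S
    have Z: "finite (Z S)" if "finite S" for S using that F by (simp add: Z_def)
    define b where "b g = (\<lambda>(x, z). of_bool (\<phi> g x = z) - of_bool (\<phi> g o' = z) :: real)" for g
    have b1: "\<bar>b g j\<bar> \<le> 1" for g j by (auto simp: b_def split: prod.splits)
    have bsum: "(\<Sum>j\<in>F \<times> Z S. \<theta> j * b g j) = (\<Sum>x\<in>F. \<theta> (x, \<phi> g x) - \<theta> (x, \<phi> g o'))"
      if S: "finite S" "g \<in> S" for S g and \<theta> :: "'x \<times> 'x \<Rightarrow> real"
    proof -
      have "(\<Sum>j\<in>F \<times> Z S. \<theta> j * b g j) = (\<Sum>x\<in>F. \<Sum>z\<in>Z S. \<theta> (x, z) * b g (x, z))"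
        by (simp add: sum.cartesian_product)
      also have "\<dots> = (\<Sum>x\<in>F. \<theta> (x, \<phi> g x) - \<theta> (x, \<phi> g o'))"
      proof (rule sum.cong[OF refl])
        fix x assume x: "x \<in> F"
        have in1: "\<phi> g x \<in> Z S" "\<phi> g o' \<in> Z S" using S x o' by (force simp: Z_def)+
        have "(\<Sum>z\<in>Z S. \<theta> (x, z) * b g (x, z))
           = (\<Sum>z\<in>Z S. (if \<phi> g x = z then \<theta> (x, z) else 0)) - (\<Sum>z\<in>Z S. (if \<phi> g o' = z then \<theta> (x, z) else 0))"
          unfolding sum_subtractf[symmetric] by (intro sum.cong refl) (auto simp: b_def)
        then show "(\<Sum>z\<in>Z S. \<theta> (x, z) * b g (x, z)) = \<theta> (x, \<phi> g x) - \<theta> (x, \<phi> g o')"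
          using in1 Z[OF S(1)] by simp
      qed
      finally show ?thesis .
    qed
    have "\<exists>\<nu>. finite (set_pmf \<nu>) \<and> set_pmf \<nu> \<subseteq> C \<and> (\<forall>x\<in>F. tv_close c (P x \<nu>) (P o' \<nu>))"
    proof (rule ccontr)
      assume no: "\<not> ?thesis"
      have cert: "\<exists>\<theta>. (\<forall>j. \<bar>\<theta> j\<bar> \<le> 1) \<and> (\<forall>g\<in>S. c / 2 \<le> (\<Sum>x\<in>F. \<theta> (x, \<phi> g x) - \<theta> (x, \<phi> g o')))"
        if S: "finite S" "S \<subseteq> C" for S
      proof (cases "S = {}")
        case True
        then show ?thesis by (intro exI[of _ "\<lambda>_. 0"]) auto
      next
        case Sne: False
        obtain \<theta> where \<theta>: "\<And>j. \<bar>\<theta> j\<bar> \<le> 1" "\<And>g. g \<in> S \<Longrightarrow> c / 2 \<le> (\<Sum>j\<in>F \<times> Z S. \<theta> j * b g j)"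
        proof (rule l1_dual_certificate[of S "F \<times> Z S" b c])
          fix w assume w: "\<And>g. g \<in> S \<Longrightarrow> 0 \<le> w g" "sum w S = (1::real)"
          define w0 where "w0 g = (if g \<in> S then w g else 0)" for g
          define \<nu> where "\<nu> = embed_pmf w0"
          have nn: "(\<integral>\<^sup>+g. ennreal (w0 g) \<partial>count_space UNIV) = 1"
          proof -
            have "(\<integral>\<^sup>+g. ennreal (w0 g) \<partial>count_space UNIV) = (\<Sum>g\<in>S. ennreal (w0 g))"
              by (rule nn_integral_count_space') (auto simp: w0_def S)
            also have "\<dots> = ennreal (\<Sum>g\<in>S. w0 g)" using w by (intro sum_ennreal) (auto simp: w0_def)
            also have "(\<Sum>g\<in>S. w0 g) = 1" using w by (simp add: w0_def)
            finally show ?thesis by simp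
          qed
          have pmf\<nu>: "pmf \<nu> g = w0 g" for g
            unfolding \<nu>_def by (rule pmf_embed_pmf) (use w nn in \<open>auto simp: w0_def\<close>)
          have set\<nu>: "set_pmf \<nu> \<subseteq> S" by (auto simp: set_pmf_iff pmf\<nu> w0_def split: if_splits)
          then have fin\<nu>: "finite (set_pmf \<nu>)" using S finite_subset by blast
          obtain x where x: "x \<in> F" "\<not> tv_close c (P x \<nu>) (P o' \<nu>)"
            using no fin\<nu> set\<nu> S by blast
          have pP: "pmf (P y \<nu>) z = (\<Sum>g\<in>S. w g * of_bool (\<phi> g y = z))" for y z
          proof -
            have "pmf (P y \<nu>) z = (\<Sum>g\<in>S. of_bool (\<phi> g y = z) * pmf \<nu> g)"
              unfolding P_def pmf_map_eq_expectation by (rule pmf_expectation_finite[OF S(1) set\<nu>])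
            then show ?thesis by (simp add: pmf\<nu> w0_def mult.commute)
          qed
          have "c \<le> (\<Sum>z\<in>Z S. \<bar>pmf (P x \<nu>) z - pmf (P o' \<nu>) z\<bar>)"
          proof (rule ccontr)
            assume "\<not> ?thesis"
            then have "tv_close c (P x \<nu>) (P o' \<nu>)"
              using set\<nu> x o' by (intro tv_closeI_sum[OF Z[OF S(1)]]) (force simp: P_def Z_def)+
            then show False using x by simp
          qed
          also have "\<dots> = (\<Sum>z\<in>Z S. \<bar>\<Sum>g\<in>S. w g * b g (x, z)\<bar>)"
            by (simp add: pP b_def right_diff_distrib sum_subtractf)
          also have "\<dots> \<le> (\<Sum>x\<in>F. \<Sum>z\<in>Z S. \<bar>\<Sum>g\<in>S. w g * b g (x, z)\<bar>)"
            using member_le_sum[OF x(1), of "\<lambda>x. \<Sum>z\<in>Z S. \<bar>\<Sum>g\<in>S. w g * b g (x, z)\<bar>"] F by (simp add: sum_nonneg)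
          finally show "c \<le> (\<Sum>j\<in>F \<times> Z S. \<bar>\<Sum>g\<in>S. w g * b g j\<bar>)"
            by (simp add: sum.cartesian_product)
        qed (use S Sne F Z b1 c in auto)
        show ?thesis by (intro exI[of _ \<theta>]) (use \<theta> bsum[OF S(1)] in auto)
      qed
      have "\<forall>S. \<exists>\<theta>. finite S \<longrightarrow> S \<subseteq> C \<longrightarrow> (\<forall>j. \<bar>\<theta> j\<bar> \<le> 1) \<and>
          (\<forall>g\<in>S. c / 2 \<le> (\<Sum>x\<in>F. \<theta> (x, \<phi> g x) - \<theta> (x, \<phi> g o')))"
        using cert by blast
      from choice[OF this] obtain th where th: "\<And>S. finite S \<Longrightarrow> S \<subseteq> C \<Longrightarrow> (\<forall>j. \<bar>th S j\<bar> \<le> 1) \<and>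
          (\<forall>g\<in>S. c / 2 \<le> (\<Sum>x\<in>F. th S (x, \<phi> g x) - th S (x, \<phi> g o')))"
        by blast
      \<comment> \<open>A total family of test functions, indexed by the finite sets, so that it has a limit.\<close>
      define th' where "th' S = (if finite S \<and> S \<subseteq> C then th S else (\<lambda>_. 0))" for S
      have th'1: "\<bar>th' S j\<bar> \<le> 1" for S j
      proof (cases "finite S \<and> S \<subseteq> C")
        case True
        then have "\<forall>j. \<bar>th S j\<bar> \<le> 1" using th by blast
        then have "\<bar>th S j\<bar> \<le> 1" by blast
        then show ?thesis using True by (simp add: th'_def)
      qed (auto simp: th'_def)
      obtain \<F> \<theta> where \<F>: "\<F> \<le> finite_subsets_at_top C" "\<F> \<noteq> bot"
        and lim: "\<And>j. ((\<lambda>S. th' S j) \<longlongrightarrow> \<theta> j) \<F>"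
      proof (rule convergent_subfilter[of "finite_subsets_at_top C" th' "\<lambda>_. 1"])
        show "\<bar>th' S j\<bar> \<le> 1" for S j by (rule th'1)
      qed auto
      have \<theta>1: "\<bar>\<theta> j\<bar> \<le> 1" for j
        by (rule tendsto_upperbound[OF tendsto_rabs[OF lim[of j]] _ \<F>(2)]) (simp add: th'1)
      have \<theta>c: "c / 2 \<le> (\<Sum>x\<in>F. \<theta> (x, \<phi> g x) - \<theta> (x, \<phi> g o'))" if g: "g \<in> C" for g
      proof (rule tendsto_lowerbound[OF _ _ \<F>(2)])
        show "((\<lambda>S. \<Sum>x\<in>F. th' S (x, \<phi> g x) - th' S (x, \<phi> g o')) \<longlongrightarrow> (\<Sum>x\<in>F. \<theta> (x, \<phi> g x) - \<theta> (x, \<phi> g o'))) \<F>"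
          by (intro tendsto_sum tendsto_diff lim)
        have "eventually (\<lambda>S. finite S \<and> {g} \<subseteq> S \<and> S \<subseteq> C) (finite_subsets_at_top C)"
          using g unfolding eventually_finite_subsets_at_top by (intro exI[of _ "{g}"]) auto
        then have "eventually (\<lambda>S. finite S \<and> {g} \<subseteq> S \<and> S \<subseteq> C) \<F>"
          using \<F>(1) filter_leD by blast
        then show "eventually (\<lambda>S. c / 2 \<le> (\<Sum>x\<in>F. th' S (x, \<phi> g x) - th' S (x, \<phi> g o'))) \<F>"
          by eventually_elim (use th in \<open>simp add: th'_def\<close>)
      qed
      \<comment> \<open>Rounding down to multiples of \<open>1 / N\<close> costs at most \<open>c / 8\<close> in the sum over \<open>F\<close>.\<close>
      obtain N :: nat where N: "N > 0" "8 * real (card F) / c < real N"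
        using reals_Archimedean2[of "max 0 (8 * real (card F) / c)"] by (auto simp: max_less_iff_conj)
      define \<theta>' where "\<theta>' j = real_of_int \<lfloor>real N * \<theta> j\<rfloor> / real N" for j
      define V where "V = (\<lambda>i. real_of_int i / real N) ` {- int N - 1..int N}"
      have \<theta>'V: "\<theta>' j \<in> V" for j
      proof -
        have "real N * \<bar>\<theta> j\<bar> \<le> real N * 1" using \<theta>1 by (intro mult_left_mono) auto
        then have "\<bar>real N * \<theta> j\<bar> \<le> real N" by (simp add: abs_mult)
        then have "\<lfloor>real N * \<theta> j\<rfloor> \<in> {- int N - 1..int N}" by (simp add: le_floor_iff floor_le_iff abs_le_iff)
        then show ?thesis by (auto simp: V_def \<theta>'_def)
      qed
      have finV: "finite V" by (simp add: V_def)
      have \<theta>'close: "\<theta> j - 1 / real N \<le> \<theta>' j \<and> \<theta>' j \<le> \<theta> j" for j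
      proof -
        have "real N * \<theta> j - 1 \<le> \<lfloor>real N * \<theta> j\<rfloor>" "\<lfloor>real N * \<theta> j\<rfloor> \<le> real N * \<theta> j" by linarith+
        then have "(real N * \<theta> j - 1) / real N \<le> \<theta>' j" "\<theta>' j \<le> real N * \<theta> j / real N"
          unfolding \<theta>'_def by (intro divide_right_mono; simp)+
        then show ?thesis using N by (simp add: diff_divide_distrib)
      qed
      have \<theta>'c: "c / 4 \<le> (\<Sum>x\<in>F. \<theta>' (x, \<phi> g x) - \<theta>' (x, \<phi> g o'))" if g: "g \<in> C" for g
      proof -
        have "c / 2 - card F * (1 / real N) \<le> (\<Sum>x\<in>F. \<theta> (x, \<phi> g x) - \<theta> (x, \<phi> g o')) - (\<Sum>x\<in>F. 1 / real N)"
          using \<theta>c[OF g] by simp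
        also have "\<dots> \<le> (\<Sum>x\<in>F. \<theta>' (x, \<phi> g x) - \<theta>' (x, \<phi> g o'))"
          unfolding sum_subtractf[symmetric]
          by (intro sum_mono) (use \<theta>'close in \<open>smt (verit)\<close>)
        finally have "c / 2 - card F * (1 / real N) \<le> (\<Sum>x\<in>F. \<theta>' (x, \<phi> g x) - \<theta>' (x, \<phi> g o'))" .
        moreover have "card F * (1 / real N) \<le> c / 8" using N c by (simp add: field_simps)
        ultimately show ?thesis using c by linarith
      qed
      \<comment> \<open>\<open>T\<close> records all rounded values at \<open>g\<close>. Its finitely many fibres form the partition on which
        \<open>m\<close> is evaluated.\<close>
      define T where "T g = restrict (\<lambda>x. (\<theta>' (x, \<phi> g x), \<theta>' (x, \<phi> g o'))) F" for g
      have "T ` C \<subseteq> PiE F (\<lambda>_. V \<times> V)" using \<theta>'V by (auto simp: T_def)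
      then have finT: "finite (T ` C)"
        using F finV by (meson finite_PiE finite_SigmaI finite_subset)
      have fib: "m {g \<in> C. T g \<in> B} = (\<Sum>v\<in>T ` C \<inter> B. m {g \<in> C. T g = v})" for B
        using fin_add_prob_fibres[OF m finT[unfolded C_def]] by (simp add: C_def)
      have m0: "m {g \<in> C. T g = v} \<ge> 0" for v using m by (simp add: fin_add_prob_def C_def)
      have m1: "(\<Sum>v\<in>T ` C. m {g \<in> C. T g = v}) = 1"
        using fib[of UNIV] m by (simp add: fin_add_prob_def C_def)
      have marg: "(\<Sum>v\<in>T ` C. m {g \<in> C. T g = v} * r v) = (\<Sum>a\<in>V. a * m {g \<in> C. r (T g) = a})"
        if r: "\<And>g. g \<in> C \<Longrightarrow> r (T g) \<in> V" for r
      proof -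
        have "(\<Sum>v\<in>T ` C. m {g \<in> C. T g = v} * r v)
            = (\<Sum>a\<in>V. \<Sum>v\<in>{v \<in> T ` C. r v = a}. m {g \<in> C. T g = v} * r v)"
          using finT finV r by (intro sum.group[symmetric]) auto
        also have "\<dots> = (\<Sum>a\<in>V. a * (\<Sum>v\<in>T ` C \<inter> {v. r v = a}. m {g \<in> C. T g = v}))"
          unfolding sum_distrib_left by (intro sum.cong) (auto simp: mult.commute)
        also have "\<dots> = (\<Sum>a\<in>V. a * m {g \<in> C. r (T g) = a})" by (simp add: fib[symmetric])
        finally show ?thesis .
      qed
      have bal: "(\<Sum>v\<in>T ` C. m {g \<in> C. T g = v} * fst (v x)) = (\<Sum>v\<in>T ` C. m {g \<in> C. T g = v} * snd (v x))"
        if x: "x \<in> F" for x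
      proof -
        have "m {g \<in> C. fst (T g x) = a} = m {g \<in> C. snd (T g x) = a}" for a
        proof -
          have xX: "x \<in> X" "o' \<in> X" using x o' F by auto
          have "{g \<in> C. fst (T g x) = a} = {g \<in> carrier G. \<phi> g x \<in> {z \<in> X. \<theta>' (x, z) = a}}"
            "{g \<in> C. snd (T g x) = a} = {g \<in> carrier G. \<phi> g o' \<in> {z \<in> X. \<theta>' (x, z) = a}}"
            using x act xX by (auto simp: T_def C_def)
          then show ?thesis using inv[OF xX, of "{z \<in> X. \<theta>' (x, z) = a}"] by (simp add: push_measure_def)
        qed
        then show ?thesis using x \<theta>'V by (subst (1 2) marg) (auto simp: T_def)
      qed
      have "c / 4 = (\<Sum>v\<in>T ` C. m {g \<in> C. T g = v} * (c / 4))"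
        unfolding sum_distrib_right[symmetric] m1 by simp
      also have "\<dots> \<le> (\<Sum>v\<in>T ` C. m {g \<in> C. T g = v} * (\<Sum>x\<in>F. fst (v x) - snd (v x)))"
      proof (intro sum_mono mult_left_mono m0)
        fix v assume "v \<in> T ` C"
        then obtain g where g: "g \<in> C" "v = T g" by blast
        have "(\<Sum>x\<in>F. fst (v x) - snd (v x)) = (\<Sum>x\<in>F. \<theta>' (x, \<phi> g x) - \<theta>' (x, \<phi> g o'))"
          by (intro sum.cong) (auto simp: g T_def)
        then show "c / 4 \<le> (\<Sum>x\<in>F. fst (v x) - snd (v x))" using \<theta>'c[OF g(1)] by simp
      qed
      also have "\<dots> = (\<Sum>x\<in>F. (\<Sum>v\<in>T ` C. m {g \<in> C. T g = v} * fst (v x)) - (\<Sum>v\<in>T ` C. m {g \<in> C. T g = v} * snd (v x)))"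
        unfolding sum_distrib_left by (subst sum.swap) (simp add: right_diff_distrib sum_subtractf)
      also have "\<dots> = 0" using bal by simp
      finally show False using c by simp
    qed
    then obtain \<nu> where \<nu>: "finite (set_pmf \<nu>)" "set_pmf \<nu> \<subseteq> C" "\<And>x. x \<in> F \<Longrightarrow> tv_close c (P x \<nu>) (P o' \<nu>)"
      by blast
    have "tv_close \<epsilon> (P x \<nu>) (P y \<nu>)" if "x \<in> F" "y \<in> F" for x y
      using tv_close_trans[OF \<nu>(3)[OF that(1)] tv_close_sym[OF \<nu>(3)[OF that(2)]]] by (simp add: c_def)
    then show ?thesis using \<nu> by (auto simp: P_def C_def)
  qed
qed

section \<open>From the Liouville property to invariant means\<close>

text \<open>
  The Markov operator of \<open>\<mu>\<close> is the expectation of \<open>f\<close> along one step of the random walk. For bounded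
  \<open>f\<close> the sum that defines harmonicity converges.
\<close>

lemma expectation_step_has_sum:
  fixes f :: "'x \<Rightarrow> real"
  assumes act: "group_action G X \<phi>" and \<mu>: "prob_on G \<mu>" and x: "x \<in> X"
    and f: "\<And>y. y \<in> X \<Longrightarrow> \<bar>f y\<bar> \<le> B"
  shows "((\<lambda>y. f y * trans_prob G \<phi> \<mu> x y) has_sum expect \<mu> (\<lambda>g. f (\<phi> g x))) X"
proof -
  interpret group_action G X \<phi> by fact
  define f' where "f' y = (if y \<in> X then f y else 0)" for y
  define \<nu> where "\<nu> = map_pmf (\<lambda>g. \<phi> g x) \<mu>"
  have set\<mu>: "set_pmf \<mu> \<subseteq> carrier G" using \<mu> by (simp add: prob_on_def)
  have set\<nu>: "set_pmf \<nu> \<subseteq> X" using set\<mu> x element_image by (auto simp: \<nu>_def)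
  have tp: "trans_prob G \<phi> \<mu> x y = pmf \<nu> y" for y
  proof -
    define A where "A = {g \<in> carrier G. \<phi> g x = y}"
    have "((\<lambda>g. indicator A g * pmf \<mu> g) has_sum expect \<mu> (indicator A)) UNIV"
      by (rule pmf_expectation_has_sum[where B=1]) (auto simp: indicator_def)
    also have "?this \<longleftrightarrow> (pmf \<mu> has_sum expect \<mu> (indicator A)) A"
      by (rule has_sum_cong_neutral) auto
    finally have hs: "(pmf \<mu> has_sum expect \<mu> (indicator A)) A" .
    have e: "expect \<mu> (indicator A) = expect \<mu> (\<lambda>g. of_bool (\<phi> g x = y) :: real)"
      using set\<mu> by (intro integral_cong_AE) (auto simp: AE_measure_pmf_iff A_def indicator_def)
    show ?thesis
      unfolding trans_prob_def \<nu>_def pmf_map_eq_expectation using trans[OF infsumI[OF hs] e] unfolding A_def .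
  qed
  have B0: "0 \<le> B" using f[OF x] by linarith
  have "((\<lambda>y. f' y * pmf \<nu> y) has_sum expect \<nu> f') UNIV"
    by (rule pmf_expectation_has_sum[where B=B]) (use f B0 in \<open>auto simp: f'_def\<close>)
  also have "?this \<longleftrightarrow> ((\<lambda>y. f y * pmf \<nu> y) has_sum expect \<nu> f') X"
    by (rule has_sum_cong_neutral) (auto simp: f'_def)
  finally have "((\<lambda>y. f y * pmf \<nu> y) has_sum expect \<nu> f') X" .
  moreover have "expect \<nu> f' = expect \<mu> (\<lambda>g. f (\<phi> g x))"
    unfolding \<nu>_def integral_map_pmf using set\<mu> x element_image
    by (intro integral_cong_AE) (auto simp: AE_measure_pmf_iff f'_def)
  ultimately show ?thesis by (simp add: tp)
qed

text \<open>
  Let \<open>m\<close> be a limit of the Cesaro averages of the convolution powers of \<open>\<mu>\<close>. A further step from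
  \<open>\<mu>\<close> at the beginning of the walk does not change the limit, so \<open>x \<mapsto> m {g. g x \<in> A}\<close> is harmonic.
  It is bounded, hence constant, which is the invariance of \<open>m\<close>.
\<close>

lemma invariant_mean_of_liouville:
  fixes G :: "('g, 'm) monoid_scheme" (structure) and X :: "'x set"
  assumes act: "group_action G X \<phi>" and \<mu>: "prob_on G \<mu>" and li: "liouville G X \<phi> \<mu>"
  shows "\<exists>m. fin_add_prob (carrier G) m \<and>
     (\<forall>x\<in>X. \<forall>y\<in>X. \<forall>A\<subseteq>X. push_measure G \<phi> m x A = push_measure G \<phi> m y A)"
proof -
  interpret group_action G X \<phi> by fact
  interpret group G using group_hom group_hom.axioms(1) by auto
  have set\<mu>: "set_pmf \<mu> \<subseteq> carrier G" using \<mu> by (simp add: prob_on_def)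
  \<comment> \<open>\<open>\<kappa> k\<close> is the \<open>k\<close>-th convolution power of \<open>\<mu>\<close>; each new factor acts first on a point of \<open>X\<close>.\<close>
  define \<kappa> where "\<kappa> k = ((\<lambda>p. bind_pmf \<mu> (\<lambda>h. map_pmf (\<lambda>g. g \<otimes> h) p)) ^^ k) (return_pmf \<one>)" for k
  have \<kappa>Suc: "\<kappa> (Suc k) = bind_pmf \<mu> (\<lambda>h. map_pmf (\<lambda>g. g \<otimes> h) (\<kappa> k))" for k by (simp add: \<kappa>_def)
  have set\<kappa>: "set_pmf (\<kappa> k) \<subseteq> carrier G" for k
  proof (induction k)
    case 0
    then show ?case by (simp add: \<kappa>_def)
  next
    case (Suc k)
    then show ?case using set\<mu> by (auto simp: \<kappa>Suc subset_iff)
  qed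
  define pr where "pr k A = measure_pmf.prob (\<kappa> k) A" for k A
  have pr01: "0 \<le> pr k A" "pr k A \<le> 1" for k A by (auto simp: pr_def)
  have prE: "pr k A = expect (\<kappa> k) (indicator A)" for k A by (simp add: pr_def)
  have prSuc: "pr (Suc k) A = expect \<mu> (\<lambda>h. pr k {g. g \<otimes> h \<in> A})" for k A
  proof -
    have "pr (Suc k) A = expect \<mu> (\<lambda>h. expect (map_pmf (\<lambda>g. g \<otimes> h) (\<kappa> k)) (indicator A))"
      unfolding prE \<kappa>Suc by (rule pmf_expectation_bind_bounded[where B=1]) (auto simp: indicator_def)
    also have "\<dots> = expect \<mu> (\<lambda>h. pr k {g. g \<otimes> h \<in> A})"
      by (simp add: prE vimage_def pr_def)
    finally show ?thesis .
  qed
  define a where "a n A = (\<Sum>k<Suc n. pr k A) / real (Suc n)" for n A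
  have a01: "0 \<le> a n A" "a n A \<le> 1" for n A
  proof -
    show "0 \<le> a n A" unfolding a_def using pr01 by (intro divide_nonneg_nonneg sum_nonneg) auto
    have "(\<Sum>k<Suc n. pr k A) \<le> (\<Sum>k<Suc n. 1)" using pr01 by (intro sum_mono) auto
    then show "a n A \<le> 1" by (simp add: a_def)
  qed
  obtain \<F> m where \<F>: "\<F> \<le> sequentially" "\<F> \<noteq> bot" and lim: "\<And>A. ((\<lambda>n. a n A) \<longlongrightarrow> m A) \<F>"
  proof (rule convergent_subfilter[of sequentially a "\<lambda>_. 1"])
    show "\<bar>a n A\<bar> \<le> 1" for n A using a01[of n A] by simp
  qed auto
  have m01: "0 \<le> m A" "m A \<le> 1" for A
    using tendsto_lowerbound[OF lim[of A] _ \<F>(2), of 0] tendsto_upperbound[OF lim[of A] _ \<F>(2), of 1] a01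
    by auto
  have madd: "m (A \<union> B) = m A + m B" if "A \<inter> B = {}" for A B
  proof -
    have "pr k (A \<union> B) = pr k A + pr k B" for k
      unfolding pr_def using that by (intro measure_pmf.finite_measure_Union) auto
    then have "a n (A \<union> B) = a n A + a n B" for n by (simp add: a_def sum.distrib add_divide_distrib del: sum.lessThan_Suc)
    then have "((\<lambda>n. a n (A \<union> B)) \<longlongrightarrow> m A + m B) \<F>" using tendsto_add[OF lim lim] by simp
    then show ?thesis using tendsto_unique[OF \<F>(2) lim] by blast
  qed
  have mone: "m (carrier G) = 1"
  proof -
    have "pr k (carrier G) = 1" for k
      unfolding pr_def using set\<kappa> by (simp add: measure_pmf.prob_eq_1 AE_measure_pmf_iff subset_iff)
    then have "a n (carrier G) = 1" for n by (simp add: a_def del: sum.lessThan_Suc)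
    then show ?thesis using tendsto_unique[OF \<F>(2) lim[of "carrier G"]] by simp
  qed
  have fa: "fin_add_prob (carrier G) m"
    unfolding fin_add_prob_def Measure_Space.additive_def using m01 madd mone by blast
  have "push_measure G \<phi> m x A = push_measure G \<phi> m y A" if A: "A \<subseteq> X" and xy: "x \<in> X" "y \<in> X" for x y A
  proof -
    define At where "At x = {g \<in> carrier G. \<phi> g x \<in> A}" for x
    define f where "f x = m (At x)" for x
    have harm: "f x = expect \<mu> (\<lambda>h. f (\<phi> h x))" if x: "x \<in> X" for x
    proof -
      have shift: "expect \<mu> (\<lambda>h. pr k (At (\<phi> h x))) = pr (Suc k) (At x)" for k
        unfolding prSuc
      proof (rule integral_cong_AE)
        show "AE h in \<mu>. pr k (At (\<phi> h x)) = pr k {g. g \<otimes> h \<in> At x}"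
        proof (rule AE_pmfI)
          fix h assume h: "h \<in> set_pmf \<mu>"
          then have hc: "h \<in> carrier G" using set\<mu> by auto
          show "pr k (At (\<phi> h x)) = pr k {g. g \<otimes> h \<in> At x}"
            unfolding pr_def
          proof (rule measure_pmf.finite_measure_eq_AE)
            show "AE g in \<kappa> k. (g \<in> At (\<phi> h x)) = (g \<in> {g. g \<otimes> h \<in> At x})"
            proof (rule AE_pmfI)
              fix g assume "g \<in> set_pmf (\<kappa> k)"
              then have "g \<in> carrier G" using set\<kappa> by auto
              then show "(g \<in> At (\<phi> h x)) = (g \<in> {g. g \<otimes> h \<in> At x})"
                using hc x composition_rule[of x g h] by (simp add: At_def)
            qed
          qed auto
        qed
      qed auto
      \<comment> \<open>The Cesaro sum telescopes: an extra step shifts the sum, so only its two end terms change.\<close>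
      have "expect \<mu> (\<lambda>h. a n (At (\<phi> h x))) = a n (At x) + (pr (Suc n) (At x) - pr 0 (At x)) / real (Suc n)" for n
      proof -
        have "expect \<mu> (\<lambda>h. a n (At (\<phi> h x)))
            = (\<Sum>k<Suc n. expect \<mu> (\<lambda>h. pr k (At (\<phi> h x)))) / real (Suc n)"
          unfolding a_def integral_divide_zero
          by (subst Bochner_Integration.integral_sum) (auto intro!: integrable_pmf_bounded[where B=1] simp: pr01 abs_le_iff order_trans[OF _ pr01(1)])
        also have "\<dots> = (\<Sum>k<Suc n. pr (Suc k) (At x)) / real (Suc n)" by (simp only: shift)
        also have "(\<Sum>k<Suc n. pr (Suc k) (At x)) = (\<Sum>k<Suc n. pr k (At x)) + (pr (Suc n) (At x) - pr 0 (At x))"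
          using sum.lessThan_Suc_shift[of "\<lambda>k. pr k (At x)" "Suc n"] by simp
        finally show ?thesis by (simp only: a_def add_divide_distrib)
      qed
      moreover have "((\<lambda>n. (pr (Suc n) (At x) - pr 0 (At x)) / real (Suc n)) \<longlongrightarrow> 0) \<F>"
      proof (rule tendsto_mono[OF \<F>(1)])
        show "(\<lambda>n. (pr (Suc n) (At x) - pr 0 (At x)) / real (Suc n)) \<longlonglongrightarrow> 0"
        proof (rule Lim_null_comparison)
          show "eventually (\<lambda>n. norm ((pr (Suc n) (At x) - pr 0 (At x)) / real (Suc n)) \<le> inverse (real (Suc n))) sequentially"
          proof (intro always_eventually allI)
            fix n
            have "\<bar>pr (Suc n) (At x) - pr 0 (At x)\<bar> \<le> 1"
              using pr01[of "Suc n" "At x"] pr01[of 0 "At x"] by linarith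
            then show "norm ((pr (Suc n) (At x) - pr 0 (At x)) / real (Suc n)) \<le> inverse (real (Suc n))"
              by (simp add: divide_simps)
          qed
          show "(\<lambda>n. inverse (real (Suc n))) \<longlonglongrightarrow> 0" by (rule LIMSEQ_inverse_real_of_nat)
        qed
      qed
      ultimately have "((\<lambda>n. expect \<mu> (\<lambda>h. a n (At (\<phi> h x)))) \<longlongrightarrow> f x + 0) \<F>"
        unfolding f_def by (simp only:) (intro tendsto_add lim)
      moreover have "((\<lambda>n. expect \<mu> (\<lambda>h. a n (At (\<phi> h x)))) \<longlongrightarrow> expect \<mu> (\<lambda>h. f (\<phi> h x))) \<F>"
        unfolding f_def by (rule tendsto_pmf_expectation[where B=1, OF lim _ \<F>(2)]) (use a01 in \<open>simp add: abs_le_iff order_trans[OF _ a01(1)]\<close>)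
      ultimately show ?thesis using tendsto_unique[OF \<F>(2)] by fastforce
    qed
    have f1: "\<bar>f y\<bar> \<le> 1" for y using m01[of "At y"] by (simp add: f_def)
    have "harmonic_on G X \<phi> \<mu> f"
      unfolding harmonic_on_def
    proof
      fix x assume x: "x \<in> X"
      show "((\<lambda>y. f y * trans_prob G \<phi> \<mu> x y) has_sum f x) X"
        by (subst harm[OF x]) (rule expectation_step_has_sum[OF act \<mu> x f1])
    qed
    moreover have "bounded (f ` X)" using f1 by (auto simp: bounded_iff intro!: exI[of _ 1])
    ultimately obtain c where "\<forall>x\<in>X. f x = c" using li unfolding liouville_def by blast
    then show ?thesis using xy by (simp add: f_def At_def push_measure_def)
  qed
  then show ?thesis using fa by blast
qed

section \<open>From Reiter's condition to a Liouville measure\<close>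

text \<open>
  The construction follows Kaimanovich and Vershik. The measure \<open>\<mu>\<close> is a mixture with weights
  \<open>(1/2) ^ (n + 1)\<close>. Its \<open>n\<close>-th part is the average of \<open>\<nu> n\<close>, of its inverse, and of the point masses
  at \<open>h n\<close> and \<open>inv (h n)\<close>, where \<open>h\<close> enumerates the group; the last three make \<open>\<mu>\<close> symmetric with
  full support. The measures \<open>\<nu> n\<close> are chosen one after another. Each \<open>\<nu> n\<close> nearly equalises all points
  that can be reached from \<open>F n\<close> in at most \<open>t n\<close> steps from the parts with smaller index, and \<open>t n\<close> is
  so large that a walk of \<open>t n\<close> steps misses all parts with index at least \<open>n\<close> only with probability
  \<open>(1/2) ^ n\<close> or less.

  Let \<open>f\<close> be harmonic with oscillation at most \<open>\<Omega>\<close>, and run the walk from two points of \<open>F n\<close> with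
  the same increments until a part of index \<open>N \<ge> n\<close> is used for the first time. With probability
  \<open>1/4\<close> the step comes from \<open>\<nu> N\<close>, which makes the two expected values of \<open>f\<close> almost equal. Otherwise
  they differ by at most \<open>\<Omega>\<close>. So the oscillation is at most \<open>3/4 * \<Omega>\<close>, and iterating shows that it is
  \<open>0\<close>.
\<close>

lemma liouville_measure_of_reiter:
  fixes G :: "('g, 'm) monoid_scheme" (structure) and X :: "'x set"
  assumes trans: "transitive_action G X \<phi>" and count: "countable (carrier G)" and re: "reiter G X \<phi>"
  shows "\<exists>\<mu>. prob_on G \<mu> \<and> nondegenerate G \<mu> \<and> symmetric_prob G \<mu> \<and> liouville G X \<phi> \<mu>"
proof -
  interpret transitive_action G X \<phi> by fact
  interpret group G using group_hom group_hom.axioms(1) by auto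
  have act: "group_action G X \<phi>" by unfold_locales
  define C where "C = carrier G"
  have C1: "\<one> \<in> C" "C \<noteq> {}" by (auto simp: C_def)
  have invC: "inv g \<in> C" if "g \<in> C" for g using that by (simp add: C_def)
  have actX: "\<phi> g x \<in> X" if "g \<in> C" "x \<in> X" for g x using that element_image by (simp add: C_def)
  define h where "h = from_nat_into C"
  have hC: "range h = C" unfolding h_def using count C1 by (simp add: range_from_nat_into C_def)
  then have hn: "h n \<in> C" for n by auto
  have countX: "countable X"
  proof (cases "X = {}")
    case False
    then obtain x0 where "x0 \<in> X" by blast
    then have "X \<subseteq> (\<lambda>g. \<phi> g x0) ` C" using unique_orbit by (force simp: C_def)
    then show ?thesis using count countable_subset countable_image by (metis C_def)
  qed auto
  define F where "F n = from_nat_into X ` {..<n} \<inter> X" for n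
  have F: "finite (F n)" "F n \<subseteq> X" for n by (auto simp: F_def)
  have Fmono: "F n \<subseteq> F N" if "n \<le> N" for n N using that by (auto simp: F_def)
  have Fex: "\<exists>n. x \<in> F n" if x: "x \<in> X" for x
  proof -
    obtain k where "from_nat_into X k = x" using from_nat_into_surj[OF countX x] by blast
    then have "x \<in> F (Suc k)" using x by (auto simp: F_def)
    then show ?thesis by blast
  qed
  define geo where "geo = geometric_pmf (1/2)"
  have set_geo: "set_pmf geo = UNIV" unfolding geo_def by (rule set_pmf_geometric) auto
  define s where "s n = measure_pmf.prob geo {..<n}" for n
  have s01: "0 \<le> s n" "s n < 1" for n
  proof -
    show "0 \<le> s n" by (simp add: s_def)
    have "measure_pmf.prob geo ({..<n} \<union> {n}) = s n + pmf geo n"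
      unfolding s_def by (subst measure_pmf.finite_measure_Union) (auto simp: measure_pmf_single)
    moreover have "measure_pmf.prob geo ({..<n} \<union> {n}) \<le> 1" by simp
    moreover have "pmf geo n > 0" using set_geo by (simp add: pmf_positive)
    ultimately show "s n < 1" by linarith
  qed
  have "\<exists>t0. \<forall>n. s n ^ t0 n < (1/2) ^ n"
    using real_arch_pow_inv[OF _ s01(2)] by (intro choice allI) simp
  then obtain t0 where t0: "\<And>n. s n ^ t0 n < (1/2) ^ n" by blast
  \<comment> \<open>Summing makes \<open>t\<close> monotone, so that \<open>\<nu> N\<close> also handles the shorter walks of stages below \<open>N\<close>.\<close>
  define t where "t n = (\<Sum>k\<le>n. t0 k)" for n
  have tmono: "t n \<le> t N" if "n \<le> N" for n N unfolding t_def using that by (intro sum_mono2) auto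
  have st: "s n ^ t n \<le> (1/2) ^ n" for n
  proof -
    have "t0 n \<le> t n" unfolding t_def by (intro member_le_sum) auto
    then have "s n ^ t n \<le> s n ^ t0 n" using s01[of n] by (intro power_decreasing) auto
    then show ?thesis using t0[of n] by linarith
  qed
  \<comment> \<open>\<open>R Q ^^ i\<close> collects the points that are reached in at most \<open>i\<close> steps from \<open>Q\<close>.\<close>
  define R where "R Q Y = Y \<union> (\<lambda>(g, y). \<phi> g y) ` (Q \<times> Y)" for Q Y
  have Riter: "finite ((R Q ^^ i) Y) \<and> (R Q ^^ i) Y \<subseteq> X" if "finite Q" "Q \<subseteq> C" "finite Y" "Y \<subseteq> X" for Q Y i
    using that by (induction i) (auto simp: R_def intro: actX)
  have Rmono1: "R Q Y \<subseteq> R Q' Y'" if "Q \<subseteq> Q'" "Y \<subseteq> Y'" for Q Q' Y Y' using that by (auto simp: R_def)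
  have Rmono: "(R Q ^^ i) Y \<subseteq> (R Q' ^^ j) Y'" if "Q \<subseteq> Q'" "Y \<subseteq> Y'" "i \<le> j" for Q Q' Y Y' i j
    using that
  proof (induction j arbitrary: i)
    case (Suc j)
    show ?case
    proof (cases "i \<le> j")
      case True
      then have "(R Q ^^ i) Y \<subseteq> (R Q' ^^ j) Y'" using Suc by blast
      moreover have "(R Q' ^^ j) Y' \<subseteq> (R Q' ^^ Suc j) Y'" by (auto simp: R_def)
      ultimately show ?thesis by blast
    next
      case False
      then have "i = Suc j" using Suc.prems by simp
      then show ?thesis using Suc.IH[of j] Suc.prems Rmono1 by simp
    qed
  qed auto
  define good where "good Q n \<nu> \<longleftrightarrow> finite (set_pmf \<nu>) \<and> set_pmf \<nu> \<subseteq> C \<and>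
     (\<forall>x\<in>(R Q ^^ t n) (F n). \<forall>y\<in>(R Q ^^ t n) (F n).
        tv_close ((1/2) ^ n) (map_pmf (\<lambda>g. \<phi> g x) \<nu>) (map_pmf (\<lambda>g. \<phi> g y) \<nu>))" for Q n \<nu>
  define sel where "sel Q n = (SOME \<nu>. good Q n \<nu>)" for Q n
  have sel: "good Q n (sel Q n)" if Q: "finite Q" "Q \<subseteq> C" for Q n
    unfolding sel_def
  proof (rule someI_ex)
    have pos: "(1/2::real) ^ n > 0" by simp
    have Y: "finite ((R Q ^^ t n) (F n))" "(R Q ^^ t n) (F n) \<subseteq> X"
      using Riter[OF Q F(1) F(2), of "t n" n] by blast+
    obtain \<nu> where "finite (set_pmf \<nu>)" "set_pmf \<nu> \<subseteq> carrier G"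
      "\<And>x y. x \<in> (R Q ^^ t n) (F n) \<Longrightarrow> y \<in> (R Q ^^ t n) (F n) \<Longrightarrow>
        tv_close ((1/2) ^ n) (map_pmf (\<lambda>g. \<phi> g x) \<nu>) (map_pmf (\<lambda>g. \<phi> g y) \<nu>)"
      by (rule reiterE[OF re pos Y]) blast
    then have "good Q n \<nu>" unfolding good_def C_def by blast
    then show "\<exists>\<nu>. good Q n \<nu>" ..
  qed
  \<comment> \<open>\<open>Qs n\<close> is the support of the parts with index below \<open>n\<close>.\<close>
  define Qs where "Qs = rec_nat {} (\<lambda>n Q. Q \<union> set_pmf (sel Q n) \<union> m_inv G ` set_pmf (sel Q n) \<union> {h n, inv (h n)})"
  define \<nu> where "\<nu> n = sel (Qs n) n" for n
  have Qs0: "Qs 0 = {}" by (simp add: Qs_def)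
  have QsSuc: "Qs (Suc n) = Qs n \<union> set_pmf (\<nu> n) \<union> m_inv G ` set_pmf (\<nu> n) \<union> {h n, inv (h n)}" for n
    by (simp add: Qs_def \<nu>_def)
  have Qs: "finite (Qs n) \<and> Qs n \<subseteq> C" for n
  proof (induction n)
    case (Suc n)
    then have "good (Qs n) n (\<nu> n)" using sel by (simp add: \<nu>_def)
    then show ?case using Suc hn invC by (auto simp: QsSuc good_def)
  qed (simp add: Qs0)
  have good\<nu>: "good (Qs n) n (\<nu> n)" for n using sel Qs by (simp add: \<nu>_def)
  then have \<nu>C: "set_pmf (\<nu> n) \<subseteq> C" for n by (simp add: good_def)
  have Qsmono: "Qs n \<subseteq> Qs N" if "n \<le> N" for n N
    using that by (induction rule: dec_induct) (auto simp: QsSuc)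
  have RX: "z \<in> X" if z: "z \<in> (R (Qs n) ^^ i) (F n)" for z n i
  proof -
    have "(R (Qs n) ^^ i) (F n) \<subseteq> X" using Riter[of "Qs n" "F n" i] Qs[of n] F[of n] by simp
    then show ?thesis using z by blast
  qed
  define pick where "pick n g i = (if i = 0 then g else if i = 1 then inv g else if i = 2 then h n else inv (h n))" for n g and i :: nat
  define \<mu> where "\<mu> = bind_pmf geo (\<lambda>n. bind_pmf (\<nu> n) (\<lambda>g. map_pmf (pick n g) (pmf_of_set {0..<4})))"
  have E\<mu>: "expect \<mu> u = expect geo (\<lambda>n. expect (\<nu> n)
      (\<lambda>g. (u g + u (inv g) + u (h n) + u (inv (h n))) / 4))" if u: "\<And>g. \<bar>u g\<bar> \<le> B" for u :: "'g \<Rightarrow> real" and B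
  proof -
    have 4: "{0..<4::nat} = {0, 1, 2, 3}" by auto
    have eq: "expect (map_pmf (pick n g) (pmf_of_set {0..<4})) u
        = (u g + u (inv g) + u (h n) + u (inv (h n))) / 4" for n g
      unfolding integral_map_pmf by (subst integral_pmf_of_set) (auto simp: 4 pick_def)
    show ?thesis
      unfolding \<mu>_def pmf_expectation_bind_bounded[where f=u, OF u] eq ..
  qed
  have set\<mu>: "set_pmf \<mu> = C"
  proof
    show "set_pmf \<mu> \<subseteq> C" using \<nu>C hn invC by (auto simp: \<mu>_def pick_def)
    show "C \<subseteq> set_pmf \<mu>"
    proof
      fix g assume "g \<in> C"
      then obtain n where n: "g = h n" using hC by auto
      obtain g' where "g' \<in> set_pmf (\<nu> n)" using set_pmf_not_empty by fast
      then show "g \<in> set_pmf \<mu>" unfolding \<mu>_def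
        by (auto simp: set_geo n pick_def intro!: exI[of _ n] bexI[of _ g'] image_eqI[of _ _ 2])
    qed
  qed
  have "prob_on G \<mu>" using set\<mu> by (simp add: prob_on_def C_def)
  moreover have "nondegenerate G \<mu>"
  proof -
    have "g \<in> C" if "g \<in> semigroup_generated G C" for g
      using that by (induction) (auto simp: C_def)
    then have "semigroup_generated G C = C" by (auto intro: semigroup_generated.base)
    then show ?thesis unfolding nondegenerate_def set\<mu> by (simp add: C_def)
  qed
  moreover have "symmetric_prob G \<mu>"
    unfolding symmetric_prob_def
  proof
    fix g assume g: "g \<in> carrier G"
    define u where "u k = (of_bool (k = g) :: real)" for k
    define v where "v k = (of_bool (k = inv g) :: real)" for k
    have uv: "v k = u (inv k)" "v (inv k) = u k" if "k \<in> C" for k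
    proof -
      have kc: "k \<in> carrier G" using that by (simp add: C_def)
      have "k = inv g \<longleftrightarrow> inv k = g" "inv k = inv g \<longleftrightarrow> k = g"
        using kc g by (metis inv_inv)+
      then show "v k = u (inv k)" "v (inv k) = u k" by (simp_all add: u_def v_def)
    qed
    have "pmf \<mu> k = expect \<mu> (\<lambda>k'. of_bool (k' = k))" for k
      using pmf_map_eq_expectation[of "\<lambda>x. x" \<mu> k] by simp
    then have "pmf \<mu> g = expect \<mu> u" "pmf \<mu> (inv g) = expect \<mu> v"
      by (simp_all add: u_def[abs_def] v_def[abs_def])
    moreover have "expect \<mu> v = expect \<mu> u"
    proof -
      have "expect (\<nu> n) (\<lambda>g. (v g + v (inv g) + v (h n) + v (inv (h n))) / 4)
          = expect (\<nu> n) (\<lambda>g. (u g + u (inv g) + u (h n) + u (inv (h n))) / 4)" for n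
        using uv \<nu>C[of n] hn[of n] by (intro integral_cong_AE) (auto simp: AE_measure_pmf_iff subset_iff)
      moreover have "\<bar>u k\<bar> \<le> 1" "\<bar>v k\<bar> \<le> 1" for k by (auto simp: u_def v_def)
      ultimately show ?thesis using E\<mu>[of u 1] E\<mu>[of v 1] by simp
    qed
    ultimately show "pmf \<mu> g = pmf \<mu> (inv g)" by simp
  qed
  moreover have "liouville G X \<phi> \<mu>"
    unfolding liouville_def
  proof (intro allI impI, elim conjE)
    fix f0 assume bd: "bounded (f0 ` X)" and harm: "harmonic_on G X \<phi> \<mu> f0"
    define f where "f x = (if x \<in> X then f0 x else 0)" for x
    obtain B where B: "B > 0" "\<And>x. x \<in> X \<Longrightarrow> \<bar>f0 x\<bar> \<le> B"
      using bd unfolding bounded_pos by (auto simp: image_iff)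
    have fB: "\<bar>f x\<bar> \<le> B" for x using B by (auto simp: f_def)
    have fE: "f x = expect \<mu> (\<lambda>g. f (\<phi> g x))" if x: "x \<in> X" for x
    proof -
      have "f0 x = expect \<mu> (\<lambda>g. f0 (\<phi> g x))"
        using harm x expectation_step_has_sum[OF act \<open>prob_on G \<mu>\<close> x, of f0 B] B(2)
        unfolding harmonic_on_def by (blast intro: has_sum_unique)
      also have "\<dots> = expect \<mu> (\<lambda>g. f (\<phi> g x))"
        using set\<mu> actX x by (intro integral_cong_AE) (auto simp: AE_measure_pmf_iff f_def)
      finally show ?thesis using x by (simp add: f_def)
    qed
    have contract: "\<bar>f x - f y\<bar> \<le> 3 / 4 * \<Omega>"
      if \<Omega>: "\<And>x y. x \<in> X \<Longrightarrow> y \<in> X \<Longrightarrow> \<bar>f x - f y\<bar> \<le> \<Omega>" and xy: "x \<in> X" "y \<in> X" for \<Omega> x y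
    proof -
      have \<Omega>0: "0 \<le> \<Omega>" using \<Omega>[OF xy] by linarith
      define \<beta> where "\<beta> n = (1/4) * (B * (1/2) ^ n) + 3 / 4 * \<Omega>" for n :: nat
      have \<beta>mono: "\<beta> N \<le> \<beta> n" if "n \<le> N" for n N
      proof -
        have "(1/2::real) ^ N \<le> (1/2) ^ n" using that by (rule power_decreasing) auto
        then have "B * (1/2) ^ N \<le> B * (1/2) ^ n" using B(1) by (intro mult_left_mono) auto
        then show ?thesis unfolding \<beta>_def by linarith
      qed
      \<comment> \<open>\<open>s n ^ j\<close> is the probability that \<open>j\<close> steps all have index below \<open>n\<close>.\<close>
      have main: "\<forall>x\<in>(R (Qs n) ^^ (t n - j)) (F n). \<forall>y\<in>(R (Qs n) ^^ (t n - j)) (F n).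
          \<bar>f x - f y\<bar> \<le> s n ^ j * \<Omega> + (1 - s n ^ j) * \<beta> n" if "j \<le> t n" for n j
        using that
      proof (induction j)
        case 0
        show ?case
        proof (intro ballI)
          fix x y assume "x \<in> (R (Qs n) ^^ (t n - 0)) (F n)" "y \<in> (R (Qs n) ^^ (t n - 0)) (F n)"
          then have "x \<in> X" "y \<in> X" using RX by blast+
          then show "\<bar>f x - f y\<bar> \<le> s n ^ 0 * \<Omega> + (1 - s n ^ 0) * \<beta> n" using \<Omega>[of x y] by simp
        qed
      next
        case (Suc j)
        define K where "K = s n ^ j * \<Omega> + (1 - s n ^ j) * \<beta> n"
        have SucI: "t n - j = Suc (t n - Suc j)" using Suc.prems by simp
        show ?case
        proof (intro ballI)
          fix x y assume x: "x \<in> (R (Qs n) ^^ (t n - Suc j)) (F n)" and y: "y \<in> (R (Qs n) ^^ (t n - Suc j)) (F n)"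
          have xX: "x \<in> X" and yX: "y \<in> X" using x y RX by blast+
          define d where "d k = f (\<phi> k x) - f (\<phi> k y)" for k
          have dB: "\<bar>d k\<bar> \<le> 2 * B" for k using fB[of "\<phi> k x"] fB[of "\<phi> k y"] by (auto simp: d_def)
          have d\<Omega>: "\<bar>d k\<bar> \<le> \<Omega>" if "k \<in> C" for k unfolding d_def using that xX yX by (intro \<Omega> actX)
          have dK: "\<bar>d k\<bar> \<le> K" if "k \<in> Qs n" for k
          proof -
            have "\<phi> k x \<in> (R (Qs n) ^^ (t n - j)) (F n)" "\<phi> k y \<in> (R (Qs n) ^^ (t n - j)) (F n)"
              using that x y unfolding SucI by (auto simp: R_def)
            then show ?thesis using Suc.IH Suc.prems by (simp add: d_def K_def)
          qed
          define D where "D N = expect (\<nu> N) (\<lambda>g. (d g + d (inv g) + d (h N) + d (inv (h N))) / 4)" for N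
          have "f x - f y = expect \<mu> d"
            unfolding d_def fE[OF xX] fE[OF yX]
            by (subst Bochner_Integration.integral_diff) (auto intro!: integrable_pmf_bounded[where B=B] fB)
          also have "\<dots> = expect geo D"
            unfolding D_def by (rule E\<mu>[OF dB])
          finally have eq: "f x - f y = expect geo D" .
          \<comment> \<open>A step of index below \<open>n\<close> leads to points covered by the induction hypothesis.\<close>
          have Dlt: "\<bar>D N\<bar> \<le> K" if N: "N < n" for N
            unfolding D_def
          proof (rule pmf_expectation_abs_le)
            fix g assume g: "g \<in> set_pmf (\<nu> N)"
            have sub: "Qs (Suc N) \<subseteq> Qs n" using N by (intro Qsmono) simp
            have "g \<in> Qs n" "inv g \<in> Qs n" "h N \<in> Qs n" "inv (h N) \<in> Qs n"
              using sub g unfolding QsSuc by auto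
            from dK[OF this(1)] dK[OF this(2)] dK[OF this(3)] dK[OF this(4)]
            show "\<bar>(d g + d (inv g) + d (h N) + d (inv (h N))) / 4\<bar> \<le> K" by (auto simp: abs_le_iff)
          qed
          \<comment> \<open>A step of index \<open>N \<ge> n\<close> is equalising in one case out of four.\<close>
          have Dge: "\<bar>D N\<bar> \<le> \<beta> n" if N: "n \<le> N" for N
          proof -
            have x': "x \<in> (R (Qs N) ^^ t N) (F N)" and y': "y \<in> (R (Qs N) ^^ t N) (F N)"
              using x y Rmono[OF Qsmono[OF N] Fmono[OF N], of "t n - Suc j" "t N"] tmono[OF N] by fastforce+
            have "tv_close ((1/2) ^ N) (map_pmf (\<lambda>g. \<phi> g x) (\<nu> N)) (map_pmf (\<lambda>g. \<phi> g y) (\<nu> N))"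
              using good\<nu>[of N] x' y' unfolding good_def by blast
            moreover have "\<bar>f z / B\<bar> \<le> 1" for z using fB B by (simp add: abs_divide)
            ultimately have "\<bar>expect (map_pmf (\<lambda>g. \<phi> g x) (\<nu> N)) (\<lambda>z. f z / B)
                - expect (map_pmf (\<lambda>g. \<phi> g y) (\<nu> N)) (\<lambda>z. f z / B)\<bar> \<le> (1/2) ^ N"
              by (rule tv_closeD)
            then have "\<bar>expect (\<nu> N) (\<lambda>g. f (\<phi> g x)) / B
                - expect (\<nu> N) (\<lambda>g. f (\<phi> g y)) / B\<bar> \<le> (1/2) ^ N"
              by simp
            then have "\<bar>(expect (\<nu> N) (\<lambda>g. f (\<phi> g x))
                - expect (\<nu> N) (\<lambda>g. f (\<phi> g y))) / B\<bar> \<le> (1/2) ^ N"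
              by (simp only: diff_divide_distrib)
            then have "\<bar>expect (\<nu> N) (\<lambda>g. f (\<phi> g x))
                - expect (\<nu> N) (\<lambda>g. f (\<phi> g y))\<bar> \<le> B * (1/2) ^ N"
              using B(1) by (simp add: abs_divide divide_le_eq mult.commute)
            moreover have "expect (\<nu> N) d = expect (\<nu> N) (\<lambda>g. f (\<phi> g x))
                - expect (\<nu> N) (\<lambda>g. f (\<phi> g y))"
              unfolding d_def by (subst Bochner_Integration.integral_diff) (auto intro!: integrable_pmf_bounded[where B=B] fB)
            ultimately have d1: "\<bar>expect (\<nu> N) d\<bar> \<le> B * (1/2) ^ N" by simp
            define e where "e g = d (inv g) + d (h N) + d (inv (h N))" for g
            have d2: "\<bar>expect (\<nu> N) e\<bar> \<le> 3 * \<Omega>"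
            proof (rule pmf_expectation_abs_le)
              fix g assume "g \<in> set_pmf (\<nu> N)"
              then have g: "g \<in> C" using \<nu>C by auto
              show "\<bar>e g\<bar> \<le> 3 * \<Omega>"
                using d\<Omega>[OF invC[OF g]] d\<Omega>[OF hn[of N]] d\<Omega>[OF invC[OF hn[of N]]] unfolding e_def by (auto simp: abs_le_iff)
            qed
            have eb: "\<bar>e g\<bar> \<le> 6 * B" for g using dB[of "inv g"] dB[of "h N"] dB[of "inv (h N)"] by (auto simp: e_def abs_le_iff)
            have "D N = expect (\<nu> N) (\<lambda>g. (d g + e g) / 4)"
              unfolding D_def e_def by (simp add: add.assoc)
            also have "\<dots> = (expect (\<nu> N) d + expect (\<nu> N) e) / 4"
              by (simp add: Bochner_Integration.integral_add[OF integrable_pmf_bounded[OF dB] integrable_pmf_bounded[OF eb]])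
            finally have "\<bar>D N\<bar> \<le> (B * (1/2) ^ N + 3 * \<Omega>) / 4" using d1 d2 by (auto simp: abs_le_iff)
            also have "\<dots> = \<beta> N" by (simp add: \<beta>_def add_divide_distrib)
            also have "\<dots> \<le> \<beta> n" by (rule \<beta>mono[OF N])
            finally show ?thesis .
          qed
          have K0: "0 \<le> K" "0 \<le> \<beta> n"
          proof -
            show "0 \<le> \<beta> n" using B \<Omega>0 by (simp add: \<beta>_def)
            then show "0 \<le> K" using s01[of n] \<Omega>0 by (auto simp: K_def power_le_one intro!: add_nonneg_nonneg mult_nonneg_nonneg)
          qed
          have Dbd: "\<bar>D N\<bar> \<le> K * indicator {..<n} N + \<beta> n * indicator (- {..<n}) N" for N
            using Dlt[of N] Dge[of N] by (cases "N < n") auto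
          have Db: "\<bar>D N\<bar> \<le> K + \<beta> n" for N using Dlt[of N] Dge[of N] K0 by (cases "N < n") auto
          have "\<bar>f x - f y\<bar> \<le> expect geo (\<lambda>N. \<bar>D N\<bar>)"
            unfolding eq by (rule integral_abs_bound)
          also have "\<dots> \<le> expect geo (\<lambda>N. K * indicator {..<n} N + \<beta> n * indicator (- {..<n}) N)"
          proof (rule integral_mono[OF _ _ Dbd])
            show "integrable geo (\<lambda>N. \<bar>D N\<bar>)" by (rule integrable_pmf_bounded[where B="K + \<beta> n"]) (use Db in simp)
            show "integrable geo (\<lambda>N. K * indicator {..<n} N + \<beta> n * indicator (- {..<n}) N :: real)"
              by (rule integrable_pmf_bounded[where B="K + \<beta> n"]) (use K0 in \<open>auto simp: indicator_def\<close>)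
          qed
          also have "\<dots> = K * s n + \<beta> n * measure_pmf.prob geo (- {..<n})"
          proof -
            have i1: "integrable geo (\<lambda>N. K * indicator {..<n} N :: real)"
              by (rule integrable_pmf_bounded[where B=K]) (use K0 in \<open>auto simp: indicator_def\<close>)
            have i2: "integrable geo (\<lambda>N. \<beta> n * indicator (- {..<n}) N :: real)"
              by (rule integrable_pmf_bounded[where B="\<beta> n"]) (use K0 in \<open>auto simp: indicator_def\<close>)
            show ?thesis unfolding Bochner_Integration.integral_add[OF i1 i2] by (simp add: s_def)
          qed
          also have "measure_pmf.prob geo (- {..<n}) = 1 - s n"
            using measure_pmf.prob_compl[of "{..<n}" geo] by (simp add: s_def Compl_eq_Diff_UNIV)
          also have "K * s n + \<beta> n * (1 - s n) = s n ^ Suc j * \<Omega> + (1 - s n ^ Suc j) * \<beta> n"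
            by (simp add: K_def algebra_simps)
          finally show "\<bar>f x - f y\<bar> \<le> s n ^ Suc j * \<Omega> + (1 - s n ^ Suc j) * \<beta> n" .
        qed
      qed
      obtain n0 where n0: "x \<in> F n0" "y \<in> F n0"
        using Fex[OF xy(1)] Fex[OF xy(2)] Fmono by (metis linear subsetD)
      have "\<bar>f x - f y\<bar> \<le> (1/2) ^ n * (\<Omega> + B / 4) + 3 / 4 * \<Omega>" if n: "n0 \<le> n" for n
      proof -
        have "x \<in> F n" "y \<in> F n" using n0 Fmono[OF n] by auto
        then have "\<bar>f x - f y\<bar> \<le> s n ^ t n * \<Omega> + (1 - s n ^ t n) * \<beta> n"
          using main[of "t n" n] by simp
        also have "\<dots> \<le> (1/2) ^ n * \<Omega> + 1 * \<beta> n"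
          using st[of n] \<Omega>0 s01[of n] B by (intro add_mono mult_right_mono) (auto simp: \<beta>_def)
        also have "\<dots> = (1/2) ^ n * (\<Omega> + B / 4) + 3 / 4 * \<Omega>" by (simp add: \<beta>_def algebra_simps)
        finally show ?thesis .
      qed
      moreover have "(\<lambda>n. (1/2) ^ n * (\<Omega> + B / 4) + 3 / 4 * \<Omega>) \<longlonglongrightarrow> 0 * (\<Omega> + B / 4) + 3 / 4 * \<Omega>"
        by (intro tendsto_intros LIMSEQ_realpow_zero) auto
      ultimately show ?thesis using LIMSEQ_le_const[of _ _ "\<bar>f x - f y\<bar>"] by force
    qed
    have pow: "\<bar>f x - f y\<bar> \<le> (3/4) ^ k * (2 * B)" if "x \<in> X" "y \<in> X" for k x y
      using that
    proof (induction k arbitrary: x y)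
      case 0
      then show ?case using fB[of x] fB[of y] by simp
    next
      case (Suc k)
      then show ?case using contract[of "(3/4) ^ k * (2 * B)" x y] by simp
    qed
    have "f x = f y" if "x \<in> X" "y \<in> X" for x y
    proof -
      have "(\<lambda>k. (3/4) ^ k * (2 * B)) \<longlonglongrightarrow> 0 * (2 * B)"
        by (intro tendsto_intros LIMSEQ_realpow_zero) auto
      then have "\<bar>f x - f y\<bar> \<le> 0 * (2 * B)" using pow[OF that] by (intro LIMSEQ_le_const[of _ _ "\<bar>f x - f y\<bar>"]) auto
      then show ?thesis by simp
    qed
    then show "\<exists>c. \<forall>x\<in>X. f0 x = c" unfolding f_def by (metis (full_types))
  qed
  ultimately show ?thesis by blast
qed

section \<open>Non-amenable groups contract square-summable functions\<close>

text \<open>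
  An isoperimetric inequality for sets passes to functions, because a function is a positive
  combination of nested sets (its superlevel sets) and the variations of nested sets add up
  without cancellation. The induction subtracts the least value on the support.
\<close>

lemma coarea:
  fixes F :: "'a \<Rightarrow> real" and r :: "'t \<Rightarrow> 'a \<Rightarrow> 'a"
  assumes "finite S"
    and iso: "\<And>E. E \<subseteq> S \<Longrightarrow> c * real (card E) \<le> (\<Sum>t\<in>T. \<Sum>g\<in>D. \<bar>indicator E (r t g) - indicator E g :: real\<bar>)"
    and F: "\<And>g. 0 \<le> F g" "\<And>g. g \<notin> S \<Longrightarrow> F g = 0"
  shows "c * sum F S \<le> (\<Sum>t\<in>T. \<Sum>g\<in>D. \<bar>F (r t g) - F g\<bar>)"
  using assms
proof (induction S arbitrary: F rule: finite_psubset_induct)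
  case (psubset S F)
  show ?case
  proof (cases "S = {}")
    case True
    then show ?thesis by (simp add: sum_nonneg)
  next
    case False
    define m where "m = Min (F ` S)"
    have fS: "finite (F ` S)" "F ` S \<noteq> {}" using psubset.hyps False by auto
    have "m \<in> F ` S" unfolding m_def using fS by (rule Min_in)
    then obtain g0 where g0: "g0 \<in> S" "F g0 = m" by auto
    have mle: "m \<le> F g" if "g \<in> S" for g unfolding m_def using fS that by auto
    have m0: "0 \<le> m" using g0 psubset.prems(2) by metis
    define F' where "F' g = F g - m * indicator S g" for g
    define S' where "S' = S - {g0}"
    have "S' \<subset> S" using g0 by (auto simp: S'_def)
    then have IH: "c * sum F' S' \<le> (\<Sum>t\<in>T. \<Sum>g\<in>D. \<bar>F' (r t g) - F' g\<bar>)"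
    proof (rule psubset.IH)
      show "c * real (card E) \<le> (\<Sum>t\<in>T. \<Sum>g\<in>D. \<bar>indicator E (r t g) - indicator E g :: real\<bar>)" if "E \<subseteq> S'" for E
        by (rule psubset.prems(1)) (use that in \<open>auto simp: S'_def\<close>)
      show "0 \<le> F' g" for g using mle[of g] psubset.prems(2)[of g] by (auto simp: F'_def indicator_def)
      show "F' g = 0" if "g \<notin> S'" for g
        using that g0 psubset.prems(3)[of g] by (auto simp: F'_def S'_def indicator_def)
    qed
    have "sum F' S = sum F' S' + F' g0"
      unfolding S'_def using psubset.hyps g0 by (simp add: sum.remove)
    then have "sum F' S' = sum F' S" using g0 by (simp add: F'_def)
    also have "\<dots> = sum F S - m * card S" by (simp add: F'_def sum_subtractf)
    finally have s1: "sum F S = sum F' S' + m * card S" by simp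
    have pt: "\<bar>F a - F b\<bar> = m * \<bar>indicator S a - indicator S b\<bar> + \<bar>F' a - F' b\<bar>" for a b
      using mle[of a] mle[of b] m0 psubset.prems(3)[of a] psubset.prems(3)[of b]
      by (auto simp: F'_def indicator_def)
    have "c * sum F S = m * (c * card S) + c * sum F' S'" by (simp add: s1 algebra_simps)
    also have "\<dots> \<le> m * (\<Sum>t\<in>T. \<Sum>g\<in>D. \<bar>indicator S (r t g) - indicator S g :: real\<bar>)
        + (\<Sum>t\<in>T. \<Sum>g\<in>D. \<bar>F' (r t g) - F' g\<bar>)"
      using psubset.prems(1)[OF order_refl] m0 IH by (intro add_mono mult_left_mono) auto
    also have "\<dots> = (\<Sum>t\<in>T. \<Sum>g\<in>D. \<bar>F (r t g) - F g\<bar>)"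
      by (simp add: pt sum.distrib sum_distrib_left)
    finally show ?thesis .
  qed
qed

text \<open>
  Cheeger's inequality: an isoperimetric inequality with constant \<open>c\<close> makes lazy averaging over the
  maps \<open>r t\<close> a strict contraction in \<open>\<ell>\<^sup>2\<close>. The coarea inequality is applied to \<open>f\<^sup>2\<close>; the parallelogram
  identity then turns the variation of \<open>f\<close> into a loss of energy.
\<close>

lemma cheeger:
  fixes f :: "'a \<Rightarrow> real" and r :: "'t \<Rightarrow> 'a \<Rightarrow> 'a"
  assumes S: "finite S" and T: "finite T" "T \<noteq> {}" and D: "finite D" "S \<subseteq> D"
    and r: "\<And>t. t \<in> T \<Longrightarrow> inj_on (r t) D"
    and iso: "\<And>E. E \<subseteq> S \<Longrightarrow> c * real (card E) \<le> (\<Sum>t\<in>T. \<Sum>g\<in>D. \<bar>indicator E (r t g) - indicator E g :: real\<bar>)"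
    and c: "0 < c"
    and f: "\<And>g. 0 \<le> f g" "\<And>g. g \<notin> S \<Longrightarrow> f g = 0"
  shows "(\<Sum>g\<in>D. ((\<Sum>t\<in>T. (f g + f (r t g)) / 2) / card T)\<^sup>2)
      \<le> (1 - c\<^sup>2 / (16 * (card T)\<^sup>2)) * (\<Sum>g\<in>S. (f g)\<^sup>2)"
proof -
  define n where "n = real (card T)"
  define I where "I = (\<Sum>g\<in>S. (f g)\<^sup>2)"
  define V where "V = (\<Sum>t\<in>T. \<Sum>g\<in>D. (f (r t g) - f g)\<^sup>2)"
  have n: "n > 0" using T by (simp add: n_def card_gt_0_iff)
  have ID: "(\<Sum>g\<in>D. (f g)\<^sup>2) = I"
    unfolding I_def using D f by (intro sum.mono_neutral_right) auto
  have It: "(\<Sum>g\<in>D. (f (r t g))\<^sup>2) \<le> I" if "t \<in> T" for t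
  proof -
    have "(\<Sum>g\<in>D. (f (r t g))\<^sup>2) = (\<Sum>g\<in>r t ` D. (f g)\<^sup>2)"
      using r[OF that] by (simp add: sum.reindex)
    also have "\<dots> = (\<Sum>g\<in>r t ` D \<inter> S. (f g)\<^sup>2)"
      using D f by (intro sum.mono_neutral_right) auto
    also have "\<dots> \<le> I" unfolding I_def using S by (intro sum_mono2) auto
    finally show ?thesis .
  qed
  \<comment> \<open>The weight in the estimate of \<open>\<bar>a\<^sup>2 - b\<^sup>2\<bar>\<close> below; it lets half of \<open>c * I\<close> be absorbed.\<close>
  define \<beta> where "\<beta> = c / (4 * n)"
  have \<beta>: "\<beta> > 0" using c n by (simp add: \<beta>_def)
  have "c * I \<le> (\<Sum>t\<in>T. \<Sum>g\<in>D. \<bar>(f (r t g))\<^sup>2 - (f g)\<^sup>2\<bar>)"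
    unfolding I_def by (rule coarea[OF S iso]) (use f in auto)
  also have "\<dots> \<le> (\<Sum>t\<in>T. \<Sum>g\<in>D. (1 / (2 * \<beta>)) * (f (r t g) - f g)\<^sup>2 + \<beta> * ((f (r t g))\<^sup>2 + (f g)\<^sup>2))"
  proof (intro sum_mono)
    fix t g
    define a b where "a = f (r t g)" and "b = f g"
    have ab: "0 \<le> a" "0 \<le> b" using f by (auto simp: a_def b_def)
    have e1: "\<bar>a\<^sup>2 - b\<^sup>2\<bar> = \<bar>a - b\<bar> * (a + b)"
      using ab by (simp add: power2_eq_square square_diff_square_factored abs_mult mult.commute)
    have "0 \<le> (\<bar>a - b\<bar> - \<beta> * (a + b))\<^sup>2" by simp
    moreover have "(\<bar>a - b\<bar> - \<beta> * (a + b))\<^sup>2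
        = (a - b)\<^sup>2 - 2 * \<beta> * (\<bar>a - b\<bar> * (a + b)) + \<beta>\<^sup>2 * (a + b)\<^sup>2"
      using power2_diff[of "\<bar>a - b\<bar>" "\<beta> * (a + b)"] by (simp add: power_mult_distrib mult_ac)
    ultimately have e2: "2 * \<beta> * (\<bar>a - b\<bar> * (a + b)) \<le> (a - b)\<^sup>2 + \<beta>\<^sup>2 * (a + b)\<^sup>2"
      by linarith
    have "(a + b)\<^sup>2 \<le> 2 * (a\<^sup>2 + b\<^sup>2)"
      using sum_squares_bound[of a b] by (simp add: power2_sum)
    then have "\<beta>\<^sup>2 * (a + b)\<^sup>2 \<le> \<beta>\<^sup>2 * (2 * (a\<^sup>2 + b\<^sup>2))" by (intro mult_left_mono) auto
    with e1 e2 have "2 * \<beta> * \<bar>a\<^sup>2 - b\<^sup>2\<bar> \<le> (a - b)\<^sup>2 + \<beta>\<^sup>2 * (2 * (a\<^sup>2 + b\<^sup>2))" by simp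
    then have "\<bar>a\<^sup>2 - b\<^sup>2\<bar> \<le> ((a - b)\<^sup>2 + \<beta>\<^sup>2 * (2 * (a\<^sup>2 + b\<^sup>2))) / (2 * \<beta>)"
      using \<beta> by (simp add: field_simps)
    also have "\<dots> = (1 / (2 * \<beta>)) * (a - b)\<^sup>2 + \<beta> * (a\<^sup>2 + b\<^sup>2)"
      using \<beta> by (simp add: field_simps power2_eq_square)
    finally show "\<bar>(f (r t g))\<^sup>2 - (f g)\<^sup>2\<bar> \<le> (1 / (2 * \<beta>)) * (f (r t g) - f g)\<^sup>2 + \<beta> * ((f (r t g))\<^sup>2 + (f g)\<^sup>2)"
      by (simp add: a_def b_def)
  qed
  also have "\<dots> = (1 / (2 * \<beta>)) * V + \<beta> * (\<Sum>t\<in>T. (\<Sum>g\<in>D. (f (r t g))\<^sup>2) + I)"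
    by (simp add: V_def sum.distrib sum_distrib_left distrib_left mult_ac flip: ID)
  also have "\<dots> \<le> (1 / (2 * \<beta>)) * V + \<beta> * (\<Sum>t\<in>T. I + I)"
    using It \<beta> by (intro add_left_mono mult_left_mono sum_mono add_mono) auto
  also have "\<dots> = (1 / (2 * \<beta>)) * V + (c / 2) * I"
    using n by (simp add: \<beta>_def n_def)
  finally have "(c / 2) * I \<le> (1 / (2 * \<beta>)) * V" by simp
  then have V: "c * \<beta> * I \<le> V" using \<beta> by (simp add: field_simps)
  have "(\<Sum>g\<in>D. ((\<Sum>t\<in>T. (f g + f (r t g)) / 2) / n)\<^sup>2)
      \<le> (\<Sum>g\<in>D. (\<Sum>t\<in>T. (f g)\<^sup>2 / 2 + (f (r t g))\<^sup>2 / 2 - (f (r t g) - f g)\<^sup>2 / 4) / n)"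
  proof (rule sum_mono)
    fix g
    define v where "v t = (f g + f (r t g)) / 2" for t
    have "(sum v T)\<^sup>2 \<le> (\<Sum>t\<in>T. (v t)\<^sup>2) * n"
      unfolding n_def using sum_squared_le_sum_of_squares[of v T] by (simp add: mult.commute)
    then have "(sum v T / n)\<^sup>2 \<le> (\<Sum>t\<in>T. (v t)\<^sup>2) / n"
      using n by (simp add: power_divide field_simps power2_eq_square)
    also have "(\<Sum>t\<in>T. (v t)\<^sup>2) = (\<Sum>t\<in>T. (f g)\<^sup>2 / 2 + (f (r t g))\<^sup>2 / 2 - (f (r t g) - f g)\<^sup>2 / 4)"
      by (intro sum.cong refl) (simp add: v_def power2_eq_square field_simps)
    finally show "((\<Sum>t\<in>T. (f g + f (r t g)) / 2) / n)\<^sup>2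
      \<le> (\<Sum>t\<in>T. (f g)\<^sup>2 / 2 + (f (r t g))\<^sup>2 / 2 - (f (r t g) - f g)\<^sup>2 / 4) / n"
      by (simp add: v_def)
  qed
  also have "\<dots> = (\<Sum>t\<in>T. I / 2 + (\<Sum>g\<in>D. (f (r t g))\<^sup>2) / 2 - (\<Sum>g\<in>D. (f (r t g) - f g)\<^sup>2) / 4) / n"
    unfolding sum_divide_distrib[symmetric] ID[symmetric]
    by (subst sum.swap) (simp add: sum.distrib sum_subtractf sum_divide_distrib)
  also have "\<dots> \<le> (\<Sum>t\<in>T. I / 2 + I / 2 - (\<Sum>g\<in>D. (f (r t g) - f g)\<^sup>2) / 4) / n"
    using n It by (intro divide_right_mono sum_mono diff_right_mono add_left_mono) auto
  also have "\<dots> = I - V / (4 * n)"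
    using n by (simp add: V_def sum_subtractf sum_divide_distrib n_def field_simps)
       (simp add: n_def field_simps sum_distrib_left sum_divide_distrib)?
  also have "\<dots> \<le> I - (c * \<beta> * I) / (4 * n)"
    using V n by (intro diff_left_mono divide_right_mono) auto
  also have "\<dots> = (1 - c\<^sup>2 / (16 * n\<^sup>2)) * I"
    using n by (simp add: \<beta>_def field_simps power2_eq_square)
  finally show ?thesis by (simp add: I_def n_def)
qed

context group
begin

text \<open>
  Existence of finite sets that are almost invariant under right translations, that is,
  amenability of the group.
\<close>

definition right_foelner :: bool where
  "right_foelner \<longleftrightarrow> (\<forall>T \<epsilon>. finite T \<and> T \<subseteq> carrier G \<and> (0::real) < \<epsilon> \<longrightarrow>
     (\<exists>E. finite E \<and> E \<noteq> {} \<and> E \<subseteq> carrier G \<and>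
        (\<forall>t\<in>T. real (card {g \<in> carrier G. (g \<otimes> t \<in> E) \<noteq> (g \<in> E)}) \<le> \<epsilon> * real (card E))))"

text \<open>
  Kesten's theorem in the form needed below: a group that is not amenable has a finitely supported
  measure for which right averaging shrinks \<open>\<ell>\<^sup>2\<close>-norms by any prescribed factor. One lazy step
  contracts by Cheeger's inequality, and \<open>m\<close> steps contract by the \<open>m\<close>-th power.
\<close>

lemma l2_contraction:
  fixes \<eta> :: real
  assumes nf: "\<not> right_foelner" and "0 < \<eta>"
  obtains \<kappa> where "finite (set_pmf \<kappa>)" "set_pmf \<kappa> \<subseteq> carrier G"
    "\<And>f S D. finite S \<Longrightarrow> S \<subseteq> carrier G \<Longrightarrow> finite D \<Longrightarrow> D \<subseteq> carrier G \<Longrightarrow>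
       (\<And>g. 0 \<le> f g) \<Longrightarrow> (\<And>g. g \<notin> S \<Longrightarrow> f g = 0) \<Longrightarrow>
       (\<Sum>g\<in>D. (expect \<kappa> (\<lambda>r. f (g \<otimes> r)))\<^sup>2) \<le> \<eta> * (\<Sum>g\<in>S. (f g)\<^sup>2)"
proof -
  obtain T c where T: "finite T" "T \<subseteq> carrier G" "0 < c"
    and nex: "\<not> (\<exists>E. finite E \<and> E \<noteq> {} \<and> E \<subseteq> carrier G \<and>
        (\<forall>t\<in>T. real (card {g \<in> carrier G. (g \<otimes> t \<in> E) \<noteq> (g \<in> E)}) \<le> c * real (card E)))"
    using nf unfolding right_foelner_def by blast
  have bad: "\<exists>t\<in>T. real (card {g \<in> carrier G. (g \<otimes> t \<in> E) \<noteq> (g \<in> E)}) > c * real (card E)"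
    if "finite E" "E \<noteq> {}" "E \<subseteq> carrier G" for E
    using nex that not_le by blast
  have T0: "T \<noteq> {}" using bad[of "{\<one>}"] by auto
  define n where "n = real (card T)"
  have n: "n > 0" using T T0 by (simp add: n_def card_gt_0_iff)
  define q where "q = 1 - c\<^sup>2 / (16 * n\<^sup>2)"
  define \<kappa>1 where "\<kappa>1 = bind_pmf (pmf_of_set T) (\<lambda>t. map_pmf (\<lambda>b. if b then t else \<one>) (bernoulli_pmf (1/2)))"
  have set1: "set_pmf \<kappa>1 \<subseteq> insert \<one> T" using T T0 by (auto simp: \<kappa>1_def split: if_splits)
  have exp1: "expect \<kappa>1 h = (\<Sum>t\<in>T. (h \<one> + h t) / 2) / n" for h :: "'a \<Rightarrow> real"
  proof -
    have inner: "expect (map_pmf (\<lambda>b. if b then t else \<one>) (bernoulli_pmf (1/2))) h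
        = (h \<one> + h t) / 2" for t
      by (simp add: field_simps)
    have "expect \<kappa>1 h = (\<Sum>t\<in>T. (h \<one> + h t) / 2 /\<^sub>R n)"
      unfolding \<kappa>1_def n_def inner[symmetric]
      by (rule pmf_expectation_bind_pmf_of_set[OF T0 T(1)]) simp
    also have "\<dots> = inverse n * (\<Sum>t\<in>T. (h \<one> + h t) / 2)"
      by (simp only: real_scaleR_def sum_distrib_left)
    also have "\<dots> = (\<Sum>t\<in>T. (h \<one> + h t) / 2) / n" by (rule divide_inverse_commute[symmetric])
    finally show ?thesis .
  qed
  have step: "(\<Sum>g\<in>D. (expect \<kappa>1 (\<lambda>r. f (g \<otimes> r)))\<^sup>2) \<le> q * (\<Sum>g\<in>S. (f g)\<^sup>2)"
    if S: "finite S" "S \<subseteq> carrier G" and D: "finite D" "D \<subseteq> carrier G"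
      and f: "\<And>g. 0 \<le> f g" "\<And>g. g \<notin> S \<Longrightarrow> f g = 0" for S D and f :: "'a \<Rightarrow> real"
  proof -
    \<comment> \<open>\<open>D'\<close> contains the supports of \<open>f\<close> and of its translates, so no variation is lost.\<close>
    define D' where "D' = D \<union> S \<union> (\<Union>t\<in>T. (\<lambda>g. g \<otimes> inv t) ` S)"
    have D': "finite D'" "D' \<subseteq> carrier G" "S \<subseteq> D'" "D \<subseteq> D'"
      using S D T by (auto simp: D'_def subset_iff)
    have "(\<Sum>g\<in>D. (expect \<kappa>1 (\<lambda>r. f (g \<otimes> r)))\<^sup>2)
       \<le> (\<Sum>g\<in>D'. (expect \<kappa>1 (\<lambda>r. f (g \<otimes> r)))\<^sup>2)"
      using D' by (intro sum_mono2) auto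
    also have "\<dots> = (\<Sum>g\<in>D'. ((\<Sum>t\<in>T. (f g + f (g \<otimes> t)) / 2) / real (card T))\<^sup>2)"
      using D' by (intro sum.cong refl) (auto simp: exp1 n_def)
    also have "\<dots> \<le> (1 - c\<^sup>2 / (16 * (card T)\<^sup>2)) * (\<Sum>g\<in>S. (f g)\<^sup>2)"
    proof (rule cheeger[OF S(1) T(1) T0 D'(1,3) _ _ T(3) f])
      show "inj_on (\<lambda>g. g \<otimes> t) D'" if "t \<in> T" for t
        using that T D' by (auto simp: inj_on_def subset_iff)
      show "c * real (card E) \<le> (\<Sum>t\<in>T. \<Sum>g\<in>D'. \<bar>indicator E (g \<otimes> t) - indicator E g :: real\<bar>)"
        if E: "E \<subseteq> S" for E
      proof (cases "E = {}")
        case False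
        obtain t where t: "t \<in> T" "real (card {g \<in> carrier G. (g \<otimes> t \<in> E) \<noteq> (g \<in> E)}) > c * real (card E)"
          using bad[OF finite_subset[OF E S(1)] False] E S by blast
        have sub: "{g \<in> carrier G. (g \<otimes> t \<in> E) \<noteq> (g \<in> E)} \<subseteq> D'"
        proof
          fix g assume g: "g \<in> {g \<in> carrier G. (g \<otimes> t \<in> E) \<noteq> (g \<in> E)}"
          have tc: "t \<in> carrier G" using t T by auto
          have "g = (g \<otimes> t) \<otimes> inv t" using g tc by (simp add: m_assoc)
          then show "g \<in> D'" using g E t unfolding D'_def by blast
        qed
        have "real (card {g \<in> carrier G. (g \<otimes> t \<in> E) \<noteq> (g \<in> E)})
            = (\<Sum>g\<in>{g \<in> carrier G. (g \<otimes> t \<in> E) \<noteq> (g \<in> E)}. \<bar>indicator E (g \<otimes> t) - indicator E g :: real\<bar>)"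
          by (subst sum.cong[OF refl, of _ _ "\<lambda>_. 1"]) (auto simp: indicator_def)
        also have "\<dots> \<le> (\<Sum>g\<in>D'. \<bar>indicator E (g \<otimes> t) - indicator E g :: real\<bar>)"
          using D' sub by (intro sum_mono2) auto
        also have "\<dots> \<le> (\<Sum>t\<in>T. \<Sum>g\<in>D'. \<bar>indicator E (g \<otimes> t) - indicator E g :: real\<bar>)"
          using member_le_sum[OF t(1), of "\<lambda>t. \<Sum>g\<in>D'. \<bar>indicator E (g \<otimes> t) - indicator E g :: real\<bar>"] T
          by (auto simp: sum_nonneg)
        finally show ?thesis using t(2) by linarith
      qed (simp add: sum_nonneg)
    qed
    finally show ?thesis by (simp add: q_def n_def)
  qed
  have q0: "0 \<le> q"
  proof -
    have "0 \<le> (\<Sum>g\<in>{\<one>}. (expect \<kappa>1 (\<lambda>r. indicat_real {\<one>} (g \<otimes> r)))\<^sup>2)"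
      by (intro sum_nonneg) auto
    also have "\<dots> \<le> q * (\<Sum>g\<in>{\<one>}. (indicat_real {\<one>} g)\<^sup>2)" by (rule step) auto
    also have "\<dots> = q" by simp
    finally show ?thesis .
  qed
  have q1: "q < 1" using T n by (simp add: q_def)
  have iter: "\<exists>\<kappa>. finite (set_pmf \<kappa>) \<and> set_pmf \<kappa> \<subseteq> carrier G \<and>
    (\<forall>f S D. finite S \<longrightarrow> S \<subseteq> carrier G \<longrightarrow> finite D \<longrightarrow> D \<subseteq> carrier G \<longrightarrow>
       (\<forall>g. 0 \<le> f g) \<longrightarrow> (\<forall>g. g \<notin> S \<longrightarrow> f g = 0) \<longrightarrow>
       (\<Sum>g\<in>D. (expect \<kappa> (\<lambda>r. f (g \<otimes> r)))\<^sup>2) \<le> q ^ m * (\<Sum>g\<in>S. (f g)\<^sup>2))" for m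
  proof (induction m)
    case 0
    show ?case
    proof (intro exI[of _ "return_pmf \<one>"] conjI allI impI)
      fix f :: "'a \<Rightarrow> real" and S D
      assume a: "finite S" "finite D" "D \<subseteq> carrier G" "\<forall>g. g \<notin> S \<longrightarrow> f g = 0"
      have "(\<Sum>g\<in>D. (expect (return_pmf \<one>) (\<lambda>r. f (g \<otimes> r)))\<^sup>2) = (\<Sum>g\<in>D. (f g)\<^sup>2)"
        using a by (intro sum.cong refl) auto
      also have "\<dots> = (\<Sum>g\<in>D \<inter> S. (f g)\<^sup>2)" using a by (intro sum.mono_neutral_right) auto
      also have "\<dots> \<le> (\<Sum>g\<in>S. (f g)\<^sup>2)" using a by (intro sum_mono2) auto
      finally show "(\<Sum>g\<in>D. (expect (return_pmf \<one>) (\<lambda>r. f (g \<otimes> r)))\<^sup>2) \<le> q ^ 0 * (\<Sum>g\<in>S. (f g)\<^sup>2)" by simp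
    qed auto
  next
    case (Suc m)
    then obtain \<kappa> where \<kappa>: "finite (set_pmf \<kappa>)" "set_pmf \<kappa> \<subseteq> carrier G" and
      IH: "\<And>f S D. finite S \<Longrightarrow> S \<subseteq> carrier G \<Longrightarrow> finite D \<Longrightarrow> D \<subseteq> carrier G \<Longrightarrow>
       (\<forall>g. 0 \<le> f g) \<Longrightarrow> (\<forall>g. g \<notin> S \<longrightarrow> f g = 0) \<Longrightarrow>
       (\<Sum>g\<in>D. (expect \<kappa> (\<lambda>r. f (g \<otimes> r)))\<^sup>2) \<le> q ^ m * (\<Sum>g\<in>S. (f g)\<^sup>2)"
      by blast
    define \<kappa>' where "\<kappa>' = bind_pmf \<kappa>1 (\<lambda>r1. map_pmf (\<lambda>r. r1 \<otimes> r) \<kappa>)"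
    have fin1: "finite (set_pmf \<kappa>1)" using set1 T finite_subset by blast
    have c1: "set_pmf \<kappa>1 \<subseteq> carrier G" using set1 T by auto
    show ?case
    proof (intro exI[of _ \<kappa>'] conjI allI impI)
      show "finite (set_pmf \<kappa>')" using fin1 \<kappa> by (simp add: \<kappa>'_def)
      show "set_pmf \<kappa>' \<subseteq> carrier G" using c1 \<kappa> by (auto simp: \<kappa>'_def)
      fix f :: "'a \<Rightarrow> real" and S D
      assume a: "finite S" "S \<subseteq> carrier G" "finite D" "D \<subseteq> carrier G" "\<forall>g. 0 \<le> f g" "\<forall>g. g \<notin> S \<longrightarrow> f g = 0"
      define h where "h g = (if g \<in> carrier G then expect \<kappa> (\<lambda>r. f (g \<otimes> r)) else 0)" for g
      define S' where "S' = (\<Union>r\<in>set_pmf \<kappa>. (\<lambda>g. g \<otimes> inv r) ` S)"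
      have S': "finite S'" "S' \<subseteq> carrier G" using a \<kappa> by (auto simp: S'_def subset_iff)
      have h0: "0 \<le> h g" for g using a by (auto simp: h_def intro!: Bochner_Integration.integral_nonneg)
      have hS: "h g = 0" if "g \<notin> S'" for g
      proof (cases "g \<in> carrier G")
        case True
        have "f (g \<otimes> r) = 0" if r: "r \<in> set_pmf \<kappa>" for r
        proof (rule ccontr)
          assume "f (g \<otimes> r) \<noteq> 0"
          then have "g \<otimes> r \<in> S" using a by blast
          moreover have "g = (g \<otimes> r) \<otimes> inv r" using True r \<kappa> by (simp add: m_assoc subset_iff)
          ultimately have "g \<in> S'" unfolding S'_def using r by blast
          then show False using \<open>g \<notin> S'\<close> by simp
        qed
        then have "expect \<kappa> (\<lambda>r. f (g \<otimes> r)) = expect \<kappa> (\<lambda>r. 0)"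
          by (intro integral_cong_AE) (auto simp: AE_measure_pmf_iff)
        then show ?thesis by (simp add: h_def)
      qed (simp add: h_def)
      have conv: "expect \<kappa>' (\<lambda>r. f (g \<otimes> r)) = expect \<kappa>1 (\<lambda>r. h (g \<otimes> r))"
        if g: "g \<in> carrier G" for g
      proof -
        have "expect \<kappa>' (\<lambda>r. f (g \<otimes> r))
            = (\<Sum>r1\<in>set_pmf \<kappa>1. pmf \<kappa>1 r1 * expect \<kappa> (\<lambda>r. f (g \<otimes> (r1 \<otimes> r))))"
          unfolding \<kappa>'_def using fin1 \<kappa> by (subst pmf_expectation_bind[OF fin1]) auto
        also have "\<dots> = (\<Sum>r1\<in>set_pmf \<kappa>1. h (g \<otimes> r1) * pmf \<kappa>1 r1)"
        proof (intro sum.cong refl)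
          fix r1 assume r1: "r1 \<in> set_pmf \<kappa>1"
          have "expect \<kappa> (\<lambda>r. f (g \<otimes> (r1 \<otimes> r))) = expect \<kappa> (\<lambda>r. f (g \<otimes> r1 \<otimes> r))"
            using g r1 c1 \<kappa> by (intro integral_cong_AE) (auto simp: AE_measure_pmf_iff m_assoc subset_iff)
          then show "pmf \<kappa>1 r1 * expect \<kappa> (\<lambda>r. f (g \<otimes> (r1 \<otimes> r))) = h (g \<otimes> r1) * pmf \<kappa>1 r1"
            using g r1 c1 by (auto simp: h_def)
        qed
        also have "\<dots> = expect \<kappa>1 (\<lambda>r. h (g \<otimes> r))"
          using fin1 by (subst integral_measure_pmf_real[of "set_pmf \<kappa>1"]) auto
        finally show ?thesis .
      qed
      have "(\<Sum>g\<in>D. (expect \<kappa>' (\<lambda>r. f (g \<otimes> r)))\<^sup>2)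
          = (\<Sum>g\<in>D. (expect \<kappa>1 (\<lambda>r. h (g \<otimes> r)))\<^sup>2)"
        using a conv by (intro sum.cong refl) auto
      also have "\<dots> \<le> q * (\<Sum>g\<in>S'. (h g)\<^sup>2)"
        by (rule step) (use a S' h0 hS in auto)
      also have "(\<Sum>g\<in>S'. (h g)\<^sup>2) = (\<Sum>g\<in>S'. (expect \<kappa> (\<lambda>r. f (g \<otimes> r)))\<^sup>2)"
        using S' by (intro sum.cong refl) (auto simp: h_def)
      also have "q * \<dots> \<le> q * (q ^ m * (\<Sum>g\<in>S. (f g)\<^sup>2))"
        using q0 by (intro mult_left_mono IH) (use a S' in auto)
      finally show "(\<Sum>g\<in>D. (expect \<kappa>' (\<lambda>r. f (g \<otimes> r)))\<^sup>2) \<le> q ^ Suc m * (\<Sum>g\<in>S. (f g)\<^sup>2)"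
        by simp
    qed
  qed
  obtain m where m: "q ^ m < \<eta>" using real_arch_pow_inv[OF assms(2) q1] by blast
  obtain \<kappa> where \<kappa>: "finite (set_pmf \<kappa>)" "set_pmf \<kappa> \<subseteq> carrier G" and
      K: "\<And>f S D. finite S \<Longrightarrow> S \<subseteq> carrier G \<Longrightarrow> finite D \<Longrightarrow> D \<subseteq> carrier G \<Longrightarrow>
       (\<forall>g. 0 \<le> f g) \<Longrightarrow> (\<forall>g. g \<notin> S \<longrightarrow> f g = 0) \<Longrightarrow>
       (\<Sum>g\<in>D. (expect \<kappa> (\<lambda>r. f (g \<otimes> r)))\<^sup>2) \<le> q ^ m * (\<Sum>g\<in>S. (f g)\<^sup>2)"
    using iter[of m] by blast
  show ?thesis
  proof (rule that[OF \<kappa>])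
    fix f :: "'a \<Rightarrow> real" and S D
    assume a: "finite S" "S \<subseteq> carrier G" "finite D" "D \<subseteq> carrier G" "\<And>g. 0 \<le> f g" "\<And>g. g \<notin> S \<Longrightarrow> f g = 0"
    have "(\<Sum>g\<in>D. (expect \<kappa> (\<lambda>r. f (g \<otimes> r)))\<^sup>2) \<le> q ^ m * (\<Sum>g\<in>S. (f g)\<^sup>2)"
      by (rule K) (use a in auto)
    also have "\<dots> \<le> \<eta> * (\<Sum>g\<in>S. (f g)\<^sup>2)" using m by (intro mult_right_mono sum_nonneg) auto
    finally show "(\<Sum>g\<in>D. (expect \<kappa> (\<lambda>r. f (g \<otimes> r)))\<^sup>2) \<le> \<eta> * (\<Sum>g\<in>S. (f g)\<^sup>2)" .
  qed
qed

end

section \<open>Clumping and rounding\<close>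

text \<open>
  Rounding without probability: a function that is affine in each coordinate does not increase when
  a fractional coordinate is moved to the better one of \<open>0\<close> and \<open>1\<close>.
\<close>

lemma rounding_of_multi_affine:
  fixes \<Phi> :: "('a \<Rightarrow> real) \<Rightarrow> real"
  assumes "finite S"
    and aff: "\<And>f g. g \<in> S \<Longrightarrow> \<exists>a b. \<forall>c. \<Phi> (f(g := c)) = a + b * c"
    and f0: "\<And>g. g \<in> S \<Longrightarrow> 0 \<le> f0 g \<and> f0 g \<le> 1"
  obtains E where "E \<subseteq> S" "\<Phi> (\<lambda>g. if g \<in> S then indicator E g else f0 g) \<le> \<Phi> f0"
proof -
  have "\<exists>E\<subseteq>T. \<Phi> (\<lambda>g. if g \<in> T then indicator E g else f0 g) \<le> \<Phi> f0" if "T \<subseteq> S" for T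
    using finite_subset[OF that assms(1)] that
  proof (induction T rule: finite_induct)
    case empty
    then show ?case by simp
  next
    case (insert g T)
    then obtain E where E: "E \<subseteq> T" "\<Phi> (\<lambda>h. if h \<in> T then indicator E h else f0 h) \<le> \<Phi> f0" by auto
    define f where "f = (\<lambda>h. if h \<in> T then indicator E h else f0 h)"
    obtain a b where ab: "\<And>c. \<Phi> (f(g := c)) = a + b * c" using aff[of g f] insert.prems by auto
    have fg: "f(g := f0 g) = f" using insert.hyps by (auto simp: f_def)
    have c: "0 \<le> f0 g" "f0 g \<le> 1" using f0 insert.prems by auto
    have eq: "(\<lambda>h. if h \<in> insert g T then indicator E' h else f0 h) = f(g := indicator E' g)"
      if "E' - {g} = E" for E' :: "'a set"
      using that insert.hyps E(1) by (auto simp: f_def fun_eq_iff indicator_def)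
    have 1: "\<Phi> f = a + b * f0 g" using ab[of "f0 g"] fg by simp
    show ?case
    proof (cases "b \<ge> 0")
      case True
      have "\<Phi> (f(g := indicator E g)) \<le> \<Phi> f"
        using insert.hyps E(1) True c unfolding ab 1 by (auto simp: indicator_def)
      moreover have "E - {g} = E" using insert.hyps E(1) by auto
      ultimately show ?thesis using E eq[of E] unfolding f_def[symmetric]
        by (intro exI[of _ E]) auto
    next
      case False
      have "\<Phi> (f(g := indicator (insert g E) g)) \<le> \<Phi> f"
        using False c unfolding ab 1 by (simp add: mult_left_mono_neg[of "f0 g" 1 b, simplified])
      moreover have "insert g E - {g} = E" using insert.hyps E(1) by auto
      ultimately show ?thesis using E eq[of "insert g E"] unfolding f_def[symmetric]
        by (intro exI[of _ "insert g E"]) auto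
    qed
  qed
  from this[of S] that show ?thesis by auto
qed

text \<open>
  This replaces the choice of a random set that contains each \<open>g\<close> independently with probability
  \<open>f g\<close>. The expected value of the left-hand side over such sets is multi-affine in the
  probabilities: the variance \<open>(\<Sum>g\<in>P j. f g * (1 - f g))\<close> exactly cancels the quadratic terms of the
  square.
\<close>

lemma rounding_with_small_variance:
  fixes f :: "'a \<Rightarrow> real" and P :: "'j \<Rightarrow> 'a set" and c :: "'j \<Rightarrow> real"
  assumes S: "finite S" and J: "finite J" and P: "\<And>j. j \<in> J \<Longrightarrow> P j \<subseteq> S"
    and c: "\<And>j. j \<in> J \<Longrightarrow> 0 \<le> c j"
    and f: "\<And>g. g \<in> S \<Longrightarrow> 0 \<le> f g \<and> f g \<le> 1"
  obtains E where "E \<subseteq> S"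
    "(\<Sum>j\<in>J. c j * (real (card (E \<inter> P j)) - sum f (P j))\<^sup>2) + sum l E
       \<le> (\<Sum>j\<in>J. c j * sum f (P j)) + (\<Sum>g\<in>S. l g * f g)"
proof -
  define \<Phi> where "\<Phi> u = (\<Sum>j\<in>J. c j * ((sum u (P j) - sum f (P j))\<^sup>2 + (\<Sum>g\<in>P j. u g * (1 - u g))))
     + (\<Sum>g\<in>S. l g * u g)" for u :: "'a \<Rightarrow> real"
  have aff: "\<exists>a b. \<forall>r. \<Phi> (u(g := r)) = a + b * r" if g: "g \<in> S" for u g
  proof -
    have trm: "\<exists>A B. \<forall>r. ((sum (u(g := r)) (P j) - sum f (P j))\<^sup>2 + (\<Sum>h\<in>P j. (u(g := r)) h * (1 - (u(g := r)) h))) = A + B * r"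
      if j: "j \<in> J" for j
    proof (cases "g \<in> P j")
      case False
      then have "sum (u(g := r)) (P j) = sum u (P j)"
        "(\<Sum>h\<in>P j. (u(g := r)) h * (1 - (u(g := r)) h)) = (\<Sum>h\<in>P j. u h * (1 - u h))" for r
        by (auto intro!: sum.cong)
      then show ?thesis by (metis add.right_neutral mult_zero_left)
    next
      case True
      have fin: "finite (P j)" using P[OF j] S finite_subset by blast
      define r0 where "r0 = sum u (P j - {g}) - sum f (P j)"
      define k where "k = (\<Sum>h\<in>P j - {g}. u h * (1 - u h))"
      have upd: "(\<Sum>h\<in>P j - {g}. v ((u(g := r)) h)) = (\<Sum>h\<in>P j - {g}. v (u h))" for r and v :: "real \<Rightarrow> real"
        by (intro sum.cong) auto
      have "sum (u(g := r)) (P j) - sum f (P j) = r0 + r" for r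
        unfolding r0_def using sum.remove[OF fin True, of "u(g := r)"] upd[of "\<lambda>y. y" r] by simp
      moreover have "(\<Sum>h\<in>P j. (u(g := r)) h * (1 - (u(g := r)) h)) = k + r * (1 - r)" for r
        unfolding k_def using sum.remove[OF fin True, of "\<lambda>h. (u(g := r)) h * (1 - (u(g := r)) h)"]
          upd[of "\<lambda>y. y * (1 - y)" r] by simp
      ultimately have "(sum (u(g := r)) (P j) - sum f (P j))\<^sup>2 + (\<Sum>h\<in>P j. (u(g := r)) h * (1 - (u(g := r)) h))
          = (r0\<^sup>2 + k) + (2 * r0 + 1) * r" for r
        by (simp add: power2_eq_square algebra_simps)
      then show ?thesis by blast
    qed
    then obtain A B where AB: "\<And>j r. j \<in> J \<Longrightarrow>
       ((sum (u(g := r)) (P j) - sum f (P j))\<^sup>2 + (\<Sum>h\<in>P j. (u(g := r)) h * (1 - (u(g := r)) h))) = A j + B j * r"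
      by metis
    have lin: "(\<Sum>h\<in>S. l h * (u(g := r)) h) = (\<Sum>h\<in>S - {g}. l h * u h) + l g * r" for r
    proof -
      have "(\<Sum>h\<in>S - {g}. l h * (u(g := r)) h) = (\<Sum>h\<in>S - {g}. l h * u h)"
        by (intro sum.cong) auto
      then show ?thesis using sum.remove[OF S g, of "\<lambda>h. l h * (u(g := r)) h"] by simp
    qed
    have "\<Phi> (u(g := r)) = ((\<Sum>j\<in>J. c j * A j) + (\<Sum>h\<in>S - {g}. l h * u h)) + ((\<Sum>j\<in>J. c j * B j) + l g) * r" for r
    proof -
      have "\<Phi> (u(g := r)) = (\<Sum>j\<in>J. c j * (A j + B j * r)) + (\<Sum>h\<in>S. l h * (u(g := r)) h)"
        unfolding \<Phi>_def by (intro arg_cong2[where f="(+)"] sum.cong refl) (simp only: AB)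
      then show ?thesis unfolding lin
        by (simp add: distrib_left distrib_right sum.distrib sum_distrib_right mult.assoc)
    qed
    then show ?thesis by blast
  qed
  obtain E where E: "E \<subseteq> S" "\<Phi> (\<lambda>g. if g \<in> S then indicator E g else f g) \<le> \<Phi> f"
    using rounding_of_multi_affine[of S \<Phi> f, OF S aff f] by blast
  define e where "e = (\<lambda>g. if g \<in> S then indicator E g else f g)"
  have cardE: "sum e (P j) = real (card (E \<inter> P j))" if j: "j \<in> J" for j
  proof -
    have fin: "finite (P j)" using P[OF j] S finite_subset by blast
    have "sum e (P j) = sum (indicator E) (P j)"
      using P[OF j] by (intro sum.cong) (auto simp: e_def)
    also have "\<dots> = real (card (E \<inter> P j))"
      using fin by (simp add: indicator_def Int_commute)
    finally show ?thesis .
  qed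
  have "\<Phi> e = (\<Sum>j\<in>J. c j * (real (card (E \<inter> P j)) - sum f (P j))\<^sup>2) + sum l E"
  proof -
    have "(\<Sum>g\<in>P j. e g * (1 - e g)) = 0" if "j \<in> J" for j
      using P[OF that] by (intro sum.neutral) (auto simp: e_def indicator_def)
    moreover have "(\<Sum>g\<in>S. l g * e g) = sum l E"
    proof -
      have "(\<Sum>g\<in>S. l g * e g) = (\<Sum>g\<in>S. if g \<in> E then l g else 0)"
        by (intro sum.cong) (auto simp: e_def)
      then show ?thesis using E(1) S by (simp add: sum.inter_restrict[symmetric] Int_absorb1)
    qed
    ultimately show ?thesis unfolding \<Phi>_def by (simp add: cardE)
  qed
  moreover have "\<Phi> f \<le> (\<Sum>j\<in>J. c j * sum f (P j)) + (\<Sum>g\<in>S. l g * f g)"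
    unfolding \<Phi>_def
  proof (intro add_right_mono sum_mono mult_left_mono)
    fix j assume j: "j \<in> J"
    have "(\<Sum>g\<in>P j. f g * (1 - f g)) \<le> sum f (P j)"
      using P[OF j] f by (intro sum_mono) (auto simp: mult_left_le)
    then show "(sum f (P j) - sum f (P j))\<^sup>2 + (\<Sum>g\<in>P j. f g * (1 - f g)) \<le> sum f (P j)" by simp
  qed (use c in auto)
  ultimately show ?thesis using E that unfolding e_def by force
qed

lemma sum_fibres:
  fixes h :: "'a \<Rightarrow> real"
  assumes "finite S" "finite Z" "\<And>g. g \<in> S \<Longrightarrow> a g \<in> Z"
  shows "(\<Sum>z\<in>Z. u z * (\<Sum>g\<in>{g \<in> S. a g = z}. h g)) = (\<Sum>g\<in>S. u (a g) * h g)"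
proof -
  have "(\<Sum>g\<in>S. u (a g) * h g) = (\<Sum>z\<in>Z. \<Sum>g\<in>{g \<in> S. a g = z}. u (a g) * h g)"
    using assms by (intro sum.group[symmetric]) auto
  also have "\<dots> = (\<Sum>z\<in>Z. u z * (\<Sum>g\<in>{g \<in> S. a g = z}. h g))"
    by (simp add: sum_distrib_left)
  finally show ?thesis ..
qed

text \<open>
  Suppose that the weights \<open>f\<close> have, for all \<open>x \<in> F\<close>, nearly the same image \<open>p\<close> under \<open>g \<mapsto> act g x\<close>, and
  that most of the mass of \<open>p\<close> lies on points of weight at least \<open>1 / \<beta>\<close>. Then \<open>f\<close> can be rounded to a set
  with the same property. At a point of large weight \<open>p z\<close> the number of chosen elements deviates by
  about \<open>sqrt (p z)\<close>, which is small compared with \<open>p z\<close>; the light points carry too little mass to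
  matter.
\<close>

lemma balanced_rounding:
  fixes act :: "'g \<Rightarrow> 'x \<Rightarrow> 'x" and f :: "'g \<Rightarrow> real" and p :: "'x \<Rightarrow> real"
  assumes S: "finite S" and Z: "finite Z" and F: "finite F" "F \<noteq> {}"
    and act: "\<And>g x. g \<in> S \<Longrightarrow> x \<in> F \<Longrightarrow> act g x \<in> Z"
    and f: "\<And>g. g \<in> S \<Longrightarrow> 0 \<le> f g \<and> f g \<le> 1" and fM: "sum f S \<le> M"
    and p: "\<And>z. z \<in> Z \<Longrightarrow> 0 \<le> p z" and pM: "sum p Z \<le> M"
    and s: "0 < s" "s \<le> 1" and \<beta>: "\<beta> = s\<^sup>2 / (4 * real (card F))"
    and light: "(\<Sum>z\<in>{z \<in> Z. p z < 1 / \<beta>}. p z) \<le> \<beta> * M"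
    and close: "\<And>x. x \<in> F \<Longrightarrow> (\<Sum>z\<in>Z. \<bar>(\<Sum>g\<in>{g \<in> S. act g x = z}. f g) - p z\<bar>) \<le> 2 * \<beta> * M"
  obtains E where "E \<subseteq> S"
    "\<And>x. x \<in> F \<Longrightarrow> (\<Sum>z\<in>Z. \<bar>real (card {g \<in> E. act g x = z}) - p z\<bar>) \<le> 3 * s * M"
proof -
  define k where "k = real (card F)"
  have k: "k \<ge> 1" using F by (simp add: k_def Suc_leI card_gt_0_iff)
  have \<beta>0: "\<beta> > 0" using s k by (simp add: \<beta> k_def)
  have \<beta>s: "4 * \<beta> * k = s\<^sup>2" using k by (simp add: \<beta> k_def)
  have M0: "M \<ge> 0" using sum_nonneg[of S f] f fM by force
  \<comment> \<open>Deviations are measured by a weighted variance at the heavy points and by plain mass at the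
    light ones.\<close>
  define Zh where "Zh = {z \<in> Z. p z \<ge> 1 / \<beta>}"
  define Zl where "Zl = {z \<in> Z. p z < 1 / \<beta>}"
  have ZZ: "Z = Zh \<union> Zl" "Zh \<inter> Zl = {}" "finite Zh" "finite Zl" using Z by (auto simp: Zh_def Zl_def)
  define fx where "fx x z = (\<Sum>g\<in>{g \<in> S. act g x = z}. f g)" for x z
  have fx0: "fx x z \<ge> 0" for x z unfolding fx_def using f by (intro sum_nonneg) auto
  define l where "l g = (\<Sum>x\<in>F. if act g x \<in> Zl then 1 else 0 :: real)" for g
  define J where "J = F \<times> Zh"
  define P where "P = (\<lambda>(x, z). {g \<in> S. act g x = z})"
  define c where "c = (\<lambda>(x::'x, z). 1 / p z)"
  have phigh: "p z > 0" "1 / p z \<le> \<beta>" if "z \<in> Zh" for z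
  proof -
    have "p z \<ge> 1 / \<beta>" using that by (simp add: Zh_def)
    moreover have "1 / \<beta> > 0" using \<beta>0 by simp
    ultimately show "p z > 0" by linarith
    then show "1 / p z \<le> \<beta>" using \<open>p z \<ge> 1 / \<beta>\<close> \<beta>0 by (simp add: field_simps)
  qed
  obtain E where E: "E \<subseteq> S"
    and bound: "(\<Sum>j\<in>J. c j * (real (card (E \<inter> P j)) - sum f (P j))\<^sup>2) + sum l E
       \<le> (\<Sum>j\<in>J. c j * sum f (P j)) + (\<Sum>g\<in>S. l g * f g)"
  proof (rule rounding_with_small_variance[of S J P c f l])
    show "finite J" using F ZZ by (simp add: J_def)
    show "P j \<subseteq> S" for j by (auto simp: P_def split: prod.splits)
    show "0 \<le> c j" if "j \<in> J" for j using that phigh by (force simp: c_def J_def less_imp_le)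
  qed (use S f in auto)
  have EP: "E \<inter> P (x, z) = {g \<in> E. act g x = z}" for x z using E by (auto simp: P_def)
  have PF: "sum f (P (x, z)) = fx x z" for x z by (simp add: P_def fx_def)
  have finE: "finite E" using E S finite_subset by blast
  have fx_sum: "(\<Sum>z\<in>Z'. fx x z) \<le> M" if "x \<in> F" "Z' \<subseteq> Z" for x Z'
  proof -
    have "(\<Sum>z\<in>Z'. fx x z) \<le> (\<Sum>z\<in>Z. fx x z)" using that Z fx0 by (intro sum_mono2) auto
    also have "\<dots> = sum f S"
      using sum_fibres[OF S Z, of "\<lambda>g. act g x" "\<lambda>_. 1" f] act that unfolding fx_def by simp
    finally show ?thesis using fM by linarith
  qed
  have light_f: "(\<Sum>z\<in>Zl. fx x z) \<le> 3 * \<beta> * M" if x: "x \<in> F" for x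
  proof -
    have "(\<Sum>z\<in>Zl. fx x z) \<le> (\<Sum>z\<in>Zl. p z + \<bar>fx x z - p z\<bar>)" by (intro sum_mono) auto
    also have "\<dots> \<le> sum p Zl + (\<Sum>z\<in>Z. \<bar>fx x z - p z\<bar>)"
      unfolding sum.distrib using Z by (intro add_left_mono sum_mono2) (auto simp: Zl_def)
    also have "\<dots> \<le> \<beta> * M + 2 * \<beta> * M"
      using light close[OF x] unfolding Zl_def fx_def by linarith
    finally show ?thesis by (simp add: mult.commute mult.left_commute)
  qed
  have heavy_term: "(\<Sum>j\<in>J. c j * sum f (P j)) \<le> k * (\<beta> * M)"
  proof -
    have "(\<Sum>j\<in>J. c j * sum f (P j)) = (\<Sum>x\<in>F. \<Sum>z\<in>Zh. (1 / p z) * fx x z)"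
      unfolding J_def by (simp add: c_def PF sum.cartesian_product')
    also have "\<dots> \<le> (\<Sum>x\<in>F. \<beta> * M)"
    proof (rule sum_mono)
      fix x assume x: "x \<in> F"
      have "(\<Sum>z\<in>Zh. (1 / p z) * fx x z) \<le> (\<Sum>z\<in>Zh. \<beta> * fx x z)"
        using phigh fx0 by (intro sum_mono mult_right_mono) auto
      also have "\<dots> \<le> \<beta> * M"
        unfolding sum_distrib_left[symmetric] using fx_sum[OF x, of Zh] \<beta>0 ZZ(1)
        by (intro mult_left_mono) auto
      finally show "(\<Sum>z\<in>Zh. (1 / p z) * fx x z) \<le> \<beta> * M" .
    qed
    finally show ?thesis by (simp add: k_def)
  qed
  have light_sum: "(\<Sum>g\<in>S'. l g * h g) = (\<Sum>x\<in>F. \<Sum>z\<in>Zl. \<Sum>g\<in>{g \<in> S'. act g x = z}. h g)"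
    if "S' \<subseteq> S" for S' and h :: "'g \<Rightarrow> real"
  proof -
    have fin: "finite S'" using that S finite_subset by blast
    have "(\<Sum>g\<in>S'. l g * h g) = (\<Sum>x\<in>F. \<Sum>g\<in>S'. (if act g x \<in> Zl then 1 else 0) * h g)"
      unfolding l_def sum_distrib_right by (rule sum.swap)
    also have "\<dots> = (\<Sum>x\<in>F. \<Sum>z\<in>Z. (if z \<in> Zl then 1 else 0) * (\<Sum>g\<in>{g \<in> S'. act g x = z}. h g))"
      using that act by (intro sum.cong refl sum_fibres[OF fin Z, symmetric]) auto
    also have "\<dots> = (\<Sum>x\<in>F. \<Sum>z\<in>Zl. \<Sum>g\<in>{g \<in> S'. act g x = z}. h g)"
    proof (rule sum.cong[OF refl])
      fix x
      have "(\<Sum>z\<in>Z. (if z \<in> Zl then 1 else 0) * (\<Sum>g\<in>{g \<in> S'. act g x = z}. h g))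
         = (\<Sum>z\<in>Z. if z \<in> Zl then (\<Sum>g\<in>{g \<in> S'. act g x = z}. h g) else 0)"
        by (intro sum.cong) auto
      also have "\<dots> = (\<Sum>z\<in>Zl. \<Sum>g\<in>{g \<in> S'. act g x = z}. h g)"
        using Z ZZ(1) by (subst sum.inter_restrict[symmetric]) (auto intro!: sum.cong)
      finally show "(\<Sum>z\<in>Z. (if z \<in> Zl then 1 else 0) * (\<Sum>g\<in>{g \<in> S'. act g x = z}. h g))
         = (\<Sum>z\<in>Zl. \<Sum>g\<in>{g \<in> S'. act g x = z}. h g)" .
    qed
    finally show ?thesis .
  qed
  have light_term: "(\<Sum>g\<in>S. l g * f g) \<le> k * (3 * \<beta> * M)"
  proof -
    have "(\<Sum>g\<in>S. l g * f g) = (\<Sum>x\<in>F. \<Sum>z\<in>Zl. fx x z)"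
      unfolding light_sum[OF order_refl] fx_def ..
    also have "\<dots> \<le> (\<Sum>x\<in>F. 3 * \<beta> * M)" by (intro sum_mono light_f)
    finally show ?thesis by (simp add: k_def)
  qed
  define ex where "ex x z = real (card {g \<in> E. act g x = z})" for x z
  have tot: "(\<Sum>x\<in>F. \<Sum>z\<in>Zh. (1 / p z) * (ex x z - fx x z)\<^sup>2) + (\<Sum>x\<in>F. \<Sum>z\<in>Zl. ex x z) \<le> s\<^sup>2 * M"
  proof -
    have "(\<Sum>j\<in>J. c j * (real (card (E \<inter> P j)) - sum f (P j))\<^sup>2)
        = (\<Sum>x\<in>F. \<Sum>z\<in>Zh. (1 / p z) * (ex x z - fx x z)\<^sup>2)"
      unfolding J_def
      by (simp add: c_def EP PF ex_def sum.cartesian_product')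
    moreover have "sum l E = (\<Sum>x\<in>F. \<Sum>z\<in>Zl. ex x z)"
      using light_sum[OF E, of "\<lambda>_. 1"] by (simp add: ex_def)
    ultimately have "(\<Sum>x\<in>F. \<Sum>z\<in>Zh. (1 / p z) * (ex x z - fx x z)\<^sup>2) + (\<Sum>x\<in>F. \<Sum>z\<in>Zl. ex x z)
        \<le> k * (\<beta> * M) + k * (3 * \<beta> * M)"
      using bound heavy_term light_term by linarith
    also have "\<dots> = s\<^sup>2 * M" unfolding \<beta>s[symmetric] by (simp add: algebra_simps)
    finally show ?thesis .
  qed
  have "(\<Sum>z\<in>Z. \<bar>ex x z - p z\<bar>) \<le> 3 * s * M" if x: "x \<in> F" for x
  proof -
    have nn: "0 \<le> (\<Sum>z\<in>Zh. (1 / p z) * (ex y z - fx y z)\<^sup>2)" "0 \<le> (\<Sum>z\<in>Zl. ex y z)" for y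
      using phigh by (auto intro!: sum_nonneg mult_nonneg_nonneg simp: ex_def less_imp_le)
    have A: "(\<Sum>z\<in>Zh. (1 / p z) * (ex x z - fx x z)\<^sup>2) + (\<Sum>z\<in>Zl. ex x z) \<le> s\<^sup>2 * M"
    proof -
      have "(\<Sum>z\<in>Zh. (1 / p z) * (ex x z - fx x z)\<^sup>2) \<le> (\<Sum>x\<in>F. \<Sum>z\<in>Zh. (1 / p z) * (ex x z - fx x z)\<^sup>2)"
        using member_le_sum[OF x, of "\<lambda>x. \<Sum>z\<in>Zh. (1 / p z) * (ex x z - fx x z)\<^sup>2"] nn F by auto
      moreover have "(\<Sum>z\<in>Zl. ex x z) \<le> (\<Sum>x\<in>F. \<Sum>z\<in>Zl. ex x z)"
        using member_le_sum[OF x, of "\<lambda>x. \<Sum>z\<in>Zl. ex x z"] nn F by auto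
      ultimately show ?thesis using tot by linarith
    qed
    have sq: "0 \<le> (\<Sum>z\<in>Zh. (1 / p z) * (ex x z - fx x z)\<^sup>2)" "0 \<le> (\<Sum>z\<in>Zl. ex x z)" using nn by auto
    \<comment> \<open>Cauchy-Schwarz in the form \<open>a \<le> a\<^sup>2 / (2 * s * p z) + s * p z / 2\<close>.\<close>
    have "(\<Sum>z\<in>Zh. \<bar>ex x z - fx x z\<bar>) \<le> (\<Sum>z\<in>Zh. (1 / (2 * s)) * ((1 / p z) * (ex x z - fx x z)\<^sup>2) + (s / 2) * p z)"
    proof (rule sum_mono)
      fix z assume z: "z \<in> Zh"
      define a where "a = \<bar>ex x z - fx x z\<bar>"
      have "0 \<le> (a - s * p z)\<^sup>2" by simp
      then have "2 * s * p z * a \<le> a\<^sup>2 + (s * p z)\<^sup>2" by (simp add: power2_diff algebra_simps)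
      then have "a \<le> (1 / (2 * s)) * ((1 / p z) * a\<^sup>2) + (s / 2) * p z"
        using phigh(1)[OF z] s by (simp add: field_simps power2_eq_square)
      then show "\<bar>ex x z - fx x z\<bar> \<le> (1 / (2 * s)) * ((1 / p z) * (ex x z - fx x z)\<^sup>2) + (s / 2) * p z"
        by (simp add: a_def)
    qed
    also have "\<dots> = (1 / (2 * s)) * (\<Sum>z\<in>Zh. (1 / p z) * (ex x z - fx x z)\<^sup>2) + (s / 2) * sum p Zh"
      by (simp add: sum.distrib sum_distrib_left)
    also have "\<dots> \<le> (1 / (2 * s)) * (s\<^sup>2 * M) + (s / 2) * M"
    proof (intro add_mono mult_left_mono)
      have "sum p Zh \<le> sum p Z" using Z p by (intro sum_mono2) (auto simp: Zh_def)
      then show "sum p Zh \<le> M" using pM by linarith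
    qed (use A sq s in auto)
    also have "\<dots> = s * M" using s by (simp add: power2_eq_square)
    finally have h: "(\<Sum>z\<in>Zh. \<bar>ex x z - fx x z\<bar>) \<le> s * M" .
    have "(\<Sum>z\<in>Z. \<bar>ex x z - p z\<bar>) = (\<Sum>z\<in>Zh. \<bar>ex x z - p z\<bar>) + (\<Sum>z\<in>Zl. \<bar>ex x z - p z\<bar>)"
      using ZZ by (simp add: sum.union_disjoint)
    also have "(\<Sum>z\<in>Zh. \<bar>ex x z - p z\<bar>) \<le> (\<Sum>z\<in>Zh. \<bar>ex x z - fx x z\<bar>) + (\<Sum>z\<in>Zh. \<bar>fx x z - p z\<bar>)"
      unfolding sum.distrib[symmetric] by (intro sum_mono) auto
    also have "(\<Sum>z\<in>Zh. \<bar>fx x z - p z\<bar>) \<le> (\<Sum>z\<in>Z. \<bar>fx x z - p z\<bar>)"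
      using Z by (intro sum_mono2) (auto simp: Zh_def)
    also have "\<dots> \<le> 2 * \<beta> * M" using close[OF x] by (simp add: fx_def)
    also have "(\<Sum>z\<in>Zl. \<bar>ex x z - p z\<bar>) \<le> (\<Sum>z\<in>Zl. ex x z) + sum p Zl"
      unfolding sum.distrib[symmetric] using p by (intro sum_mono) (force simp: ex_def Zl_def)
    finally have "(\<Sum>z\<in>Z. \<bar>ex x z - p z\<bar>) \<le> s * M + 2 * \<beta> * M + (s\<^sup>2 * M + \<beta> * M)"
      using h A sq light unfolding Zl_def by linarith
    also have "\<dots> = (s + s\<^sup>2 + 3 * \<beta>) * M" by (simp add: algebra_simps)
    also have "\<dots> \<le> (3 * s) * M"
    proof (intro mult_right_mono M0)
      have "\<beta> * 1 \<le> \<beta> * k" using k \<beta>0 by (intro mult_left_mono) auto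
      moreover have "s\<^sup>2 \<le> s" using s by (simp add: power2_eq_square mult_left_le)
      ultimately show "s + s\<^sup>2 + 3 * \<beta> \<le> 3 * s" using \<beta>s \<beta>0 by linarith
    qed
    finally show ?thesis .
  qed
  then show ?thesis using that[OF E] by (simp add: ex_def)
qed

text \<open>
  Think of a copy of \<open>p\<close> being placed on \<open>X\<close> by each \<open>e\<close>. If the images of \<open>w\<close> under \<open>e \<mapsto> act e y\<close>
  are nearly the same for all \<open>y \<in> Y\<close>, then they have a common majorant \<open>m\<close> of small total mass. In
  this situation some set \<open>E\<close> of copies piles up: almost all of the mass of each copy lies at points
  where the total mass of all copies is at least \<open>\<tau>\<close>.

  The set maximises \<open>\<beta> * sum w E - (\<Sum>z\<in>Z. m z * min (deg E z) \<tau>)\<close>. Removing \<open>e\<close> from a maximiser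
  costs \<open>\<beta> * w e\<close> and gains at least \<open>w e\<close> times the mass of the copy \<open>e\<close> at points of degree below
  \<open>\<tau>\<close>, so this mass is at most \<open>\<beta>\<close>. The full set \<open>A\<close> has value at least \<open>\<beta> - 2 * \<tau> > 0\<close>, so a maximiser
  is not empty.
\<close>

lemma clumping:
  fixes w :: "'e \<Rightarrow> real" and p :: "'y \<Rightarrow> real" and act :: "'e \<Rightarrow> 'y \<Rightarrow> 'x" and m :: "'x \<Rightarrow> real"
  assumes A: "finite A" and Y: "finite Y" and Z: "finite Z"
    and act: "\<And>e y. e \<in> A \<Longrightarrow> y \<in> Y \<Longrightarrow> act e y \<in> Z"
    and w: "\<And>e. e \<in> A \<Longrightarrow> 0 < w e" "sum w A = 1"
    and p: "\<And>y. y \<in> Y \<Longrightarrow> 0 \<le> p y"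
    and m: "\<And>e y. e \<in> A \<Longrightarrow> y \<in> Y \<Longrightarrow> w e \<le> m (act e y)" "\<And>z. z \<in> Z \<Longrightarrow> 0 \<le> m z" "sum m Z \<le> 2"
    and \<tau>: "0 < \<tau>" "2 * \<tau> < \<beta>"
  obtains E where "E \<subseteq> A" "E \<noteq> {}"
    "\<And>e. e \<in> E \<Longrightarrow>
       (\<Sum>y\<in>{y \<in> Y. (\<Sum>e'\<in>E. \<Sum>y'\<in>{y' \<in> Y. act e' y' = act e y}. p y') < \<tau>}. p y) \<le> \<beta>"
proof -
  define d where "d e z = (\<Sum>y\<in>{y \<in> Y. act e y = z}. p y)" for e z
  define deg where "deg E z = (\<Sum>e\<in>E. d e z)" for E z
  define J where "J E = \<beta> * sum w E - (\<Sum>z\<in>Z. m z * min (deg E z) \<tau>)" for E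
  have d0: "0 \<le> d e z" for e z unfolding d_def using p by (intro sum_nonneg) auto
  obtain E where E: "E \<subseteq> A" and max: "\<And>E'. E' \<subseteq> A \<Longrightarrow> J E' \<le> J E"
  proof -
    have "finite (J ` Pow A)" "J ` Pow A \<noteq> {}" using A by auto
    then have "Max (J ` Pow A) \<in> J ` Pow A" by (rule Max_in)
    then obtain E where "E \<subseteq> A" "J E = Max (J ` Pow A)" by auto
    then show ?thesis using that[of E] A by auto
  qed
  have finE: "finite E" using E A finite_subset by blast
  have "E \<noteq> {}"
  proof
    assume "E = {}"
    then have "J E = 0" using \<tau> by (simp add: J_def deg_def min_def)
    moreover have "J A > 0"
    proof -
      have "(\<Sum>z\<in>Z. m z * min (deg A z) \<tau>) \<le> (\<Sum>z\<in>Z. m z * \<tau>)"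
        using m by (intro sum_mono mult_left_mono) auto
      also have "\<dots> \<le> 2 * \<tau>" unfolding sum_distrib_right[symmetric] using m \<tau> by (intro mult_right_mono) auto
      finally show ?thesis using \<tau> w by (simp add: J_def)
    qed
    ultimately show False using max[of A] by simp
  qed
  moreover have "(\<Sum>y\<in>{y \<in> Y. deg E (act e y) < \<tau>}. p y) \<le> \<beta>" if e: "e \<in> E" for e
  proof -
    have eA: "e \<in> A" using e E by auto
    have degE: "deg E z = deg (E - {e}) z + d e z" for z
      unfolding deg_def using sum.remove[OF finE e] by (simp add: add.commute)
    have "w e * (\<Sum>y\<in>{y \<in> Y. deg E (act e y) < \<tau>}. p y)
        = (\<Sum>y\<in>Y. (if deg E (act e y) < \<tau> then w e else 0) * p y)"
      unfolding sum_distrib_left using Y by (intro sum.mono_neutral_cong_left) auto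
    also have "\<dots> \<le> (\<Sum>y\<in>Y. (if deg E (act e y) < \<tau> then m (act e y) else 0) * p y)"
      using m(1)[OF eA] p by (intro sum_mono mult_right_mono) auto
    also have "\<dots> = (\<Sum>z\<in>Z. (if deg E z < \<tau> then m z else 0) * d e z)"
      unfolding d_def
    proof -
      have "(\<Sum>y\<in>Y. (if deg E (act e y) < \<tau> then m (act e y) else 0) * p y)
          = (\<Sum>z\<in>Z. \<Sum>y\<in>{y \<in> Y. act e y = z}. (if deg E (act e y) < \<tau> then m (act e y) else 0) * p y)"
        using Y Z act eA by (intro sum.group[symmetric]) auto
      also have "\<dots> = (\<Sum>z\<in>Z. (if deg E z < \<tau> then m z else 0) * (\<Sum>y\<in>{y \<in> Y. act e y = z}. p y))"
        unfolding sum_distrib_left by (intro sum.cong refl) auto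
      finally show "(\<Sum>y\<in>Y. (if deg E (act e y) < \<tau> then m (act e y) else 0) * p y)
          = (\<Sum>z\<in>Z. (if deg E z < \<tau> then m z else 0) * (\<Sum>y\<in>{y \<in> Y. act e y = z}. p y))" .
    qed
    also have "\<dots> \<le> (\<Sum>z\<in>Z. m z * (min (deg E z) \<tau> - min (deg (E - {e}) z) \<tau>))"
    proof (rule sum_mono)
      fix z assume z: "z \<in> Z"
      show "(if deg E z < \<tau> then m z else 0) * d e z \<le> m z * (min (deg E z) \<tau> - min (deg (E - {e}) z) \<tau>)"
        using degE[of z] d0[of e z] m(2)[OF z] by (auto simp: min_def intro!: mult_left_mono)
    qed
    also have "\<dots> = (\<Sum>z\<in>Z. m z * min (deg E z) \<tau>) - (\<Sum>z\<in>Z. m z * min (deg (E - {e}) z) \<tau>)"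
      by (simp add: right_diff_distrib sum_subtractf)
    also have "\<dots> \<le> \<beta> * w e"
    proof -
      have "sum w E = sum w (E - {e}) + w e" using sum.remove[OF finE e, of w] by simp
      moreover have "J (E - {e}) \<le> J E" using max E by blast
      ultimately show ?thesis by (simp add: J_def algebra_simps)
    qed
    finally have "w e * (\<Sum>y\<in>{y \<in> Y. deg E (act e y) < \<tau>}. p y) \<le> w e * \<beta>" by (simp add: mult.commute)
    then show ?thesis using w(1)[OF eA] by simp
  qed
  ultimately show ?thesis using that[OF E] unfolding deg_def d_def by blast
qed

section \<open>From measures to sets\<close>

text \<open>
  No element of the group may be used twice here, while points of \<open>X\<close> are counted with their
  multiplicities. This is what separates the condition from Reiter's.
\<close>

definition foelner_sets :: "('g, 'm) monoid_scheme \<Rightarrow> 'x set \<Rightarrow> ('g \<Rightarrow> 'x \<Rightarrow> 'x) \<Rightarrow> bool" where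
  "foelner_sets G X \<phi> \<longleftrightarrow> (\<forall>\<epsilon>::real. \<epsilon> > 0 \<longrightarrow> (\<forall>F. finite F \<and> F \<subseteq> X \<longrightarrow>
     (\<exists>E. finite E \<and> E \<noteq> {} \<and> E \<subseteq> carrier G \<and>
        (\<forall>x\<in>F. \<forall>y\<in>F. real (size (sym_diff_mset (orbit_mset \<phi> E x) (orbit_mset \<phi> E y)))
           \<le> \<epsilon> * real (card E)))))"

lemma size_sym_diff_orbit_mset_sum:
  assumes "finite E" "finite Z" "\<And>g. g \<in> E \<Longrightarrow> \<phi> g x \<in> Z" "\<And>g. g \<in> E \<Longrightarrow> \<phi> g y \<in> Z"
  shows "real (size (sym_diff_mset (orbit_mset \<phi> E x) (orbit_mset \<phi> E y)))
    = (\<Sum>z\<in>Z. \<bar>real (card {g \<in> E. \<phi> g x = z}) - real (card {g \<in> E. \<phi> g y = z})\<bar>)"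
proof -
  have "set_mset (orbit_mset \<phi> E x) \<subseteq> Z" "set_mset (orbit_mset \<phi> E y) \<subseteq> Z"
    using assms by (auto simp: orbit_mset_def)
  then show ?thesis
    using size_sym_diff_mset[OF assms(2)] by (simp add: count_orbit_mset[OF assms(1)])
qed

lemma sum_over_orbit_mset:
  fixes u :: "'x \<Rightarrow> real"
  assumes "finite E" "finite Z" "\<And>g. g \<in> E \<Longrightarrow> \<phi> g x \<in> Z"
  shows "(\<Sum>g\<in>E. u (\<phi> g x)) = (\<Sum>z\<in>Z. u z * real (card {g \<in> E. \<phi> g x = z}))"
  using sum_fibres[OF assms(1,2), of "\<lambda>g. \<phi> g x" u "\<lambda>_. 1"] assms(3) by simp

lemma abs_test_le_size_sym_diff:
  fixes u :: "'x \<Rightarrow> real"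
  assumes E: "finite E" and u: "\<And>z. \<bar>u z\<bar> \<le> 1"
  shows "\<bar>(\<Sum>g\<in>E. u (\<phi> g x)) - (\<Sum>g\<in>E. u (\<phi> g y))\<bar>
    \<le> real (size (sym_diff_mset (orbit_mset \<phi> E x) (orbit_mset \<phi> E y)))"
proof -
  define Z where "Z = (\<lambda>g. \<phi> g x) ` E \<union> (\<lambda>g. \<phi> g y) ` E"
  have Z: "finite Z" using E by (auto simp: Z_def)
  define c where "c x z = real (card {g \<in> E. \<phi> g x = z})" for x z
  have ux: "(\<Sum>g\<in>E. u (\<phi> g x)) = (\<Sum>z\<in>Z. u z * c x z)"
    unfolding c_def by (rule sum_over_orbit_mset[OF E Z]) (auto simp: Z_def)
  have uy: "(\<Sum>g\<in>E. u (\<phi> g y)) = (\<Sum>z\<in>Z. u z * c y z)"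
    unfolding c_def by (rule sum_over_orbit_mset[OF E Z]) (auto simp: Z_def)
  have "\<bar>(\<Sum>g\<in>E. u (\<phi> g x)) - (\<Sum>g\<in>E. u (\<phi> g y))\<bar> = \<bar>\<Sum>z\<in>Z. u z * (c x z - c y z)\<bar>"
    unfolding ux uy by (simp add: right_diff_distrib sum_subtractf)
  also have "\<dots> \<le> (\<Sum>z\<in>Z. \<bar>u z * (c x z - c y z)\<bar>)" by (rule sum_abs)
  also have "\<dots> \<le> (\<Sum>z\<in>Z. \<bar>c x z - c y z\<bar>)"
    using u by (intro sum_mono) (auto simp: abs_mult intro!: mult_left_le_one_le)
  also have "\<dots> = real (size (sym_diff_mset (orbit_mset \<phi> E x) (orbit_mset \<phi> E y)))"
    unfolding c_def by (rule size_sym_diff_orbit_mset_sum[OF E Z, symmetric]) (auto simp: Z_def)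
  finally show ?thesis .
qed

lemma size_sym_diff_le_of_tests:
  assumes E: "finite E"
    and le: "\<And>u :: 'x \<Rightarrow> real. (\<And>z. \<bar>u z\<bar> \<le> 1) \<Longrightarrow> \<bar>(\<Sum>g\<in>E. u (\<phi> g x)) - (\<Sum>g\<in>E. u (\<phi> g y))\<bar> \<le> c"
  shows "real (size (sym_diff_mset (orbit_mset \<phi> E x) (orbit_mset \<phi> E y))) \<le> c"
proof -
  define Z where "Z = (\<lambda>g. \<phi> g x) ` E \<union> (\<lambda>g. \<phi> g y) ` E"
  have Z: "finite Z" using E by (auto simp: Z_def)
  define k where "k x z = real (card {g \<in> E. \<phi> g x = z})" for x z
  define u where "u z = sgn (k x z - k y z)" for z
  have ux: "(\<Sum>g\<in>E. u (\<phi> g x)) = (\<Sum>z\<in>Z. u z * k x z)"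
    unfolding k_def by (rule sum_over_orbit_mset[OF E Z]) (auto simp: Z_def)
  have uy: "(\<Sum>g\<in>E. u (\<phi> g y)) = (\<Sum>z\<in>Z. u z * k y z)"
    unfolding k_def by (rule sum_over_orbit_mset[OF E Z]) (auto simp: Z_def)
  have "real (size (sym_diff_mset (orbit_mset \<phi> E x) (orbit_mset \<phi> E y))) = (\<Sum>z\<in>Z. \<bar>k x z - k y z\<bar>)"
    unfolding k_def by (rule size_sym_diff_orbit_mset_sum[OF E Z]) (auto simp: Z_def)
  also have "\<dots> = (\<Sum>z\<in>Z. u z * (k x z - k y z))"
    by (intro sum.cong) (auto simp: u_def sgn_if)
  also have "\<dots> = (\<Sum>g\<in>E. u (\<phi> g x)) - (\<Sum>g\<in>E. u (\<phi> g y))"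
    unfolding ux uy by (simp add: right_diff_distrib sum_subtractf)
  also have "\<dots> \<le> \<bar>(\<Sum>g\<in>E. u (\<phi> g x)) - (\<Sum>g\<in>E. u (\<phi> g y))\<bar>" by simp
  also have "\<dots> \<le> c" by (rule le) (simp add: u_def abs_sgn_eq)
  finally show ?thesis .
qed

lemma reiter_of_foelner_sets:
  fixes \<phi> :: "'g \<Rightarrow> 'x \<Rightarrow> 'x"
  assumes fs: "foelner_sets G X \<phi>"
  shows "reiter G X \<phi>"
  unfolding reiter_def
proof (intro allI impI)
  fix \<epsilon> :: real and F assume \<epsilon>F: "\<epsilon> > 0" "finite F \<and> F \<subseteq> X"
  obtain E where E: "finite E" "E \<noteq> {}" "E \<subseteq> carrier G"
    and le: "\<And>x y. x \<in> F \<Longrightarrow> y \<in> F \<Longrightarrow>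
      real (size (sym_diff_mset (orbit_mset \<phi> E x) (orbit_mset \<phi> E y))) \<le> \<epsilon> * real (card E)"
    using fs[unfolded foelner_sets_def, rule_format, OF \<epsilon>F] by blast
  have cE: "real (card E) > 0" using E by (simp add: card_gt_0_iff)
  show "\<exists>\<nu>. finite (set_pmf \<nu>) \<and> set_pmf \<nu> \<subseteq> carrier G \<and>
        (\<forall>x\<in>F. \<forall>y\<in>F. tv_close \<epsilon> (map_pmf (\<lambda>g. \<phi> g x) \<nu>) (map_pmf (\<lambda>g. \<phi> g y) \<nu>))"
  proof (intro exI[of _ "pmf_of_set E"] conjI ballI)
    fix x y assume xy: "x \<in> F" "y \<in> F"
    show "tv_close \<epsilon> (map_pmf (\<lambda>g. \<phi> g x) (pmf_of_set E)) (map_pmf (\<lambda>g. \<phi> g y) (pmf_of_set E))"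
      unfolding tv_close_def
    proof (intro allI impI)
      fix u :: "'x \<Rightarrow> real" assume u: "\<forall>z. \<bar>u z\<bar> \<le> 1"
      have "\<bar>(\<Sum>g\<in>E. u (\<phi> g x)) - (\<Sum>g\<in>E. u (\<phi> g y))\<bar> \<le> \<epsilon> * real (card E)"
        using abs_test_le_size_sym_diff[OF E(1), of u \<phi> x y] u le[OF xy] by simp
      then have "\<bar>((\<Sum>g\<in>E. u (\<phi> g x)) - (\<Sum>g\<in>E. u (\<phi> g y))) / real (card E)\<bar> \<le> \<epsilon>"
        using cE by (simp add: abs_divide divide_le_eq)
      then show "\<bar>expect (map_pmf (\<lambda>g. \<phi> g x) (pmf_of_set E)) u
          - expect (map_pmf (\<lambda>g. \<phi> g y) (pmf_of_set E)) u\<bar> \<le> \<epsilon>"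
        using E by (simp add: integral_pmf_of_set diff_divide_distrib)
    qed
  qed (use E in auto)
qed

text \<open>
  In an amenable group a set \<open>E\<close> that is almost invariant under right translations works: if
  \<open>\<tau> x\<close> moves the base point \<open>b\<close> to \<open>x\<close>, then \<open>E x = (E \<tau>(x)) b\<close>.
\<close>

lemma foelner_sets_of_right_foelner:
  fixes G :: "('g, 'm) monoid_scheme" (structure) and X :: "'b set"
  assumes trans: "transitive_action G X \<phi>" and rf: "group.right_foelner G"
  shows "foelner_sets G X \<phi>"
  unfolding foelner_sets_def
proof (intro allI impI)
  interpret transitive_action G X \<phi> by fact
  interpret group G using group_hom group_hom.axioms(1) by auto
  fix \<epsilon> :: real and F assume \<epsilon>: "\<epsilon> > 0" and F: "finite F \<and> F \<subseteq> X"
  show "\<exists>E. finite E \<and> E \<noteq> {} \<and> E \<subseteq> carrier G \<and>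
        (\<forall>x\<in>F. \<forall>y\<in>F. real (size (sym_diff_mset (orbit_mset \<phi> E x) (orbit_mset \<phi> E y))) \<le> \<epsilon> * real (card E))"
  proof (cases "F = {}")
    case True
    then show ?thesis by (intro exI[of _ "{\<one>}"]) auto
  next
    case False
    then obtain b where b: "b \<in> F" "b \<in> X" using F by blast
    have "\<forall>x\<in>F. \<exists>g\<in>carrier G. \<phi> g b = x" using F b unique_orbit by blast
    then obtain \<tau> where \<tau>: "\<And>x. x \<in> F \<Longrightarrow> \<tau> x \<in> carrier G" "\<And>x. x \<in> F \<Longrightarrow> \<phi> (\<tau> x) b = x" by metis
    define T where "T = (\<lambda>x. inv (\<tau> x)) ` F"
    have T: "finite T" "T \<subseteq> carrier G" using F \<tau> by (auto simp: T_def)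
    have \<epsilon>2: "0 < \<epsilon> / 2" using \<epsilon> by simp
    obtain E where E: "finite E" "E \<noteq> {}" "E \<subseteq> carrier G"
      and Eb: "\<And>t. t \<in> T \<Longrightarrow> real (card {g \<in> carrier G. (g \<otimes> t \<in> E) \<noteq> (g \<in> E)}) \<le> \<epsilon> / 2 * real (card E)"
      using rf[unfolded right_foelner_def, rule_format, OF conjI[OF T(1) conjI[OF T(2) \<epsilon>2]]] by blast
    have base: "\<bar>(\<Sum>g\<in>E. u (\<phi> g x)) - (\<Sum>g\<in>E. u (\<phi> g b))\<bar> \<le> \<epsilon> / 2 * real (card E)"
      if x: "x \<in> F" and u: "\<And>z. \<bar>u z\<bar> \<le> 1" for x and u :: "'b \<Rightarrow> real"
    proof -
      define E' where "E' = (\<lambda>g. g \<otimes> \<tau> x) ` E"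
      define v where "v k = u (\<phi> k b)" for k
      have \<tau>c: "\<tau> x \<in> carrier G" using \<tau> x by blast
      have fin: "finite E'" using E by (simp add: E'_def)
      have E'eq: "E' = {g \<in> carrier G. g \<otimes> inv (\<tau> x) \<in> E}"
      proof (intro equalityI subsetI)
        fix k assume "k \<in> E'"
        then show "k \<in> {g \<in> carrier G. g \<otimes> inv (\<tau> x) \<in> E}"
          using E \<tau>c by (auto simp: E'_def m_assoc subset_iff)
      next
        fix k assume k: "k \<in> {g \<in> carrier G. g \<otimes> inv (\<tau> x) \<in> E}"
        then have "k = (k \<otimes> inv (\<tau> x)) \<otimes> \<tau> x" using \<tau>c by (simp add: m_assoc)
        then show "k \<in> E'" using k unfolding E'_def by blast
      qed
      have "(\<Sum>g\<in>E. u (\<phi> g x)) = (\<Sum>g\<in>E. v (g \<otimes> \<tau> x))"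
        using E \<tau>[OF x] b composition_rule[of b _ "\<tau> x"] by (intro sum.cong) (auto simp: v_def subset_iff)
      also have "\<dots> = sum v E'"
        unfolding E'_def using E \<tau>c by (subst sum.reindex) (auto simp: inj_on_def subset_iff)
      finally have "(\<Sum>g\<in>E. u (\<phi> g x)) - (\<Sum>g\<in>E. u (\<phi> g b)) = sum v E' - sum v E" by (simp add: v_def)
      also have "\<dots> = sum v (E' - E) - sum v (E - E')"
        using fin E sum.Int_Diff[of E' v E] sum.Int_Diff[of E v E'] by (simp add: Int_commute)
      also have "\<bar>\<dots>\<bar> \<le> real (card (E' - E)) + real (card (E - E'))"
      proof -
        have "\<bar>sum v A\<bar> \<le> real (card A)" for A
          using order_trans[OF sum_abs sum_bounded_above[of A "\<lambda>k. \<bar>v k\<bar>" 1]] u by (simp add: v_def)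
        from this[of "E' - E"] this[of "E - E'"] show ?thesis by linarith
      qed
      also have "\<dots> = real (card ((E' - E) \<union> (E - E')))"
        using fin E by (subst card_Un_disjoint) auto
      also have "(E' - E) \<union> (E - E') = {g \<in> carrier G. (g \<otimes> inv (\<tau> x) \<in> E) \<noteq> (g \<in> E)}"
        unfolding E'eq using E by auto
      also have "real (card \<dots>) \<le> \<epsilon> / 2 * real (card E)" by (rule Eb) (use x in \<open>simp add: T_def\<close>)
      finally show ?thesis .
    qed
    have "real (size (sym_diff_mset (orbit_mset \<phi> E x) (orbit_mset \<phi> E y))) \<le> \<epsilon> * real (card E)"
      if xy: "x \<in> F" "y \<in> F" for x y
    proof (rule size_sym_diff_le_of_tests[OF E(1)])
      fix u :: "'b \<Rightarrow> real" assume u: "\<And>z. \<bar>u z\<bar> \<le> 1"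
      from base[OF xy(1), of u, OF u] base[OF xy(2), of u, OF u]
      show "\<bar>(\<Sum>g\<in>E. u (\<phi> g x)) - (\<Sum>g\<in>E. u (\<phi> g y))\<bar> \<le> \<epsilon> * real (card E)" by linarith
    qed
    then show ?thesis using E by blast
  qed
qed

lemma (in group) sum_translated_pmf:
  fixes v :: "'a \<Rightarrow> real"
  assumes e: "e \<in> carrier G" and K: "finite K" "K \<subseteq> carrier G" "set_pmf p \<subseteq> K"
    and S: "finite S" "S \<subseteq> carrier G" "\<And>k. k \<in> K \<Longrightarrow> e \<otimes> k \<in> S"
  shows "(\<Sum>g\<in>S. pmf p (inv e \<otimes> g) * v g) = (\<Sum>k\<in>K. pmf p k * v (e \<otimes> k))"
proof -
  have "(\<Sum>k\<in>K. pmf p k * v (e \<otimes> k)) = (\<Sum>k\<in>K. pmf p (inv e \<otimes> (e \<otimes> k)) * v (e \<otimes> k))"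
    using e K by (intro sum.cong) (auto simp: m_assoc[symmetric] subset_iff)
  also have "\<dots> = (\<Sum>g\<in>(\<lambda>k. e \<otimes> k) ` K. pmf p (inv e \<otimes> g) * v g)"
    using e K by (subst sum.reindex) (auto simp: inj_on_def subset_iff)
  also have "\<dots> = (\<Sum>g\<in>S. pmf p (inv e \<otimes> g) * v g)"
  proof (intro sum.mono_neutral_left ballI)
    fix g assume g: "g \<in> S - (\<lambda>k. e \<otimes> k) ` K"
    then have gc: "g \<in> carrier G" using S by auto
    have "inv e \<otimes> g \<notin> K"
    proof
      assume "inv e \<otimes> g \<in> K"
      moreover have "g = e \<otimes> (inv e \<otimes> g)" using e gc by (simp add: m_assoc[symmetric])
      ultimately show False using g by blast
    qed
    then show "pmf p (inv e \<otimes> g) * v g = 0" using K(3) by (auto simp: set_pmf_iff)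
  qed (use S in auto)
  finally show ?thesis ..
qed

text \<open>
  Reiter's condition yields measures, and a set is wanted. Superlevel sets are of no use here,
  since the image of a measure in \<open>X\<close> can be balanced through cancellation between different levels.
  Instead the weights
  \<open>f0 g = W * (\<Sum>e\<in>E'. pmf \<rho> (inv e \<otimes> g))\<close> are rounded, where \<open>\<rho>\<close> is the law of
  \<open>k \<otimes> inv r\<close> for independent \<open>k\<close> and \<open>r\<close> with laws \<open>\<nu>\<close> and \<open>\<kappa>\<close>. Three measures enter, chosen in
  the order \<open>\<kappa>\<close>, \<open>\<nu>\<close>, \<open>\<nu>'\<close>.

  \<^item> Left translation preserves balance, and \<open>\<nu>\<close> is balanced on all points \<open>inv r x\<close>. So \<open>f0\<close> has
    for all \<open>x \<in> F\<close> nearly the same image \<open>pt\<close> in \<open>X\<close>, a sum of translates of the law \<open>p\<close> of \<open>k x0\<close>.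
  \<^item> Averaging over \<open>\<kappa>\<close> makes the \<open>\<ell>\<^sup>2\<close>-norm of \<open>f0\<close> small. So \<open>f0\<close> is close to \<open>min 1 f0\<close>, which can be
    rounded to a set. This uses that the group is not amenable.
  \<^item> \<open>\<nu>'\<close> is balanced on the support \<open>Y\<close> of \<open>p\<close>. By clumping there is a set \<open>E'\<close> for which most of
    the mass of \<open>pt\<close> lies at points of large weight. So the rounding errors are relatively small.
\<close>

lemma foelner_sets_of_reiter_nonfoelner:
  fixes G :: "('g, 'm) monoid_scheme" (structure) and X :: "'x set"
  assumes action: "group_action G X \<phi>" and re: "reiter G X \<phi>" and nf: "\<not> group.right_foelner G"
  shows "foelner_sets G X \<phi>"
  unfolding foelner_sets_def
proof (intro allI impI)
  interpret group_action G X \<phi> by fact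
  interpret group G using group_hom group_hom.axioms(1) by auto
  have actX: "\<phi> g x \<in> X" if "g \<in> carrier G" "x \<in> X" for g x using that element_image by simp
  fix \<epsilon> :: real and F assume \<epsilon>: "\<epsilon> > 0" and F: "finite F \<and> F \<subseteq> X"
  show "\<exists>E. finite E \<and> E \<noteq> {} \<and> E \<subseteq> carrier G \<and>
        (\<forall>x\<in>F. \<forall>y\<in>F. real (size (sym_diff_mset (orbit_mset \<phi> E x) (orbit_mset \<phi> E y))) \<le> \<epsilon> * real (card E))"
  proof (cases "F = {}")
    case True
    then show ?thesis by (intro exI[of _ "{\<one>}"]) auto
  next
    case False
    then obtain x0 where x0: "x0 \<in> F" "x0 \<in> X" using F by blast
    have cF: "real (card F) \<ge> 1" using F False by (simp add: Suc_leI card_gt_0_iff)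
    \<comment> \<open>The rounding error is \<open>3 * s * M\<close> for each point of \<open>F\<close>. The bound \<open>1/6\<close> keeps at least half of the
      mass \<open>M\<close>, and \<open>\<epsilon> / 12\<close> then gives the required ratio.\<close>
    define s where "s = min (1/6) (\<epsilon> / 12)"
    have s: "0 < s" "s \<le> 1/6" "s \<le> \<epsilon> / 12" using \<epsilon> by (auto simp: s_def)
    define \<beta> where "\<beta> = s\<^sup>2 / (4 * real (card F))"
    have \<beta>: "0 < \<beta>" using s cF by (simp add: \<beta>_def)
    \<comment> \<open>With this factor, degree \<open>\<tau> = \<beta> / 4\<close> corresponds to weight \<open>1 / \<beta>\<close>, the threshold of the rounding.\<close>
    define W where "W = 4 / \<beta>\<^sup>2"
    have W: "W > 0" using \<beta> by (simp add: W_def)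
    define \<tau> where "\<tau> = \<beta> / 4"
    have \<tau>: "0 < \<tau>" "2 * \<tau> < \<beta>" using \<beta> by (auto simp: \<tau>_def)
    have W\<tau>: "W * \<tau> = 1 / \<beta>" using \<beta> by (simp add: W_def \<tau>_def power2_eq_square)
    have "\<beta> / W > 0" using \<beta> W by simp
    then obtain \<kappa> where \<kappa>: "finite (set_pmf \<kappa>)" "set_pmf \<kappa> \<subseteq> carrier G"
      and contr: "\<And>f S D. finite S \<Longrightarrow> S \<subseteq> carrier G \<Longrightarrow> finite D \<Longrightarrow> D \<subseteq> carrier G \<Longrightarrow>
       (\<And>g. 0 \<le> f g) \<Longrightarrow> (\<And>g. g \<notin> S \<Longrightarrow> f g = 0) \<Longrightarrow>
       (\<Sum>g\<in>D. (expect \<kappa> (\<lambda>r. f (g \<otimes> r)))\<^sup>2) \<le> \<beta> / W * (\<Sum>g\<in>S. (f g)\<^sup>2)"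
      using l2_contraction[OF nf] by metis
    define F1 where "F1 = insert x0 ((\<lambda>(r, x). \<phi> (inv r) x) ` (set_pmf \<kappa> \<times> F))"
    have F1: "finite F1" "F1 \<subseteq> X"
      using F \<kappa> x0 actX by (auto simp: F1_def subset_iff)
    obtain \<nu> where \<nu>: "finite (set_pmf \<nu>)" "set_pmf \<nu> \<subseteq> carrier G"
      and \<nu>close: "\<And>x y. x \<in> F1 \<Longrightarrow> y \<in> F1 \<Longrightarrow> tv_close \<beta> (map_pmf (\<lambda>g. \<phi> g x) \<nu>) (map_pmf (\<lambda>g. \<phi> g y) \<nu>)"
      using reiterE[OF re \<beta> F1] by blast
    define p where "p = map_pmf (\<lambda>g. \<phi> g x0) \<nu>"
    define Y where "Y = set_pmf p"
    have Y: "finite Y" "Y \<subseteq> X" "Y \<noteq> {}"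
      using \<nu> actX x0 by (auto simp: Y_def p_def set_pmf_not_empty)
    have cY: "real (card Y) > 0" using Y by (simp add: card_gt_0_iff)
    then have iY: "1 / real (card Y) > 0" by simp
    obtain \<nu>' where \<nu>': "finite (set_pmf \<nu>')" "set_pmf \<nu>' \<subseteq> carrier G"
      and \<nu>'close: "\<And>x y. x \<in> Y \<Longrightarrow> y \<in> Y \<Longrightarrow> tv_close (1 / real (card Y)) (map_pmf (\<lambda>g. \<phi> g x) \<nu>') (map_pmf (\<lambda>g. \<phi> g y) \<nu>')"
      using reiterE[OF re iY Y(1,2)] by blast
    obtain y0 where y0: "y0 \<in> Y" using Y by blast
    define A where "A = set_pmf \<nu>'"
    define Z' where "Z' = (\<lambda>(e, y). \<phi> e y) ` (A \<times> Y)"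
    define q where "q y z = pmf (map_pmf (\<lambda>e. \<phi> e y) \<nu>') z" for y z
    \<comment> \<open>A common majorant of the images of \<open>\<nu>'\<close>; closeness \<open>1 / card Y\<close> makes its mass at most \<open>2\<close>.\<close>
    define m where "m z = q y0 z + (\<Sum>y\<in>Y. \<bar>q y z - q y0 z\<bar>)" for z
    have m0: "0 \<le> m z" for z unfolding m_def q_def by (intro add_nonneg_nonneg sum_nonneg) auto
    have qm: "q y z \<le> m z" if "y \<in> Y" for y z
      using member_le_sum[OF that, of "\<lambda>y. \<bar>q y z - q y0 z\<bar>"] Y unfolding m_def by fastforce
    have wq: "pmf \<nu>' e \<le> q y (\<phi> e y)" for e y
      unfolding q_def pmf_map by (subst measure_pmf_single[symmetric], intro measure_pmf.finite_measure_mono) auto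
    have finZ': "finite Z'" using \<nu>' Y by (simp add: Z'_def A_def)
    have msum: "sum m Z' \<le> 2"
    proof -
      have "sum m Z' = sum (q y0) Z' + (\<Sum>y\<in>Y. \<Sum>z\<in>Z'. \<bar>q y z - q y0 z\<bar>)"
        unfolding m_def sum.distrib by (subst (2) sum.swap) simp
      moreover have "sum (q y0) Z' \<le> 1"
        unfolding q_def using finZ' by (simp flip: measure_measure_pmf_finite)
      moreover have "(\<Sum>y\<in>Y. \<Sum>z\<in>Z'. \<bar>q y z - q y0 z\<bar>) \<le> (\<Sum>y\<in>Y. 1 / real (card Y))"
        unfolding q_def by (intro sum_mono tv_close_sum \<nu>'close y0 finZ')
      moreover have "(\<Sum>y\<in>Y. 1 / real (card Y)) = 1" using cY by simp
      ultimately show ?thesis by linarith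
    qed
    obtain E' where E': "E' \<subseteq> A" "E' \<noteq> {}" and clump: "\<And>e. e \<in> E' \<Longrightarrow>
       (\<Sum>y\<in>{y \<in> Y. (\<Sum>e'\<in>E'. \<Sum>y'\<in>{y' \<in> Y. \<phi> e' y' = \<phi> e y}. pmf p y') < \<tau>}. pmf p y) \<le> \<beta>"
    proof (rule clumping[of A Y Z' \<phi> "pmf \<nu>'" "pmf p" m \<tau> \<beta>])
      show "finite A" using \<nu>' by (simp add: A_def)
      show "\<phi> e y \<in> Z'" if "e \<in> A" "y \<in> Y" for e y using that by (force simp: Z'_def)
      show "0 < pmf \<nu>' e" if "e \<in> A" for e using that by (simp add: A_def pmf_positive)
      show "sum (pmf \<nu>') A = 1" using \<nu>' by (simp add: A_def sum_pmf_eq_1)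
      show "pmf \<nu>' e \<le> m (\<phi> e y)" if "e \<in> A" "y \<in> Y" for e y using wq[of e y] qm[OF that(2), of "\<phi> e y"] by linarith
    qed (use Y finZ' m0 msum \<tau> in auto)
    have E'c: "E' \<subseteq> carrier G" using E' \<nu>' by (auto simp: A_def)
    have finE': "finite E'" using E' \<nu>' finite_subset by (auto simp: A_def)
    have cE': "real (card E') > 0" using E' finE' by (simp add: card_gt_0_iff)
    define M where "M = W * real (card E')"
    have M: "M > 0" using W cE' by (simp add: M_def)
    define deg where "deg z = (\<Sum>e\<in>E'. \<Sum>y\<in>{y \<in> Y. \<phi> e y = z}. pmf p y)" for z
    define \<rho> where "\<rho> = bind_pmf \<kappa> (\<lambda>r. map_pmf (\<lambda>k. k \<otimes> inv r) \<nu>)"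
    define K where "K = set_pmf \<rho>"
    have K: "finite K" "K \<subseteq> carrier G" using \<kappa> \<nu> by (auto simp: K_def \<rho>_def subset_iff)
    define S where "S = (\<lambda>(e, k). e \<otimes> k) ` (E' \<times> K)"
    have S: "finite S" "S \<subseteq> carrier G" using K E'c finE' by (auto simp: S_def subset_iff)
    have Sin: "e \<otimes> k \<in> S" if "e \<in> E'" "k \<in> K" for e k using that by (force simp: S_def)
    define Z where "Z = Z' \<union> (\<lambda>(g, x). \<phi> g x) ` (S \<times> F)"
    have Z: "finite Z" using finZ' S F by (simp add: Z_def)
    have ZY: "\<phi> e y \<in> Z" if "e \<in> E'" "y \<in> Y" for e y using that E' by (force simp: Z_def Z'_def)
    have ZS: "\<phi> g x \<in> Z" if "g \<in> S" "x \<in> F" for g x using that by (force simp: Z_def)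
    define f0 where "f0 g = W * (\<Sum>e\<in>E'. pmf \<rho> (inv e \<otimes> g))" for g
    have f00: "0 \<le> f0 g" for g unfolding f0_def using W by (intro mult_nonneg_nonneg sum_nonneg) auto
    define f where "f g = min 1 (f0 g)" for g
    have f01: "0 \<le> f g \<and> f g \<le> 1" for g using f00[of g] by (simp add: f_def)
    have f0test: "(\<Sum>g\<in>S. f0 g * v g) = W * (\<Sum>e\<in>E'. \<Sum>k\<in>K. pmf \<rho> k * v (e \<otimes> k))" for v :: "'g \<Rightarrow> real"
    proof -
      have "(\<Sum>g\<in>S. f0 g * v g) = (\<Sum>g\<in>S. \<Sum>e\<in>E'. W * (pmf \<rho> (inv e \<otimes> g) * v g))"
        unfolding f0_def by (simp only: sum_distrib_left sum_distrib_right mult.assoc)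
      also have "\<dots> = (\<Sum>e\<in>E'. \<Sum>g\<in>S. W * (pmf \<rho> (inv e \<otimes> g) * v g))" by (rule sum.swap)
      also have "\<dots> = W * (\<Sum>e\<in>E'. \<Sum>g\<in>S. pmf \<rho> (inv e \<otimes> g) * v g)"
        by (simp only: sum_distrib_left)
      also have "\<dots> = W * (\<Sum>e\<in>E'. \<Sum>k\<in>K. pmf \<rho> k * v (e \<otimes> k))"
        using E'c K S Sin by (intro arg_cong[of _ _ "(*) W"] sum.cong refl sum_translated_pmf) (auto simp: K_def)
      finally show ?thesis .
    qed
    have f0sum: "sum f0 S = M"
      using f0test[of "\<lambda>_. 1"] sum_pmf_eq_1[OF K(1), of \<rho>] by (simp add: M_def K_def)
    \<comment> \<open>Before averaging over \<open>\<kappa>\<close> the weights \<open>\<phi>0\<close> are at most \<open>W\<close>, as the elements \<open>inv e \<otimes> g\<close> are distinct.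
      So their energy is at most \<open>W * M\<close>, and averaging multiplies it by \<open>\<beta> / W\<close>.\<close>
    have sq: "(\<Sum>g\<in>S. (f0 g)\<^sup>2) \<le> \<beta> * M"
    proof -
      define \<phi>0 where "\<phi>0 g = (if g \<in> carrier G then W * (\<Sum>e\<in>E'. pmf \<nu> (inv e \<otimes> g)) else 0)" for g
      define S0 where "S0 = (\<lambda>(e, k). e \<otimes> k) ` (E' \<times> set_pmf \<nu>)"
      have S0: "finite S0" "S0 \<subseteq> carrier G" using \<nu> E'c finE' by (auto simp: S0_def subset_iff)
      have S0in: "e \<otimes> k \<in> S0" if "e \<in> E'" "k \<in> set_pmf \<nu>" for e k using that by (force simp: S0_def)
      have \<phi>0nn: "0 \<le> \<phi>0 g" for g unfolding \<phi>0_def using W by (auto intro!: mult_nonneg_nonneg sum_nonneg)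
      have \<phi>0supp: "\<phi>0 g = 0" if g: "g \<notin> S0" for g
      proof (cases "g \<in> carrier G")
        case True
        have "pmf \<nu> (inv e \<otimes> g) = 0" if e: "e \<in> E'" for e
        proof (rule ccontr)
          assume "pmf \<nu> (inv e \<otimes> g) \<noteq> 0"
          then have "inv e \<otimes> g \<in> set_pmf \<nu>" by (simp add: set_pmf_iff)
          moreover have "g = e \<otimes> (inv e \<otimes> g)" using e E'c True by (simp add: m_assoc[symmetric] subset_iff)
          ultimately have "g \<in> S0" unfolding S0_def using e by (metis (no_types, lifting) SigmaI case_prod_conv image_eqI)
          then show False using g by simp
        qed
        then show ?thesis by (simp add: \<phi>0_def)
      qed (simp add: \<phi>0_def)
      have \<phi>0le: "\<phi>0 g \<le> W" for g
      proof (cases "g \<in> carrier G")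
        case True
        have "(\<Sum>e\<in>E'. pmf \<nu> (inv e \<otimes> g)) = (\<Sum>k\<in>(\<lambda>e. inv e \<otimes> g) ` E'. pmf \<nu> k)"
          using True E'c by (subst sum.reindex) (auto simp: inj_on_def subset_iff dest: inj_onD[OF inv_inj])
        also have "\<dots> \<le> 1" using finE' by (simp flip: measure_measure_pmf_finite)
        finally show ?thesis using True W by (simp add: \<phi>0_def mult_left_le)
      qed (use W in \<open>simp add: \<phi>0_def\<close>)
      have \<phi>0sum: "sum \<phi>0 S0 = M"
      proof -
        have "sum \<phi>0 S0 = (\<Sum>g\<in>S0. \<Sum>e\<in>E'. W * (pmf \<nu> (inv e \<otimes> g) * 1))"
          unfolding \<phi>0_def using S0 by (intro sum.cong refl) (auto simp: sum_distrib_left subset_iff)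
        also have "\<dots> = (\<Sum>e\<in>E'. \<Sum>g\<in>S0. W * (pmf \<nu> (inv e \<otimes> g) * 1))" by (rule sum.swap)
        also have "\<dots> = W * (\<Sum>e\<in>E'. \<Sum>g\<in>S0. pmf \<nu> (inv e \<otimes> g) * 1)"
          by (simp only: sum_distrib_left)
        also have "(\<Sum>e\<in>E'. \<Sum>g\<in>S0. pmf \<nu> (inv e \<otimes> g) * 1) = (\<Sum>e\<in>E'. \<Sum>k\<in>set_pmf \<nu>. pmf \<nu> k * 1)"
          using E'c \<nu> S0 S0in by (intro sum.cong refl sum_translated_pmf) auto
        also have "\<dots> = real (card E')" using sum_pmf_eq_1[OF \<nu>(1) order_refl] by simp
        finally show ?thesis by (simp add: M_def)
      qed
      have f0\<phi>: "f0 g = expect \<kappa> (\<lambda>r. \<phi>0 (g \<otimes> r))" if g: "g \<in> carrier G" for g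
      proof -
        have pr: "pmf \<rho> k = (\<Sum>r\<in>set_pmf \<kappa>. pmf \<nu> (k \<otimes> r) * pmf \<kappa> r)" if k: "k \<in> carrier G" for k
        proof -
          have "pmf \<rho> k = (\<Sum>r\<in>set_pmf \<kappa>. pmf (map_pmf (\<lambda>k. k \<otimes> inv r) \<nu>) k * pmf \<kappa> r)"
            unfolding \<rho>_def pmf_bind by (rule pmf_expectation_finite[OF \<kappa>(1) order_refl])
          also have "\<dots> = (\<Sum>r\<in>set_pmf \<kappa>. pmf \<nu> (k \<otimes> r) * pmf \<kappa> r)"
          proof (rule sum.cong[OF refl])
            fix r assume "r \<in> set_pmf \<kappa>"
            then have r: "r \<in> carrier G" using \<kappa> by auto
            have "pmf (map_pmf (\<lambda>k. k \<otimes> inv r) \<nu>) k = (\<Sum>h\<in>set_pmf \<nu>. of_bool (h \<otimes> inv r = k) * pmf \<nu> h)"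
              unfolding pmf_map_eq_expectation by (rule pmf_expectation_finite[OF \<nu>(1) order_refl])
            also have "\<dots> = (\<Sum>h\<in>set_pmf \<nu>. if h = k \<otimes> r then pmf \<nu> h else 0)"
            proof (rule sum.cong[OF refl])
              fix h assume "h \<in> set_pmf \<nu>"
              then have h: "h \<in> carrier G" using \<nu> by auto
              have "h \<otimes> inv r = k \<longleftrightarrow> h = k \<otimes> r"
                using h r k inv_solve_right'[of k h r] by simp
              then show "of_bool (h \<otimes> inv r = k) * pmf \<nu> h = (if h = k \<otimes> r then pmf \<nu> h else 0)" by simp
            qed
            also have "\<dots> = pmf \<nu> (k \<otimes> r)" using \<nu>(1) by (simp add: set_pmf_iff)
            finally show "pmf (map_pmf (\<lambda>k. k \<otimes> inv r) \<nu>) k * pmf \<kappa> r = pmf \<nu> (k \<otimes> r) * pmf \<kappa> r" by simp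
          qed
          finally show ?thesis .
        qed
        have "expect \<kappa> (\<lambda>r. \<phi>0 (g \<otimes> r)) = (\<Sum>r\<in>set_pmf \<kappa>. \<phi>0 (g \<otimes> r) * pmf \<kappa> r)"
          by (rule pmf_expectation_finite[OF \<kappa>(1) order_refl])
        also have "\<dots> = (\<Sum>r\<in>set_pmf \<kappa>. \<Sum>e\<in>E'. W * (pmf \<nu> (inv e \<otimes> g \<otimes> r) * pmf \<kappa> r))"
        proof (rule sum.cong[OF refl])
          fix r assume "r \<in> set_pmf \<kappa>"
          then have r: "r \<in> carrier G" using \<kappa> by auto
          have "\<phi>0 (g \<otimes> r) = W * (\<Sum>e\<in>E'. pmf \<nu> (inv e \<otimes> g \<otimes> r))"
            using r g E'c by (auto simp: \<phi>0_def m_assoc subset_iff intro!: sum.cong)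
          then show "\<phi>0 (g \<otimes> r) * pmf \<kappa> r = (\<Sum>e\<in>E'. W * (pmf \<nu> (inv e \<otimes> g \<otimes> r) * pmf \<kappa> r))"
            by (simp add: sum_distrib_left sum_distrib_right mult.assoc)
        qed
        also have "\<dots> = (\<Sum>e\<in>E'. \<Sum>r\<in>set_pmf \<kappa>. W * (pmf \<nu> (inv e \<otimes> g \<otimes> r) * pmf \<kappa> r))"
          by (rule sum.swap)
        also have "\<dots> = W * (\<Sum>e\<in>E'. \<Sum>r\<in>set_pmf \<kappa>. pmf \<nu> (inv e \<otimes> g \<otimes> r) * pmf \<kappa> r)"
          by (simp only: sum_distrib_left)
        also have "\<dots> = f0 g"
          unfolding f0_def using E'c g by (intro arg_cong[of _ _ "(*) W"] sum.cong refl pr[symmetric]) (auto simp: subset_iff)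
        finally show ?thesis ..
      qed
      have "(\<Sum>g\<in>S. (f0 g)\<^sup>2) = (\<Sum>g\<in>S. (expect \<kappa> (\<lambda>r. \<phi>0 (g \<otimes> r)))\<^sup>2)"
        using S f0\<phi> by (intro sum.cong) auto
      also have "\<dots> \<le> \<beta> / W * (\<Sum>g\<in>S0. (\<phi>0 g)\<^sup>2)"
        by (rule contr) (use S0 S \<phi>0nn \<phi>0supp in auto)
      also have "\<dots> \<le> \<beta> / W * (\<Sum>g\<in>S0. W * \<phi>0 g)"
        using \<beta> W \<phi>0le \<phi>0nn by (intro mult_left_mono sum_mono) (auto simp: power2_eq_square intro!: mult_right_mono)
      also have "\<dots> = \<beta> * M" using W by (simp add: \<phi>0sum flip: sum_distrib_left)
      finally show ?thesis .
    qed
    \<comment> \<open>Truncation at \<open>1\<close> loses at most the energy.\<close>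
    have excess: "(\<Sum>g\<in>S. f0 g - f g) \<le> \<beta> * M"
    proof -
      have "(\<Sum>g\<in>S. f0 g - f g) \<le> (\<Sum>g\<in>S. (f0 g)\<^sup>2)"
      proof (rule sum_mono)
        fix g
        show "f0 g - f g \<le> (f0 g)\<^sup>2"
          using f00[of g] self_le_power[of "f0 g" 2] by (auto simp: f_def min_def)
      qed
      then show ?thesis using sq by linarith
    qed
    have degpmf: "deg z = (\<Sum>e\<in>E'. pmf (map_pmf (\<phi> e) p) z)" for z
      unfolding deg_def
    proof (rule sum.cong[OF refl])
      fix e
      have "pmf (map_pmf (\<phi> e) p) z = (\<Sum>y\<in>Y. of_bool (\<phi> e y = z) * pmf p y)"
        unfolding pmf_map_eq_expectation by (rule pmf_expectation_finite[OF Y(1)]) (simp add: Y_def)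
      also have "\<dots> = (\<Sum>y\<in>Y. if \<phi> e y = z then pmf p y else 0)" by (intro sum.cong) auto
      also have "\<dots> = (\<Sum>y\<in>{y \<in> Y. \<phi> e y = z}. pmf p y)"
        using Y(1) by (simp add: sum.inter_filter)
      finally show "(\<Sum>y\<in>{y \<in> Y. \<phi> e y = z}. pmf p y) = pmf (map_pmf (\<phi> e) p) z" ..
    qed
    have degtest: "(\<Sum>z\<in>Z. u z * deg z) = (\<Sum>e\<in>E'. \<Sum>y\<in>Y. u (\<phi> e y) * pmf p y)" for u :: "'x \<Rightarrow> real"
    proof -
      have "(\<Sum>z\<in>Z. u z * deg z) = (\<Sum>e\<in>E'. \<Sum>z\<in>Z. u z * (\<Sum>y\<in>{y \<in> Y. \<phi> e y = z}. pmf p y))"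
        unfolding deg_def sum_distrib_left by (rule sum.swap)
      also have "\<dots> = (\<Sum>e\<in>E'. \<Sum>y\<in>Y. u (\<phi> e y) * pmf p y)"
        using ZY by (intro sum.cong refl sum_fibres Y Z)
      finally show ?thesis .
    qed
    define pt where "pt z = W * deg z" for z
    have ptsum: "sum pt Z = M"
    proof -
      have "sum pt Z = W * (\<Sum>z\<in>Z. 1 * deg z)" by (simp add: pt_def sum_distrib_left)
      also have "\<dots> = M" unfolding degtest using sum_pmf_eq_1[OF Y(1), of p] by (simp add: M_def Y_def)
      finally show ?thesis .
    qed
    have light: "(\<Sum>z\<in>{z \<in> Z. pt z < 1 / \<beta>}. pt z) \<le> \<beta> * M"
    proof -
      have iff: "pt z < 1 / \<beta> \<longleftrightarrow> deg z < \<tau>" for z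
        unfolding pt_def W\<tau>[symmetric] using W by simp
      have "(\<Sum>z\<in>{z \<in> Z. pt z < 1 / \<beta>}. pt z) = (\<Sum>z\<in>Z. W * (of_bool (deg z < \<tau>) * deg z))"
        unfolding iff using Z by (intro sum.mono_neutral_cong_left) (auto simp: pt_def)
      also have "\<dots> = W * (\<Sum>e\<in>E'. \<Sum>y\<in>Y. of_bool (deg (\<phi> e y) < \<tau>) * pmf p y)"
        unfolding sum_distrib_left[symmetric] degtest ..
      also have "\<dots> \<le> W * (\<Sum>e\<in>E'. \<beta>)"
      proof (intro mult_left_mono sum_mono)
        fix e assume e: "e \<in> E'"
        have "(\<Sum>y\<in>Y. of_bool (deg (\<phi> e y) < \<tau>) * pmf p y) = (\<Sum>y\<in>{y \<in> Y. deg (\<phi> e y) < \<tau>}. pmf p y)"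
          using Y(1) by (intro sum.mono_neutral_cong_right) auto
        also have "\<dots> \<le> \<beta>" using clump[OF e] by (simp add: deg_def)
        finally show "(\<Sum>y\<in>Y. of_bool (deg (\<phi> e y) < \<tau>) * pmf p y) \<le> \<beta>" .
      qed (use W in simp)
      also have "\<dots> = \<beta> * M" by (simp add: M_def)
      finally show ?thesis .
    qed
    have close: "(\<Sum>z\<in>Z. \<bar>(\<Sum>g\<in>{g \<in> S. \<phi> g x = z}. f g) - pt z\<bar>) \<le> 2 * \<beta> * M" if x: "x \<in> F" for x
    proof -
      have xX: "x \<in> X" using x F by auto
      define a where "a e = map_pmf (\<lambda>k. \<phi> (e \<otimes> k) x) \<rho>" for e
      have fib: "(\<Sum>g\<in>{g \<in> S. \<phi> g x = z}. f0 g) = W * (\<Sum>e\<in>E'. pmf (a e) z)" for z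
      proof -
        have "(\<Sum>g\<in>{g \<in> S. \<phi> g x = z}. f0 g) = (\<Sum>g\<in>S. f0 g * of_bool (\<phi> g x = z))"
          using S(1) by (intro sum.mono_neutral_cong_left) auto
        also have "\<dots> = W * (\<Sum>e\<in>E'. \<Sum>k\<in>K. of_bool (\<phi> (e \<otimes> k) x = z) * pmf \<rho> k)"
          unfolding f0test by (simp add: mult.commute)
        also have "\<dots> = W * (\<Sum>e\<in>E'. pmf (a e) z)"
          unfolding a_def pmf_map_eq_expectation
          by (intro arg_cong[of _ _ "(*) W"] sum.cong refl pmf_expectation_finite[symmetric] K) (simp add: K_def)
        finally show ?thesis .
      qed
      \<comment> \<open>Given \<open>r\<close>, the point \<open>e k (inv r x)\<close> is distributed almost like \<open>e k x0\<close>.\<close>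
      have tv: "tv_close \<beta> (a e) (map_pmf (\<phi> e) p)" if e: "e \<in> E'" for e
        unfolding tv_close_def
      proof (intro allI impI)
        fix u :: "'x \<Rightarrow> real" assume u: "\<forall>z. \<bar>u z\<bar> \<le> 1"
        have ec: "e \<in> carrier G" using e E'c by auto
        define v where "v y = u (\<phi> e y)" for y
        have v: "\<forall>z. \<bar>v z\<bar> \<le> 1" using u by (simp add: v_def)
        define d where "d r = expect \<nu> (\<lambda>k. v (\<phi> k (\<phi> (inv r) x))) - expect \<nu> (\<lambda>k. v (\<phi> k x0))" for r
        have vint: "integrable (measure_pmf \<kappa>) w" for w :: "'g \<Rightarrow> real"
          by (rule integrable_measure_pmf_finite[OF \<kappa>(1)])
        have "expect (a e) u = expect \<rho> (\<lambda>k. u (\<phi> (e \<otimes> k) x))"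
          by (simp add: a_def)
        also have "\<dots> = expect \<kappa> (\<lambda>r. expect \<nu> (\<lambda>k. u (\<phi> (e \<otimes> (k \<otimes> inv r)) x)))"
          unfolding \<rho>_def by (subst pmf_expectation_bind_bounded[where B=1]) (use u in auto)
        also have "\<dots> = expect \<kappa> (\<lambda>r. expect \<nu> (\<lambda>k. v (\<phi> k (\<phi> (inv r) x))))"
        proof (rule pmf_expectation_cong)
          fix r assume "r \<in> set_pmf \<kappa>"
          then have r: "r \<in> carrier G" using \<kappa> by auto
          show "expect \<nu> (\<lambda>k. u (\<phi> (e \<otimes> (k \<otimes> inv r)) x)) = expect \<nu> (\<lambda>k. v (\<phi> k (\<phi> (inv r) x)))"
          proof (rule pmf_expectation_cong)
            fix k assume "k \<in> set_pmf \<nu>"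
            then have k: "k \<in> carrier G" using \<nu> by auto
            show "u (\<phi> (e \<otimes> (k \<otimes> inv r)) x) = v (\<phi> k (\<phi> (inv r) x))"
              using composition_rule[OF xX ec, of "k \<otimes> inv r"] composition_rule[OF xX k, of "inv r"] r k
              by (simp add: v_def)
          qed
        qed
        finally have "expect (a e) u - expect (map_pmf (\<phi> e) p) u
            = expect \<kappa> d"
          unfolding d_def by (subst Bochner_Integration.integral_diff[OF vint vint]) (simp add: p_def v_def)
        moreover have "\<bar>expect \<kappa> d\<bar> \<le> \<beta>"
        proof (rule pmf_expectation_abs_le)
          fix r assume r: "r \<in> set_pmf \<kappa>"
          have "\<phi> (inv r) x \<in> F1" "x0 \<in> F1" using r x by (force simp: F1_def)+
          then have "tv_close \<beta> (map_pmf (\<lambda>k. \<phi> k (\<phi> (inv r) x)) \<nu>) (map_pmf (\<lambda>k. \<phi> k x0) \<nu>)" by (rule \<nu>close)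
          then have "\<bar>expect (map_pmf (\<lambda>k. \<phi> k (\<phi> (inv r) x)) \<nu>) v
              - expect (map_pmf (\<lambda>k. \<phi> k x0) \<nu>) v\<bar> \<le> \<beta>"
            by (rule tv_closeD) (use v in blast)
          then show "\<bar>d r\<bar> \<le> \<beta>" by (simp add: d_def)
        qed
        ultimately show "\<bar>expect (a e) u - expect (map_pmf (\<phi> e) p) u\<bar> \<le> \<beta>" by simp
      qed
      have "(\<Sum>z\<in>Z. \<bar>(\<Sum>g\<in>{g \<in> S. \<phi> g x = z}. f0 g) - pt z\<bar>)
          = (\<Sum>z\<in>Z. W * \<bar>\<Sum>e\<in>E'. pmf (a e) z - pmf (map_pmf (\<phi> e) p) z\<bar>)"
        unfolding fib pt_def degpmf using W
        by (intro sum.cong refl) (simp add: abs_mult sum_subtractf flip: right_diff_distrib)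
      also have "\<dots> \<le> (\<Sum>z\<in>Z. W * (\<Sum>e\<in>E'. \<bar>pmf (a e) z - pmf (map_pmf (\<phi> e) p) z\<bar>))"
        using W by (intro sum_mono mult_left_mono sum_abs) auto
      also have "\<dots> = W * (\<Sum>e\<in>E'. \<Sum>z\<in>Z. \<bar>pmf (a e) z - pmf (map_pmf (\<phi> e) p) z\<bar>)"
        unfolding sum_distrib_left[symmetric] sum.swap[of _ E' Z] ..
      also have "\<dots> \<le> W * (\<Sum>e\<in>E'. \<beta>)"
        using W tv Z by (intro mult_left_mono sum_mono tv_close_sum) auto
      also have "\<dots> = \<beta> * M" by (simp add: M_def)
      finally have 1: "(\<Sum>z\<in>Z. \<bar>(\<Sum>g\<in>{g \<in> S. \<phi> g x = z}. f0 g) - pt z\<bar>) \<le> \<beta> * M" .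
      have "(\<Sum>z\<in>Z. \<Sum>g\<in>{g \<in> S. \<phi> g x = z}. f0 g - f g) = (\<Sum>g\<in>S. f0 g - f g)"
        using sum_fibres[OF S(1) Z, of "\<lambda>g. \<phi> g x" "\<lambda>_. 1" "\<lambda>g. f0 g - f g"] ZS x by simp
      then have 2: "(\<Sum>z\<in>Z. \<Sum>g\<in>{g \<in> S. \<phi> g x = z}. f0 g - f g) \<le> \<beta> * M" using excess by simp
      have "(\<Sum>z\<in>Z. \<bar>(\<Sum>g\<in>{g \<in> S. \<phi> g x = z}. f g) - pt z\<bar>)
          \<le> (\<Sum>z\<in>Z. \<bar>(\<Sum>g\<in>{g \<in> S. \<phi> g x = z}. f0 g) - pt z\<bar> + (\<Sum>g\<in>{g \<in> S. \<phi> g x = z}. f0 g - f g))"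
      proof (rule sum_mono)
        fix z
        have "0 \<le> (\<Sum>g\<in>{g \<in> S. \<phi> g x = z}. f0 g - f g)" by (intro sum_nonneg) (simp add: f_def)
        then show "\<bar>(\<Sum>g\<in>{g \<in> S. \<phi> g x = z}. f g) - pt z\<bar>
          \<le> \<bar>(\<Sum>g\<in>{g \<in> S. \<phi> g x = z}. f0 g) - pt z\<bar> + (\<Sum>g\<in>{g \<in> S. \<phi> g x = z}. f0 g - f g)"
          unfolding sum_subtractf by linarith
      qed
      then show ?thesis using 1 2 unfolding sum.distrib by linarith
    qed
    have fM: "sum f S \<le> M" unfolding f0sum[symmetric] by (intro sum_mono) (simp add: f_def)
    have pt0: "0 \<le> pt z" for z unfolding pt_def deg_def using W by (intro mult_nonneg_nonneg sum_nonneg) auto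
    obtain E where E: "E \<subseteq> S"
      and Ebal: "\<And>x. x \<in> F \<Longrightarrow> (\<Sum>z\<in>Z. \<bar>real (card {g \<in> E. \<phi> g x = z}) - pt z\<bar>) \<le> 3 * s * M"
    proof (rule balanced_rounding[of S Z F \<phi> f M pt s \<beta>])
      show "s \<le> 1" using s by simp
    qed (use S Z F False ZS f01 fM pt0 ptsum s \<beta>_def light close in auto)
    have finE: "finite E" using E S finite_subset by blast
    have EZ: "\<phi> g x \<in> Z" if "g \<in> E" "x \<in> F" for g x using that E ZS by auto
    have cardE: "M / 2 \<le> real (card E)"
    proof -
      have "real (card E) = (\<Sum>z\<in>Z. real (card {g \<in> E. \<phi> g x0 = z}))"
        using sum_over_orbit_mset[OF finE Z, of \<phi> x0 "\<lambda>_. 1"] EZ x0 by simp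
      moreover have "M - (\<Sum>z\<in>Z. real (card {g \<in> E. \<phi> g x0 = z})) \<le> (\<Sum>z\<in>Z. \<bar>real (card {g \<in> E. \<phi> g x0 = z}) - pt z\<bar>)"
        unfolding ptsum[symmetric] sum_subtractf[symmetric] by (intro sum_mono) auto
      moreover have "3 * s * M \<le> M / 2" using s M mult_right_mono[of "3 * s" "1/2" M] by simp
      ultimately show ?thesis using Ebal[OF x0(1)] by linarith
    qed
    have "real (size (sym_diff_mset (orbit_mset \<phi> E x) (orbit_mset \<phi> E y))) \<le> \<epsilon> * real (card E)"
      if xy: "x \<in> F" "y \<in> F" for x y
    proof -
      have "real (size (sym_diff_mset (orbit_mset \<phi> E x) (orbit_mset \<phi> E y)))
          = (\<Sum>z\<in>Z. \<bar>real (card {g \<in> E. \<phi> g x = z}) - real (card {g \<in> E. \<phi> g y = z})\<bar>)"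
        by (rule size_sym_diff_orbit_mset_sum[OF finE Z]) (use EZ xy in auto)
      also have "\<dots> \<le> (\<Sum>z\<in>Z. \<bar>real (card {g \<in> E. \<phi> g x = z}) - pt z\<bar> + \<bar>real (card {g \<in> E. \<phi> g y = z}) - pt z\<bar>)"
        by (intro sum_mono) linarith
      also have "\<dots> \<le> 3 * s * M + 3 * s * M" unfolding sum.distrib by (intro add_mono Ebal xy)
      also have "\<dots> = 12 * s * (M / 2)" by simp
      also have "\<dots> \<le> \<epsilon> * real (card E)" using s cardE M by (intro mult_mono) auto
      finally show ?thesis .
    qed
    moreover have "E \<noteq> {}" using cardE M by auto
    ultimately show ?thesis using finE E S by blast
  qed
qed

section \<open>The equivalence\<close>

theorem theorem1:
  fixes G :: "('g, 'm) monoid_scheme" and X :: "'x set" and \<phi> :: "'g \<Rightarrow> 'x \<Rightarrow> 'x"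
  assumes "transitive_action G X \<phi>"
    and "countable (carrier G)"
  shows "((\<exists>\<mu>. prob_on G \<mu> \<and> nondegenerate G \<mu> \<and> symmetric_prob G \<mu> \<and> liouville G X \<phi> \<mu>)
          \<longleftrightarrow>
          (\<exists>m. fin_add_prob (carrier G) m \<and>
             (\<forall>x\<in>X. \<forall>y\<in>X. \<forall>A\<subseteq>X. push_measure G \<phi> m x A = push_measure G \<phi> m y A)))
         \<and>
         ((\<exists>m. fin_add_prob (carrier G) m \<and>
             (\<forall>x\<in>X. \<forall>y\<in>X. \<forall>A\<subseteq>X. push_measure G \<phi> m x A = push_measure G \<phi> m y A))
          \<longleftrightarrow>
          (\<forall>\<epsilon>::real. \<epsilon> > 0 \<longrightarrow> (\<forall>F. finite F \<and> F \<subseteq> X \<longrightarrow>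
             (\<exists>E. finite E \<and> E \<noteq> {} \<and> E \<subseteq> carrier G \<and>
                (\<forall>x\<in>F. \<forall>y\<in>F.
                   real (size (sym_diff_mset (orbit_mset \<phi> E x) (orbit_mset \<phi> E y)))
                     \<le> \<epsilon> * real (card E))))))"
proof -
  interpret transitive_action G X \<phi> by fact
  interpret group G using group_hom group_hom.axioms(1) by auto
  have action: "group_action G X \<phi>" by unfold_locales
  let ?L = "\<exists>\<mu>. prob_on G \<mu> \<and> nondegenerate G \<mu> \<and> symmetric_prob G \<mu> \<and> liouville G X \<phi> \<mu>"
  let ?M = "\<exists>m. fin_add_prob (carrier G) m \<and>
     (\<forall>x\<in>X. \<forall>y\<in>X. \<forall>A\<subseteq>X. push_measure G \<phi> m x A = push_measure G \<phi> m y A)"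
  have LM: ?M if ?L using that invariant_mean_of_liouville[OF action] by blast
  have MR: "reiter G X \<phi>" if M: ?M
  proof -
    obtain m where m: "fin_add_prob (carrier G) m"
      "\<forall>x\<in>X. \<forall>y\<in>X. \<forall>A\<subseteq>X. push_measure G \<phi> m x A = push_measure G \<phi> m y A"
      using M by blast
    show ?thesis
    proof (rule reiter_of_invariant_mean[OF _ m(1)])
      show "carrier G \<noteq> {}" using one_closed by blast
      show "\<phi> g x \<in> X" if "g \<in> carrier G" "x \<in> X" for g x using element_image[OF that refl] .
      show "push_measure G \<phi> m x A = push_measure G \<phi> m y A" if "x \<in> X" "y \<in> X" "A \<subseteq> X" for x y A
        using m(2) that by blast
    qed
  qed
  have RL: ?L if "reiter G X \<phi>" using liouville_measure_of_reiter[OF assms that] .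
  have RF: "foelner_sets G X \<phi>" if "reiter G X \<phi>"
    using foelner_sets_of_right_foelner[OF assms(1)] foelner_sets_of_reiter_nonfoelner[OF action that]
    by blast
  have FR: "reiter G X \<phi>" if "foelner_sets G X \<phi>" using that by (rule reiter_of_foelner_sets)
  have "?L \<longleftrightarrow> ?M" using LM MR RL by blast
  moreover have "?M \<longleftrightarrow> foelner_sets G X \<phi>" using LM MR RL RF FR by blast
  ultimately show ?thesis unfolding foelner_sets_def by blast
qed

end
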